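(* Fix $\tau\in(0,1)$ and define, for $N\in\mathbb{N}$, the domains $$\mathcal{D}_N(\tau)=\left[-\tfrac1\tau,\tfrac1\tau\right]+i\left[\tfrac{1}{N^{1-\tau}},\tfrac1\tau\right],\qquad \mathcal{D}^*_N(\tau)=\left[-2+\tau,2-\tau\right]+i\left[\tfrac{1}{N^{1-\tau}},\tfrac1\tau\right].$$ Let $H=(H_N)_N$ be an ensemble of Curie-Weiss type, $G(z)=(H_N-z)^{-1}$, $s(z)=\frac1N\operatorname{tr}G(z)$, let $m$ be the Stieltjes transform of the semicircle distribution, and let $\Lambda(z)=\max_{i,j}|G_{ij}(z)-m(z)\delta_{ij}|$. Write $\eta=\operatorname{Im}z$, $E=\operatorname{Re}z$ and $\kappa=\big||E|-2\big|$. Then $$\max\big(\Lambda(z),|s(z)-m(z)|\big)\prec\frac{\frac{1}{\sqrt{N\eta}}}{\sqrt{\kappa+\eta+\frac{1}{\sqrt{N\eta}}}}\quad\text{uniformly in } z\in\mathcal{D}_N(\tau),$$ and in particular $$\max\big(\Lambda(z),|s(z)-m(z)|\big)\prec\frac{1}{\sqrt{N\eta}}\quad\text{uniformly in } z\in\mathcal{D}^*_N(\tau).$$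
   Context: De-Finetti type: for a finite index set $I$, a family $Y_I=(Y_i)_{i\in I}$ of real random variables on a probability space $(\Omega,\mathcal{A},\mathbb{P})$ is of de-Finetti type with respect to the mixing space $(T,\mathcal{T},\mu,P)$ if $(T,\mathcal{T},\mu)$ is a probability space, $P:T\to\mathcal{M}_1(\mathbb{R})$, $t\mapsto P_t$, is measurable ($\mathcal{M}_1(\mathbb{R})$ = Borel probability measures on $\mathbb{R}$ with the Borel $\sigma$-algebra of the weak topology), and $\mathbb{P}(Y_I\in B)=\int_T P_t^{\otimes I}(B)\,d\mu(t)$ for all measurable $B\subseteq\mathbb{R}^I$, where $P_t^{\otimes I}$ is the product measure. Curie-Weiss type: a sequence $(H_N)_N$ of real symmetric random $N\times N$ matrices is of Curie-Weiss type if (a) for all $N$, $(H_N(i,j))_{1\le i\le j\le N}=(\frac{1}{\sqrt N}X_N(i,j))_{1\le i\le j\le N}$, where $(X_N(i,j))_{1\le i\le j\le N}$ is of de-Finetti type with respect to some mixing space $(T_N,\mathcal{T}_N,\mu_N,P^{(N)})$; and (b) with $m_N^{(\ell)}(t)=\int_{\mathbb{R}}x^\ell\,dP^{(N)}_t(x)$, for every even $p\in\mathbb{N}$ there is $K_p\ge 0$ such that for all $N\in\mathbb{N}$: $\int_{T_N}|m_N^{(1)}(t)|^p\,d\mu_N(t)\le K_pN^{-p/2}$; $\int_{T_N}|1-m_N^{(2)}(t)|^p\,d\mu_N(t)\le K_pN^{-p/2}$; $\sup_{t\in T_N}\int_{\mathbb{R}}|y-m_N^{(1)}(t)|^p\,dP_t^{(N)}(y)\le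 K_p$; $\sup_{t\in T_N}\int_{\mathbb{R}}|y^2-m_N^{(2)}(t)|^p\,dP_t^{(N)}(y)\le K_p$. Stochastic domination: for complex random variables $X^{(N)}(u)$ and non-negative random variables $Y^{(N)}(u)$, $u\in U^{(N)}$, we write $X\prec Y$ uniformly in $u\in U^{(N)}$ if for all $\epsilon,D>0$ there is $C_{\epsilon,D}\ge0$ with $\sup_{u\in U^{(N)}}\mathbb{P}(|X^{(N)}(u)|>N^\epsilon Y^{(N)}(u))\le C_{\epsilon,D}N^{-D}$ for all $N\in\mathbb{N}$. The semicircle distribution has Lebesgue density $x\mapsto\frac{1}{2\pi}\sqrt{(4-x^2)_+}$; the Stieltjes transform of a probability measure $\nu$ on $\mathbb{R}$ is $z\mapsto\int\frac{1}{x-z}\,d\nu(x)$ for $\operatorname{Im}z>0$, so $m(z)=\frac{-z+\sqrt{z^2-4}}{2}$ (branch with $\operatorname{Im}\sqrt{\cdot}>0$). The dependence of $G,s,\Lambda$ on $N$ is suppressed. *)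

theory Defs
  imports "HOL-Probability.Probability" "Jordan_Normal_Form.Gauss_Jordan_Elimination"
begin

section \<open>Families of de-Finetti type\<close>

text \<open>The coarsest topology on the Borel probability measures on the real line for which
  integration of every bounded continuous function is continuous.\<close>

definition weak_topology :: "real measure topology" where
  "weak_topology = topology_generated_by
     {{Q \<in> space (prob_algebra borel). (\<integral>x. f x \<partial>Q) \<in> U} | f U.
        continuous_on UNIV f \<and> bounded (range f) \<and> open (U :: real set)}"

definition weak_borel :: "real measure measure" where
  "weak_borel = sigma (topspace weak_topology) {U. openin weak_topology U}"

lemma topspace_weak_topology: "topspace weak_topology = space (prob_algebra borel)"
proof -
  have "space (prob_algebra borel) \<in>
     {{Q \<in> space (prob_algebra borel). (\<integral>x. f x \<partial>Q) \<in> U} | f U.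
        continuous_on UNIV f \<and> bounded (range f) \<and> open (U :: real set)}"
    by (intro CollectI exI[of _ "\<lambda>_. 0"] exI[of _ UNIV]) auto
  then show ?thesis
    unfolding weak_topology_def topology_generated_by_topspace by blast
qed

lemma space_weak_borel: "space weak_borel = space (prob_algebra borel)"
  unfolding weak_borel_def topspace_weak_topology[symmetric]
  by (rule space_measure_of) (auto dest: openin_subset)

definition de_finetti_type ::
    "'a measure \<Rightarrow> 'i set \<Rightarrow> ('i \<Rightarrow> 'a \<Rightarrow> real) \<Rightarrow> 't measure \<Rightarrow> ('t \<Rightarrow> real measure) \<Rightarrow> bool" where
  "de_finetti_type M I Y T P \<longleftrightarrow>
     finite I \<and> prob_space M \<and> (\<forall>i\<in>I. Y i \<in> borel_measurable M) \<and>
     prob_space T \<and> P \<in> measurable T weak_borel \<and>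
     (\<forall>B \<in> sets (PiM I (\<lambda>_. borel)).
        emeasure M {\<omega> \<in> space M. (\<lambda>i\<in>I. Y i \<omega>) \<in> B}
          = (\<integral>\<^sup>+ t. emeasure (PiM I (\<lambda>_. P t)) B \<partial>T))"

section \<open>Ensembles of Curie-Weiss type\<close>

definition moment :: "real measure \<Rightarrow> nat \<Rightarrow> real" where
  "moment Q l = (\<integral>x. x ^ l \<partial>Q)"

text \<open>The moment bounds are stated with integrals in \<open>[0, \<infinity>]\<close>, so that they cannot hold because of a
  diverging integral: the bounds on the central quantities for \<open>p = 2\<close> force \<open>P N t\<close> to have
  finite moments up to order four, hence \<open>moment (P N t) 1\<close> and \<open>moment (P N t) 2\<close> are
  genuine moments. Matrix indices are \<open>0, \<dots>, N - 1\<close>.\<close>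

definition curie_weiss_type ::
    "'a measure \<Rightarrow> (nat \<Rightarrow> 't measure) \<Rightarrow> (nat \<Rightarrow> 't \<Rightarrow> real measure) \<Rightarrow> (nat \<Rightarrow> 'a \<Rightarrow> real mat) \<Rightarrow> bool"
  where
  "curie_weiss_type M T P H \<longleftrightarrow>
     (\<forall>N\<ge>1. \<forall>\<omega>\<in>space M. H N \<omega> \<in> carrier_mat N N \<and> transpose_mat (H N \<omega>) = H N \<omega>) \<and>
     (\<forall>N\<ge>1. \<exists>X :: nat \<times> nat \<Rightarrow> 'a \<Rightarrow> real.
        de_finetti_type M {(i, j). i \<le> j \<and> j < N} X (T N) (P N) \<and>
        (\<forall>\<omega>\<in>space M. \<forall>i j. i \<le> j \<and> j < N \<longrightarrow>
           H N \<omega> $$ (i, j) = 1 / sqrt (real N) * X (i, j) \<omega>)) \<and>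
     (\<forall>p::nat. even p \<and> p > 0 \<longrightarrow> (\<exists>K\<ge>0::real. \<forall>N\<ge>1.
        (\<integral>\<^sup>+ t. ennreal (\<bar>moment (P N t) 1\<bar> ^ p) \<partial>T N)
          \<le> ennreal (K * real N powr (- real p / 2)) \<and>
        (\<integral>\<^sup>+ t. ennreal (\<bar>1 - moment (P N t) 2\<bar> ^ p) \<partial>T N)
          \<le> ennreal (K * real N powr (- real p / 2)) \<and>
        (SUP t\<in>space (T N). \<integral>\<^sup>+ y. ennreal (\<bar>y - moment (P N t) 1\<bar> ^ p) \<partial>P N t) \<le> ennreal K \<and>
        (SUP t\<in>space (T N). \<integral>\<^sup>+ y. ennreal (\<bar>y\<^sup>2 - moment (P N t) 2\<bar> ^ p) \<partial>P N t) \<le> ennreal K))"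

section \<open>Stochastic domination\<close>

definition stoch_dominated ::
    "'a measure \<Rightarrow> (nat \<Rightarrow> 'u set) \<Rightarrow> (nat \<Rightarrow> 'u \<Rightarrow> 'a \<Rightarrow> complex) \<Rightarrow> (nat \<Rightarrow> 'u \<Rightarrow> 'a \<Rightarrow> real) \<Rightarrow> bool"
  where
  "stoch_dominated M U X Y \<longleftrightarrow>
     (\<forall>N\<ge>1. \<forall>u\<in>U N. X N u \<in> borel_measurable M \<and> Y N u \<in> borel_measurable M \<and>
        (\<forall>\<omega>\<in>space M. Y N u \<omega> \<ge> 0)) \<and>
     (\<forall>\<epsilon>>0::real. \<forall>D>0::real. \<exists>C\<ge>0::real. \<forall>N\<ge>1.
        (SUP u\<in>U N. emeasure M {\<omega> \<in> space M. cmod (X N u \<omega>) > real N powr \<epsilon> * Y N u \<omega>})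
          \<le> ennreal (C * real N powr (- D)))"

section \<open>Semicircle distribution, resolvent, and spectral domains\<close>

definition semicircle :: "real measure" where
  "semicircle = density lborel (\<lambda>x. ennreal (1 / (2 * pi) * sqrt (max 0 (4 - x\<^sup>2))))"

definition stieltjes :: "real measure \<Rightarrow> complex \<Rightarrow> complex" where
  "stieltjes \<nu> z = (\<integral>x. 1 / (complex_of_real x - z) \<partial>\<nu>)"

text \<open>Only used for non-real \<open>z\<close> and symmetric \<open>A\<close>, where the inverse exists.\<close>

definition resolvent :: "real mat \<Rightarrow> complex \<Rightarrow> complex mat" where
  "resolvent A z =
     the (mat_inverse (map_mat complex_of_real A - z \<cdot>\<^sub>m 1\<^sub>m (dim_row A)))"

definition mat_trace :: "complex mat \<Rightarrow> complex" where
  "mat_trace A = (\<Sum>i<dim_row A. A $$ (i, i))"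

definition normalized_trace :: "real mat \<Rightarrow> complex \<Rightarrow> complex" where
  "normalized_trace A z = 1 / of_nat (dim_row A) * mat_trace (resolvent A z)"

definition Lambda :: "real mat \<Rightarrow> complex \<Rightarrow> real" where
  "Lambda A z = Max {cmod (resolvent A z $$ (i, j) - stieltjes semicircle z * (if i = j then 1 else 0))
     | i j. i < dim_row A \<and> j < dim_row A}"

definition spectral_domain :: "real \<Rightarrow> nat \<Rightarrow> complex set" where
  "spectral_domain \<tau> N =
     {z. Re z \<in> {- 1 / \<tau> .. 1 / \<tau>} \<and> Im z \<in> {1 / real N powr (1 - \<tau>) .. 1 / \<tau>}}"

definition bulk_domain :: "real \<Rightarrow> nat \<Rightarrow> complex set" where
  "bulk_domain \<tau> N =
     {z. Re z \<in> {- 2 + \<tau> .. 2 - \<tau>} \<and> Im z \<in> {1 / real N powr (1 - \<tau>) .. 1 / \<tau>}}"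

end

theory Submission
  imports Defs "Jordan_Normal_Form.Determinant"
begin

text \<open>
The proof is the Schur complement argument for local semicircle laws, carried out conditionally on the mixing
parameter. Given \<open>t\<close>, the entries on and above the diagonal are independent with common law \<open>P t\<close>. The
assumptions on the moments say that, outside a set of parameters \<open>t\<close> of negligible measure, the mean of this law
and the deviation of its second moment from 1 are at most of order \<open>N powr (e - 1 / 2)\<close>, for any \<open>e > 0\<close>. It
therefore suffices to prove the law for independent entries of this kind, with constants that depend on moment
bounds only (\<open>local_law_iid_entries\<close>), and to integrate the resulting tail bound over \<open>t\<close>
(\<open>de_finetti_tail\<close>).

For independent entries, row \<open>i\<close> is independent of the minor \<open>H'\<close> obtained by deleting it. The Schur complement
formula (\<open>schur_complement\<close>, \<open>green_off_diagonal\<close>) expresses \<open>G i i\<close> and \<open>G i j\<close> by a quadratic and a linear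
form in the entries of row \<open>i\<close> whose coefficients are entries of the resolvent \<open>G'\<close> of \<open>H'\<close>. Such forms
concentrate: \<open>linear_tail\<close> and \<open>quadratic_tail\<close> bound their deviation, including the bias caused by the small
mean and variance defect, by the Frobenius norm of the coefficients. The Ward identity
\<open>\<Sum>k. \<bar>G i k\<bar>\<^sup>2 = Im (G i i) / \<eta>\<close> converts Frobenius norms into traces. With \<open>r = R / sqrt (N \<eta>)\<close>, where \<open>R\<close>
is a small power of \<open>N\<close>, the outcome is \<open>1 / G i i = - (z + s) + O(r)\<close> and \<open>G i j = O(r)\<close>, provided that the
resolvent obeys rough two-sided bounds. Averaging over \<open>i\<close> gives \<open>s\<^sup>2 + z s + 1 = O(r)\<close>, that is,
\<open>(s - m) (s - 1 / m) = O(r)\<close> (\<open>self_consistent_equation\<close>).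

The two roots satisfy \<open>\<bar>m - 1 / m\<bar>\<^sup>2 = \<bar>z\<^sup>2 - 4\<bar> \<ge> \<kappa> + \<eta>\<close>. So \<open>s\<close> is within \<open>O(r / sqrt (\<kappa> + \<eta> + r))\<close> of
one of the roots, which is the rate of the theorem up to a small power of \<open>N\<close>. That it is the right root,
and that the rough bounds hold, is known at height \<open>\<eta> \<ge> 1\<close>, where the roots lie on different sides of the
real axis at distance at least one (\<open>away_from_axis\<close>). From there both facts are passed down a vertical
line in \<open>N ^ 4\<close> small steps (\<open>branch_step\<close>, \<open>deterministic_local_law\<close>): as long as the gap between the
roots exceeds the error, \<open>s\<close> cannot jump from one root to the other, and once the gap is below the error
it stays so at smaller heights and the choice of the root is immaterial. Only polynomially many events
are involved, so moment bounds of high order and a union bound suffice.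

In the bulk \<open>\<kappa> \<ge> \<tau>\<close>, and the second claim follows from the first.
\<close>

section \<open>The Stieltjes transform of the semicircle distribution\<close>

lemma integral_sin_orthogonal:
  "((\<lambda>t. sin (real (k + 1) * t) * sin t) has_integral (if k = 0 then pi / 2 else 0)) {0..pi}"
proof (cases "k = 0")
  case True
  have "((\<lambda>t. sin t * sin t) has_integral
      ((\<lambda>t. t / 2 - sin (2 * t) / 4) pi - (\<lambda>t. t / 2 - sin (2 * t) / 4) 0)) {0..pi}"
  proof (rule fundamental_theorem_of_calculus)
    fix t :: real
    have "((\<lambda>t. t / 2 - sin (2 * t) / 4) has_real_derivative (1 - cos (2 * t)) / 2) (at t within {0..pi})"
      by (auto intro!: derivative_eq_intros simp: field_simps)
    moreover have "sin t * sin t = (1 - cos (2 * t)) / 2"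
      by (simp add: cos_double_sin power2_eq_square)
    ultimately show "((\<lambda>t. t / 2 - sin (2 * t) / 4) has_vector_derivative sin t * sin t) (at t within {0..pi})"
      by (simp only: has_real_derivative_iff_has_vector_derivative)
  qed simp
  then show ?thesis using True by simp
next
  case False
  let ?F = "\<lambda>t. sin (real k * t) / (2 * real k) - sin (real (k + 2) * t) / (2 * real (k + 2))"
  have "((\<lambda>t. sin (real (k + 1) * t) * sin t) has_integral (?F pi - ?F 0)) {0..pi}"
  proof (rule fundamental_theorem_of_calculus)
    fix t :: real
    have "sin (real (k + 1) * t) * sin t = (cos (real k * t) - cos (real (k + 2) * t)) / 2"
      by (simp add: sin_times_sin algebra_simps)
    moreover have "(?F has_real_derivative (cos (real k * t) - cos (real (k + 2) * t)) / 2) (at t within {0..pi})"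
    proof -
      have "((\<lambda>t. sin (c * t) / (2 * c)) has_real_derivative cos (c * t) / 2) (at t within {0..pi})"
        if "c \<noteq> 0" for c :: real
        using that by (auto intro!: derivative_eq_intros)
      from DERIV_diff[OF this[of "real k"] this[of "real (k + 2)"]] False show ?thesis
        by (simp add: diff_divide_distrib)
    qed
    ultimately show "(?F has_vector_derivative sin (real (k + 1) * t) * sin t) (at t within {0..pi})"
      by (simp only: has_real_derivative_iff_has_vector_derivative)
  qed simp
  moreover have "?F pi - ?F 0 = 0"
    using sin_npi[of k] sin_npi[of "k+2"] by (simp add: algebra_simps)
  ultimately show ?thesis using False by simp
qed

text \<open>A truncation, with its remainder, of the generating function
\<open>\<Sum>k. u\<^sup>k sin ((k + 1) t) = sin t / (1 - 2 u cos t + u\<^sup>2)\<close> of the Chebyshev polynomials of the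
second kind.\<close>

lemma chebyshev_generating_sum:
  fixes u :: complex and t :: real
  shows "(\<Sum>k\<le>n. u ^ k * of_real (sin (real (k + 1) * t))) * (1 - 2 * u * of_real (cos t) + u ^ 2)
    = of_real (sin t) - u ^ (n + 1) * of_real (sin (real (n + 2) * t))
      + u ^ (n + 2) * of_real (sin (real (n + 1) * t))"
proof (induction n)
  case 0
  have "sin (2 * t) = 2 * sin t * cos t" by (rule sin_double)
  then show ?case by (simp add: algebra_simps power2_eq_square)
next
  case (Suc n)
  have "sin (real (n + 3) * t) + sin (real (n + 1) * t) = 2 * cos t * sin (real (n + 2) * t)"
  proof -
    have a: "real (n + 3) * t = real (n + 2) * t + t" "real (n + 1) * t = real (n + 2) * t - t"
      by (simp_all add: algebra_simps)
    show ?thesis unfolding a sin_add sin_diff by simp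
  qed
  then have e: "complex_of_real (sin (real (n + 3) * t)) =
      2 * of_real (cos t) * of_real (sin (real (n + 2) * t)) - of_real (sin (real (n + 1) * t))"
    by (metis (no_types, lifting) add_diff_cancel_right' of_real_diff of_real_mult of_real_numeral)
  let ?D = "1 - 2 * u * of_real (cos t) + u ^ 2"
  have "(\<Sum>k\<le>Suc n. u ^ k * of_real (sin (real (k + 1) * t))) * ?D
     = (\<Sum>k\<le>n. u ^ k * of_real (sin (real (k + 1) * t))) * ?D
       + u ^ Suc n * of_real (sin (real (n + 2) * t)) * ?D"
    by (simp add: distrib_right)
  also have "\<dots> = of_real (sin t) - u ^ (Suc n + 1) * of_real (sin (real (n + 3) * t))
      + u ^ (Suc n + 2) * of_real (sin (real (n + 2) * t))"
    unfolding Suc.IH e by (simp add: algebra_simps power2_eq_square)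
  finally show ?case by (simp add: numeral_eq_Suc)
qed

text \<open>The denominator is the product of \<open>1 - u e\<close> and \<open>1 - u / e\<close> for the point \<open>e = cis t\<close> of the unit circle.\<close>

lemma chebyshev_denominator_bound:
  fixes u :: complex
  assumes "cmod u < 1"
  shows "(1 - cmod u)\<^sup>2 \<le> cmod (1 - 2 * u * of_real (cos t) + u ^ 2)"
proof -
  have "1 - 2 * u * of_real (cos t) + u ^ 2 = (1 - u * cis t) * (1 - u * cis (- t))"
  proof -
    have "cis t + cis (- t) = 2 * of_real (cos t)" by (simp add: complex_eq_iff)
    moreover have "cis t * cis (- t) = 1" by (simp add: cis_mult)
    moreover have "(1 - u * cis t) * (1 - u * cis (- t)) = 1 - u * (cis t + cis (- t)) + u^2 * (cis t * cis (- t))"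
      by (simp add: algebra_simps power2_eq_square)
    ultimately show ?thesis by simp
  qed
  moreover have "1 - cmod u \<le> cmod (1 - u * cis s)" for s
    using norm_triangle_ineq2[of 1 "u * cis s"] by (simp add: norm_mult)
  ultimately show ?thesis
    using assms by (simp add: norm_mult power2_eq_square mult_mono)
qed

text \<open>Orthogonality of the sines leaves only the term \<open>k = 0\<close> of the truncated generating function, and the
remainder decays geometrically in the order of truncation. Hence the integral does not depend on \<open>u\<close>.\<close>

lemma integral_sin_squared_chebyshev:
  fixes u :: complex
  assumes u: "cmod u < 1"
  shows "integral {0..pi} (\<lambda>t. of_real ((sin t)\<^sup>2) / (1 - 2 * u * of_real (cos t) + u ^ 2)) = of_real (pi / 2)"
proof -
  define D where "D t = 1 - 2 * u * of_real (cos t) + u ^ 2" for t :: real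
  define d where "d = (1 - cmod u)\<^sup>2"
  have d: "0 < d" "\<And>t. d \<le> cmod (D t)"
    using u chebyshev_denominator_bound[OF u] by (auto simp: d_def D_def)
  have D0: "D t \<noteq> 0" for t using d(1) d(2)[of t] by auto
  let ?f = "\<lambda>t. of_real ((sin t)\<^sup>2) / D t"
  have int: "?f integrable_on {0..pi}"
    by (rule integrable_continuous_real) (use D0 in \<open>auto intro!: continuous_intros simp: D_def\<close>)
  have bound: "cmod (integral {0..pi} ?f - of_real (pi / 2)) \<le> 2 * cmod u ^ (n + 1) / d * pi" for n
  proof -
    let ?p = "\<lambda>t. \<Sum>k\<le>n. u ^ k * of_real (sin (real (k + 1) * t) * sin t)"
    have "((\<lambda>t. u ^ k * complex_of_real (sin (real (k + 1) * t) * sin t)) has_integral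
        u ^ k * of_real (if k = 0 then pi / 2 else 0)) {0..pi}" for k
      by (intro has_integral_mult_right has_integral_of_real integral_sin_orthogonal)
    then have "(?p has_integral (\<Sum>k\<le>n. u ^ k * of_real (if k = 0 then pi / 2 else 0))) {0..pi}"
      by (intro has_integral_sum) auto
    moreover have "(\<Sum>k\<le>n. u ^ k * complex_of_real (if k = 0 then pi / 2 else 0)) = of_real (pi / 2)"
    proof -
      have "(\<Sum>k\<le>n. u ^ k * complex_of_real (if k = 0 then pi / 2 else 0)) = (\<Sum>k\<le>n. if k = 0 then complex_of_real (pi/2) else 0)"
        by (intro sum.cong) auto
      then show ?thesis by simp
    qed
    ultimately have "(?p has_integral of_real (pi / 2)) {0..pi}" by simp
    from has_integral_diff[OF integrable_integral[OF int] this]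
    have diff: "((\<lambda>t. ?f t - ?p t) has_integral (integral {0..pi} ?f - of_real (pi / 2))) {0..pi}" .
    show ?thesis
    proof -
      have "cmod (?f t - ?p t) \<le> 2 * cmod u ^ (n + 1) / d" for t
      proof -
        let ?r = "u ^ (n + 1) * of_real (sin (real (n + 2) * t)) - u ^ (n + 2) * of_real (sin (real (n + 1) * t))"
        have "?p t = of_real (sin t) * (\<Sum>k\<le>n. u ^ k * of_real (sin (real (k + 1) * t)))"
          by (simp add: sum_distrib_left mult_ac)
        also have "\<dots> = of_real (sin t) * ((of_real (sin t) - ?r) / D t)"
          using chebyshev_generating_sum[of u t n] D0[of t]
          by (simp add: D_def[symmetric] eq_divide_eq diff_diff_eq2)
        finally have "?f t - ?p t = of_real (sin t) * ?r / D t"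
          using D0[of t] by (simp add: field_simps power2_eq_square)
        then have "cmod (?f t - ?p t) = \<bar>sin t\<bar> * cmod ?r / cmod (D t)"
          by (simp add: norm_mult norm_divide)
        also have "\<dots> \<le> 1 * (2 * cmod u ^ (n + 1)) / d"
        proof -
          have "cmod ?r \<le> cmod u ^ (n + 1) * 1 + cmod u ^ (n + 2) * 1"
            by (rule order_trans[OF norm_triangle_ineq4])
              (simp only: norm_mult norm_power norm_of_real, intro add_mono mult_left_mono abs_sin_le_one zero_le_power norm_ge_zero)
          also have "\<dots> \<le> 2 * cmod u ^ (n + 1)"
            using u power_decreasing[of "n+1" "n+2" "cmod u"] by simp
          finally have "cmod ?r \<le> 2 * cmod u ^ (n + 1)" .
          then show ?thesis using d d(2)[of t]
            by (intro frac_le mult_mono) (auto simp: abs_sin_le_one)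
        qed
        finally show ?thesis by simp
      qed
      moreover have "0 \<le> 2 * cmod u ^ (n + 1) / d" using d by simp
      ultimately show ?thesis
        using has_integral_bound_real[OF _ finite.emptyI diff, of "2 * cmod u ^ (n + 1) / d"] by simp
    qed
  qed
  have "(\<lambda>n. 2 * cmod u ^ (n + 1) / d * pi) \<longlonglongrightarrow> 2 * 0 / d * pi"
    using LIMSEQ_ignore_initial_segment[OF LIMSEQ_power_zero[of "cmod u"], of 1] u d
    by (intro tendsto_intros) auto
  then have "cmod (integral {0..pi} ?f - of_real (pi / 2)) \<le> 0"
    using bound by (intro LIMSEQ_le_const[where a = "cmod (integral {0..pi} ?f - of_real (pi / 2))"]) auto
  then show ?thesis by (simp add: D_def)
qed

text \<open>The substitution \<open>x = - 2 cos t\<close> makes the density proportional to \<open>sin t\<close>, and \<open>u + 1 / u = - z\<close> turns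
\<open>x - z\<close> into the Chebyshev denominator divided by \<open>u\<close>.\<close>

lemma semicircle_stieltjes_eq_root:
  assumes z: "Im z > 0" and u: "u \<noteq> 0" "cmod u < 1" "u + 1 / u = - z"
  shows "stieltjes semicircle z = u"
proof -
  define d where "d x = 1 / (2 * pi) * sqrt (max 0 (4 - x\<^sup>2))" for x :: real
  define f where "f x = d x *\<^sub>R (1 / (complex_of_real x - z))" for x
  have zne: "complex_of_real x \<noteq> z" for x using z by auto
  have contd: "continuous_on S d" for S unfolding d_def by (intro continuous_intros) auto
  have contf: "continuous_on S f" for S unfolding f_def
    by (intro continuous_intros contd) (use zne in auto)
  have "stieltjes semicircle z = (\<integral>x. f x \<partial>lborel)"
    unfolding stieltjes_def semicircle_def f_def d_def
    by (subst integral_density) (auto intro!: borel_measurable_continuous_onI continuous_intros simp: zne)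
  also have "\<dots> = (LBINT x=ereal (-2)..ereal 2. f x)"
    unfolding interval_lebesgue_integral_def set_lebesgue_integral_def
  proof (simp, rule Bochner_Integration.integral_cong, simp)
    fix x :: real
    show "f x = indicat_real {-2<..<2} x *\<^sub>R f x"
    proof (cases "x \<in> {-2<..<2}")
      case False
      then have "2 \<le> \<bar>x\<bar>" by auto
      then have "4 \<le> x\<^sup>2" using power_mono[of 2 "\<bar>x\<bar>" 2] by simp
      then show ?thesis by (simp add: f_def d_def)
    qed simp
  qed
  also have "\<dots> = (LBINT t=ereal 0..ereal pi. (2 * sin t) *\<^sub>R f (- 2 * cos t))"
  proof -
    have "(LBINT t=ereal 0..ereal pi. (2 * sin t) *\<^sub>R f (- 2 * cos t)) = (LBINT x=ereal (-2 * cos 0)..ereal (- 2 * cos pi). f x)"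
      by (rule interval_integral_substitution_finite)
        (auto intro!: derivative_eq_intros contf continuous_intros)
    then show ?thesis by simp
  qed
  also have "\<dots> = integral {0..pi} (\<lambda>t. (2 * sin t) *\<^sub>R f (- 2 * cos t))"
    by (intro interval_integral_eq_integral borel_integrable_atLeastAtMost' continuous_intros
        continuous_on_compose2[OF contf[of UNIV]]) auto
  also have "\<dots> = integral {0..pi} (\<lambda>t. of_real (2 / pi) * u * (of_real ((sin t)\<^sup>2) / (1 - 2 * u * of_real (cos t) + u ^ 2)))"
  proof (rule Henstock_Kurzweil_Integration.integral_cong)
    fix t :: real assume t: "t \<in> {0..pi}"
    have s: "sqrt (max 0 (4 - (- 2 * cos t)\<^sup>2)) = 2 * sin t"
    proof -
      have "4 - (- 2 * cos t)\<^sup>2 = (2 * sin t)\<^sup>2"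
        by (simp add: power_mult_distrib sin_squared_eq)
      then have "max 0 (4 - (- 2 * cos t)\<^sup>2) = (2 * sin t)\<^sup>2"
        by (simp only: max_absorb2[OF zero_le_power2])
      then show ?thesis using t sin_ge_zero[of t] by (simp only: real_sqrt_abs) simp
    qed
    have z': "z = - u - 1 / u"
    proof -
      have "z = - (u + 1 / u)" unfolding u(3) by simp
      then show ?thesis by simp
    qed
    have D0: "1 - 2 * u * of_real (cos t) + u ^ 2 \<noteq> 0"
      using chebyshev_denominator_bound[OF u(2), of t] u(2) by auto
    have "1 / (complex_of_real (- 2 * cos t) - z) = u / (1 - 2 * u * of_real (cos t) + u ^ 2)"
    proof -
      have "complex_of_real (- 2 * cos t) - z = (1 - 2 * u * of_real (cos t) + u ^ 2) / u"
        unfolding z' using u(1) by (simp add: field_simps power2_eq_square)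
      then show ?thesis by simp
    qed
    then show "(2 * sin t) *\<^sub>R f (- 2 * cos t) = of_real (2 / pi) * u * (of_real ((sin t)\<^sup>2) / (1 - 2 * u * of_real (cos t) + u ^ 2))"
      unfolding f_def d_def s by (simp add: scaleR_conv_of_real power2_eq_square)
  qed
  also have "\<dots> = of_real (2 / pi) * u * of_real (pi / 2)"
    by (subst integral_mult_right) (simp only: integral_sin_squared_chebyshev[OF u(2)])
  also have "\<dots> = u" by simp
  finally show ?thesis .
qed

text \<open>The two roots of \<open>u\<^sup>2 + z u + 1\<close> have product 1. If both were on the unit circle, they would be
conjugate to each other and their sum \<open>- z\<close> would be real.\<close>

lemma semicircle_root_exists:
  assumes z: "Im z > 0"
  shows "\<exists>u. u \<noteq> 0 \<and> cmod u < 1 \<and> u + 1 / u = - z"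
proof -
  define r where "r = csqrt (z\<^sup>2 - 4)"
  define u where "u = (- z + r) / 2"
  define v where "v = (- z - r) / 2"
  have r2: "r * r = z * z - 4" by (simp add: r_def power2_eq_square[symmetric])
  have uv: "u * v = 1" and s: "u + v = - z"
    using r2 by (simp_all add: u_def v_def field_simps)
  have n: "cmod u * cmod v = 1" using uv by (metis norm_mult norm_one)
  have "cmod u \<noteq> 1"
  proof
    assume a: "cmod u = 1"
    then have "u * cnj u = 1" by (metis complex_norm_square of_real_1 power_one)
    then have "v = cnj u" using uv a by (metis mult_cancel_left norm_eq_zero zero_neq_one)
    then have "Im (u + v) = 0" by simp
    then show False using z s by simp
  qed
  then consider "cmod u < 1" | "cmod v < 1"
    using n by (metis linorder_neqE_linordered_idom mult_less_cancel_left2 norm_ge_zero less_le_not_le mult.right_neutral mult_less_cancel_left_pos zero_less_one order.strict_trans)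
  then show ?thesis
  proof cases
    case 1
    then show ?thesis using uv s
      by (intro exI[of _ u]) (metis mult_zero_left nonzero_mult_div_cancel_left zero_neq_one)
  next
    case 2
    then show ?thesis using uv s
      by (intro exI[of _ v]) (metis add.commute mult.commute mult_zero_left nonzero_mult_div_cancel_left zero_neq_one)
  qed
qed

abbreviation (input) msc :: "complex \<Rightarrow> complex" where "msc \<equiv> stieltjes semicircle"

lemma msc_root:
  assumes "Im z > 0"
  shows "msc z \<noteq> 0" "cmod (msc z) < 1" "msc z + 1 / msc z = - z"
  using semicircle_root_exists[OF assms] semicircle_stieltjes_eq_root[OF assms] by metis+

text \<open>The second root \<open>1 / m\<close> of the quadratic equation lies at depth at least \<open>Im z\<close> below the real axis. The
averaged resolvent has nonnegative imaginary part, so it cannot be close to this root when \<open>Im z\<close> is of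
order one.\<close>

lemma msc_inverse_Im:
  assumes "Im z > 0"
  shows "Im z \<le> - Im (1 / msc z)"
proof -
  let ?m = "msc z"
  note r = msc_root[OF assms]
  have n: "0 < (cmod ?m)\<^sup>2" "(cmod ?m)\<^sup>2 < 1" using r by (auto simp: power_less_one_iff abs_square_less_1)
  have i: "Im (1 / ?m) = - Im ?m / (cmod ?m)\<^sup>2"
    by (simp add: Im_divide cmod_def)
  have e: "Im ?m + Im (1 / ?m) = - Im z" using arg_cong[OF r(3), of Im] by simp
  then have "Im ?m / (cmod ?m)\<^sup>2 = Im z + Im ?m" using i by simp
  then have "Im ?m * (1 - (cmod ?m)\<^sup>2) = Im z * (cmod ?m)\<^sup>2" using n by (simp add: field_simps)
  then have "0 < Im ?m * (1 - (cmod ?m)\<^sup>2)" using assms n by simp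
  then have "Im ?m \<ge> 0" using n by (simp add: zero_less_mult_iff)
  then show "Im z \<le> - Im (1 / ?m)" using e by simp
qed

lemma msc_lower_bound:
  assumes "Im z > 0"
  shows "1 \<le> cmod (msc z) * (cmod z + 1)"
proof -
  let ?m = "msc z"
  note r = msc_root[OF assms]
  have "?m * ?m + 1 = ?m * (?m + 1 / ?m)" using r(1) by (simp add: distrib_left)
  also have "\<dots> = - (?m * z)" using r(3) by simp
  finally have "1 = - (?m * (z + ?m))" by (simp add: algebra_simps eq_neg_iff_add_eq_0)
  then have "1 = cmod (?m * (z + ?m))" by (metis norm_minus_cancel norm_one)
  also have "\<dots> \<le> cmod ?m * (cmod z + cmod ?m)"
    by (simp add: norm_mult mult_left_mono norm_triangle_ineq)
  also have "\<dots> \<le> cmod ?m * (cmod z + 1)" using r(2) by (simp add: mult_left_mono)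
  finally show ?thesis .
qed

lemma msc_norm_gap:
  assumes "Im z > 0"
  shows "1 + Im z \<le> 1 / (cmod (msc z))\<^sup>2"
proof -
  let ?m = "msc z"
  note r = msc_root[OF assms]
  have n: "0 < cmod ?m" "cmod ?m < 1" using r by auto
  have "Im (1 / ?m) = - Im ?m / (cmod ?m)\<^sup>2"
    by (simp add: Im_divide cmod_def)
  then have e: "Im ?m / (cmod ?m)\<^sup>2 - Im ?m = Im z" using arg_cong[OF r(3), of Im] by simp
  have "Im ?m \<le> 1" using n abs_Im_le_cmod[of ?m] by linarith
  moreover have "0 \<le> 1 / (cmod ?m)\<^sup>2 - 1" using n by (simp add: power_le_one)
  ultimately have "Im ?m * (1 / (cmod ?m)\<^sup>2 - 1) \<le> 1 * (1 / (cmod ?m)\<^sup>2 - 1)"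
    by (rule mult_right_mono)
  then show ?thesis using e by (simp add: algebra_simps)
qed

text \<open>The equation \<open>m + 1 / m = - z\<close> at two points gives \<open>(m - m') (1 - 1 / (m m')) = z' - z\<close>. By
\<open>msc_norm_gap\<close> the second factor has modulus at least \<open>h\<close>.\<close>

lemma msc_lipschitz:
  assumes h: "h > 0" "Im z \<ge> h" "Im z' \<ge> h"
  shows "h * cmod (msc z - msc z') \<le> cmod (z - z')"
proof -
  let ?m = "msc z" and ?n = "msc z'"
  have p: "Im z > 0" "Im z' > 0" using h by auto
  note r = msc_root[OF p(1)] msc_root[OF p(2)]
  have "(?m - ?n) * (1 - 1 / (?m * ?n)) = (?m + 1 / ?m) - (?n + 1 / ?n)"
  proof -
    have i: "?m * inverse ?m = 1" "?n * inverse ?n = 1" using r by auto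
    have "(?m - ?n) * (1 - inverse ?m * inverse ?n)
      = ?m - ?n - (?m * inverse ?m) * inverse ?n + (?n * inverse ?n) * inverse ?m"
      by (simp only: algebra_simps) simp
    then show ?thesis unfolding i by (simp add: divide_inverse)
  qed
  then have e: "(?m - ?n) * (1 - 1 / (?m * ?n)) = z' - z" using r by simp
  have "(1 + h)\<^sup>2 \<le> (1 / (cmod ?m)\<^sup>2) * (1 / (cmod ?n)\<^sup>2)"
    unfolding power2_eq_square[of "1+h"] using msc_norm_gap[OF p(1)] msc_norm_gap[OF p(2)] h
    by (intro mult_mono) auto
  then have "(1 + h)\<^sup>2 \<le> (1 / (cmod ?m * cmod ?n))\<^sup>2"
    by (simp add: power2_eq_square field_simps)
  then have "1 + h \<le> 1 / (cmod ?m * cmod ?n)"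
    by (rule power2_le_imp_le) simp
  then have "h \<le> cmod (1 / (?m * ?n)) - cmod 1" by (simp add: norm_divide norm_mult)
  also have "\<dots> \<le> cmod (1 - 1 / (?m * ?n))" by (metis norm_minus_commute norm_triangle_ineq2)
  finally have "h * cmod (?m - ?n) \<le> cmod ((?m - ?n) * (1 - 1 / (?m * ?n)))"
    unfolding norm_mult by (subst mult.commute) (rule mult_left_mono, simp_all)
  then show ?thesis by (simp add: e norm_minus_commute)
qed

text \<open>The discriminant of \<open>m\<^sup>2 + z m + 1\<close>. Its modulus measures how well the two roots are separated, and
by \<open>edge_distance_le\<close> it is at least the distance to the spectral edges.\<close>

lemma msc_root_gap:
  assumes "Im z > 0"
  shows "(cmod (msc z - 1 / msc z))\<^sup>2 = cmod (z\<^sup>2 - 4)"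
proof -
  let ?m = "msc z"
  note r = msc_root[OF assms]
  have "(?m - 1 / ?m)\<^sup>2 = (?m + 1 / ?m)\<^sup>2 - 4" using r(1)
    by (simp add: power2_eq_square field_simps)
  then have "(?m - 1 / ?m)\<^sup>2 = z\<^sup>2 - 4" using r(3) by simp
  then show ?thesis by (metis norm_power)
qed

lemma edge_distance_le:
  assumes "Im z > 0"
  shows "\<bar>\<bar>Re z\<bar> - 2\<bar> + Im z \<le> cmod (z\<^sup>2 - 4)"
proof -
  have key: "\<bar>x - 2\<bar> + y \<le> cmod (Complex x y - 2) * cmod (Complex x y + 2)"
    if "x \<ge> 0" "y > 0" for x y :: real
  proof -
    have a: "\<bar>x - 2\<bar> \<le> cmod (Complex x y - 2)" "y \<le> cmod (Complex x y - 2)"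
      using abs_Re_le_cmod[of "Complex x y - 2"] abs_Im_le_cmod[of "Complex x y - 2"] that by auto
    have "2 \<le> cmod (Complex x y + 2)"
      using abs_Re_le_cmod[of "Complex x y + 2"] that by auto
    then have "cmod (Complex x y - 2) * 2 \<le> cmod (Complex x y - 2) * cmod (Complex x y + 2)"
      by (intro mult_left_mono) auto
    then show ?thesis using a by linarith
  qed
  have f: "cmod (z\<^sup>2 - 4) = cmod (z - 2) * cmod (z + 2)"
    by (simp add: norm_mult[symmetric] algebra_simps power2_eq_square)
  show ?thesis
  proof (cases "Re z \<ge> 0")
    case True
    then show ?thesis using key[of "Re z" "Im z"] assms f by simp
  next
    case False
    have "cmod (Complex (- Re z) (Im z) - 2) = cmod (z + 2)" "cmod (Complex (- Re z) (Im z) + 2) = cmod (z - 2)"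
      by (simp_all add: cmod_def power2_eq_square algebra_simps)
    then show ?thesis using key[of "- Re z" "Im z"] assms f False by (simp add: mult.commute)
  qed
qed

section \<open>Resolvents, minors and the Schur complement\<close>

abbreviation kron :: "nat \<Rightarrow> nat \<Rightarrow> complex" where "kron i j \<equiv> (if i = j then 1 else 0)"

text \<open>The matrix \<open>H - z\<close>. Matrices are functions of two indices below \<open>N\<close> and matrix products are sums over
\<open>{..<N}\<close>; in this form a minor can keep the indices of the full matrix.\<close>

definition spectral_mat :: "(nat \<Rightarrow> nat \<Rightarrow> real) \<Rightarrow> complex \<Rightarrow> nat \<Rightarrow> nat \<Rightarrow> complex" where
  "spectral_mat h z i j = complex_of_real (h i j) - z * kron i j"

definition green :: "nat \<Rightarrow> (nat \<Rightarrow> nat \<Rightarrow> real) \<Rightarrow> complex \<Rightarrow> nat \<Rightarrow> nat \<Rightarrow> complex" where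
  "green N h z i j = resolvent (mat N N (\<lambda>(i, j). h i j)) z $$ (i, j)"

definition symmetric_on :: "nat \<Rightarrow> (nat \<Rightarrow> nat \<Rightarrow> real) \<Rightarrow> bool" where
  "symmetric_on N h \<longleftrightarrow> (\<forall>i<N. \<forall>j<N. h i j = h j i)"

text \<open>A vector \<open>v\<close> in the kernel satisfies \<open>\<langle>v, H v\<rangle> = z \<bar>v\<bar>\<^sup>2\<close>, and the left-hand side is real.\<close>

lemma shifted_mat_det_nonzero:
  assumes sym: "symmetric_on N h" and z: "Im z \<noteq> 0"
  shows "det (mat N N (\<lambda>(i, j). spectral_mat h z i j)) \<noteq> 0"
proof
  let ?A = "mat N N (\<lambda>(i, j). spectral_mat h z i j)"
  assume "det ?A = 0"
  then obtain v where v: "v \<in> carrier_vec N" "v \<noteq> 0\<^sub>v N" "?A *\<^sub>v v = 0\<^sub>v N"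
    using det_0_iff_vec_prod_zero_field[of ?A N] by auto
  define f where "f i = v $ i" for i
  have row: "(\<Sum>j<N. of_real (h i j) * f j) = z * f i" if "i < N" for i
  proof -
    have "0 = (?A *\<^sub>v v) $ i" using v that by simp
    also have "\<dots> = (\<Sum>j<N. spectral_mat h z i j * f j)"
      using v(1) that by (simp add: scalar_prod_def f_def atLeast0LessThan)
    also have "\<dots> = (\<Sum>j<N. of_real (h i j) * f j) - (\<Sum>j<N. z * kron i j * f j)"
      by (simp add: spectral_mat_def left_diff_distrib sum_subtractf)
    also have "(\<Sum>j<N. z * kron i j * f j) = (\<Sum>j<N. if j = i then z * f i else 0)"
      by (rule sum.cong) auto
    also have "\<dots> = z * f i" using that by simp
    finally show ?thesis by simp
  qed
  let ?q = "\<Sum>i<N. \<Sum>j<N. cnj (f i) * of_real (h i j) * f j"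
  let ?n = "\<Sum>i<N. (cmod (f i))\<^sup>2"
  have q: "?q = z * of_real ?n"
  proof -
    have "?q = (\<Sum>i<N. cnj (f i) * (\<Sum>j<N. of_real (h i j) * f j))"
      by (simp add: sum_distrib_left mult.assoc)
    also have "\<dots> = (\<Sum>i<N. z * of_real ((cmod (f i))\<^sup>2))"
    proof (rule sum.cong[OF refl])
      fix k assume "k \<in> {..<N}"
      then have "(\<Sum>j<N. of_real (h k j) * f j) = z * f k" by (intro row) simp
      then show "cnj (f k) * (\<Sum>j<N. of_real (h k j) * f j) = z * of_real ((cmod (f k))\<^sup>2)"
        unfolding complex_norm_square by simp
    qed
    finally show ?thesis by (simp add: sum_distrib_left)
  qed
  have "cnj ?q = (\<Sum>i<N. \<Sum>j<N. cnj (f j) * of_real (h j i) * f i)"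
    using sym by (auto simp: symmetric_on_def intro!: sum.cong)
  also have "\<dots> = ?q" by (rule sum.swap)
  finally have "cnj ?q = ?q" .
  from arg_cong[OF this, of Im] have "- Im ?q = Im ?q" by (simp only: cnj.sel)
  then have "Im ?q = 0" by linarith
  then have "?n = 0" using q z by simp
  then have "f i = 0" if "i < N" for i using that by (simp add: sum_nonneg_eq_0_iff)
  then have "v = 0\<^sub>v N" using v(1) by (intro eq_vecI) (auto simp: f_def)
  then show False using v(2) by simp
qed

lemma resolvent_inverse:
  assumes sym: "symmetric_on N h" and z: "Im z \<noteq> 0"
  defines "R \<equiv> resolvent (mat N N (\<lambda>(i, j). h i j)) z"
    and "A \<equiv> mat N N (\<lambda>(i, j). spectral_mat h z i j)"
  shows "R \<in> carrier_mat N N" "A * R = 1\<^sub>m N" "R * A = 1\<^sub>m N"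
proof -
  let ?H = "mat N N (\<lambda>(i, j). h i j)"
  have A: "map_mat complex_of_real ?H - z \<cdot>\<^sub>m 1\<^sub>m (dim_row ?H) = A"
    unfolding A_def by (intro eq_matI) (auto simp: spectral_mat_def)
  have "A \<in> Units (ring_mat TYPE(complex) N ())"
    using shifted_mat_det_nonzero[OF sym z] det_non_zero_imp_unit[of A N] by (auto simp: A_def)
  then obtain B where B: "mat_inverse A = Some B"
    using mat_inverse(1)[of A N, where b = "()"] by (cases "mat_inverse A") (auto simp: A_def)
  have "R = B" unfolding R_def resolvent_def A B by simp
  then show "R \<in> carrier_mat N N" "A * R = 1\<^sub>m N" "R * A = 1\<^sub>m N"
    using mat_inverse(2)[OF _ B, of N] by (auto simp: A_def)
qed

lemma green_inverse:
  assumes sym: "symmetric_on N h" and z: "Im z \<noteq> 0" and ij: "i < N" "j < N"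
  shows "(\<Sum>k<N. spectral_mat h z i k * green N h z k j) = kron i j"
    and "(\<Sum>k<N. green N h z i k * spectral_mat h z k j) = kron i j"
proof -
  let ?A = "mat N N (\<lambda>(i, j). spectral_mat h z i j)"
  let ?R = "resolvent (mat N N (\<lambda>(i, j). h i j)) z"
  note R = resolvent_inverse[OF sym z]
  have "(?A * ?R) $$ (i, j) = (\<Sum>k<N. spectral_mat h z i k * green N h z k j)"
    using ij R(1) by (auto simp: scalar_prod_def green_def atLeast0LessThan)
  then show "(\<Sum>k<N. spectral_mat h z i k * green N h z k j) = kron i j" using ij by (simp add: R)
  have "(?R * ?A) $$ (i, j) = (\<Sum>k<N. green N h z i k * spectral_mat h z k j)"
    using ij R(1) by (auto simp: scalar_prod_def green_def atLeast0LessThan)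
  then show "(\<Sum>k<N. green N h z i k * spectral_mat h z k j) = kron i j" using ij by (simp add: R)
qed

text \<open>With suitable one-sided inverses this yields the Ward identity (a matrix and its complex conjugate), the
Lipschitz continuity in \<open>z\<close> (two spectral parameters) and the perturbation formulas for minors.\<close>

lemma resolvent_identity:
  fixes A A' G G' :: "nat \<Rightarrow> nat \<Rightarrow> complex"
  assumes 1: "\<And>i j. i < N \<Longrightarrow> j < N \<Longrightarrow> (\<Sum>k<N. A i k * G k j) = kron i j"
    and 2: "\<And>i j. i < N \<Longrightarrow> j < N \<Longrightarrow> (\<Sum>k<N. G' i k * A' k j) = kron i j"
    and ij: "i < N" "j < N"
  shows "G' i j - G i j = (\<Sum>k<N. \<Sum>l<N. G' i k * (A k l - A' k l) * G l j)"
proof -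
  have "(\<Sum>k<N. \<Sum>l<N. G' i k * (A k l * G l j)) = (\<Sum>k<N. G' i k * kron k j)"
    by (simp add: sum_distrib_left[symmetric] 1 ij del: mult_if_delta)
  also have "\<dots> = (\<Sum>k<N. if k = j then G' i j else 0)" by (rule sum.cong) auto
  also have "\<dots> = G' i j" using ij by simp
  finally have a: "(\<Sum>k<N. \<Sum>l<N. G' i k * (A k l * G l j)) = G' i j" .
  have "(\<Sum>k<N. \<Sum>l<N. G' i k * A' k l * G l j) = (\<Sum>l<N. \<Sum>k<N. G' i k * A' k l * G l j)"
    by (rule sum.swap)
  also have "\<dots> = (\<Sum>l<N. kron i l * G l j)"
    by (simp add: sum_distrib_right[symmetric] 2 ij)
  also have "\<dots> = (\<Sum>l<N. if l = i then G i j else 0)" by (rule sum.cong) auto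
  also have "\<dots> = G i j" using ij by simp
  finally have b: "(\<Sum>k<N. \<Sum>l<N. G' i k * A' k l * G l j) = G i j" .
  show ?thesis unfolding a[symmetric] b[symmetric] sum_subtractf[symmetric]
    by (simp add: algebra_simps)
qed

lemma green_unique:
  assumes sym: "symmetric_on N h" and z: "Im z \<noteq> 0" and ij: "i < N" "j < N"
    and 2: "\<And>i j. i < N \<Longrightarrow> j < N \<Longrightarrow> (\<Sum>k<N. F i k * spectral_mat h z k j) = kron i j"
  shows "F i j = green N h z i j"
  using resolvent_identity[where A = "spectral_mat h z" and A' = "spectral_mat h z" and G' = F
      and G = "green N h z" and N = N, OF green_inverse(1)[OF sym z] 2 ij] by simp

lemma spectral_mat_sym:
  "symmetric_on N h \<Longrightarrow> i < N \<Longrightarrow> j < N \<Longrightarrow> spectral_mat h z i j = spectral_mat h z j i"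
  by (auto simp: spectral_mat_def symmetric_on_def)

lemma green_sym:
  assumes sym: "symmetric_on N h" and z: "Im z \<noteq> 0" and ij: "i < N" "j < N"
  shows "green N h z j i = green N h z i j"
proof (rule green_unique[OF sym z ij, where F = "\<lambda>i j. green N h z j i"])
  fix i j assume ij: "i < N" "j < N"
  have "(\<Sum>k<N. green N h z k i * spectral_mat h z k j) = (\<Sum>k<N. spectral_mat h z j k * green N h z k i)"
    by (rule sum.cong) (use spectral_mat_sym[OF sym] ij in \<open>auto simp: mult.commute\<close>)
  then show "(\<Sum>k<N. green N h z k i * spectral_mat h z k j) = kron i j"
    using green_inverse(1)[OF sym z ij(2,1)] by auto
qed

lemma double_sum_diagonal:
  fixes f :: "nat \<Rightarrow> complex"
  assumes "i < N" "\<And>k l. k < N \<Longrightarrow> l < N \<Longrightarrow> F k l = (if k = l then f k else 0)"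
  shows "(\<Sum>k<N. \<Sum>l<N. F k l) = (\<Sum>k<N. f k)"
proof (rule sum.cong, simp)
  fix k assume "k \<in> {..<N}"
  then have "(\<Sum>l<N. F k l) = (\<Sum>l<N. if l = k then f k else 0)"
    by (intro sum.cong) (auto simp: assms)
  then show "(\<Sum>l<N. F k l) = f k" using \<open>k \<in> _\<close> by simp
qed

text \<open>\<open>H - z\<close> and its complex conjugate differ by a multiple of the identity, so the resolvent identity collapses
to a single sum.\<close>

lemma ward_identity:
  assumes sym: "symmetric_on N h" and z: "Im z > 0" and i: "i < N"
  shows "Im (green N h z i i) = Im z * (\<Sum>k<N. (cmod (green N h z i k))\<^sup>2)"
proof -
  let ?G = "green N h z"
  have z0: "Im z \<noteq> 0" using z by simp
  let ?A = "\<lambda>k l. cnj (spectral_mat h z k l)"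
  have "?G i i - cnj (?G i i) = (\<Sum>k<N. \<Sum>l<N. ?G i k * (?A k l - spectral_mat h z k l) * cnj (?G l i))"
  proof (rule resolvent_identity[OF _ _ i i])
    fix i j assume ij: "i < N" "j < N"
    have "(\<Sum>k<N. ?A i k * cnj (?G k j)) = cnj (\<Sum>k<N. spectral_mat h z i k * ?G k j)" by simp
    then show "(\<Sum>k<N. ?A i k * cnj (?G k j)) = kron i j"
      using green_inverse(1)[OF sym z0 ij] by simp
    show "(\<Sum>k<N. ?G i k * spectral_mat h z k j) = kron i j" by (rule green_inverse(2)[OF sym z0 ij])
  qed
  also have "\<dots> = (\<Sum>k<N. 2 * \<i> * of_real (Im z) * of_real ((cmod (?G i k))\<^sup>2))"
  proof (rule double_sum_diagonal[OF i])
    fix k l assume kl: "k < N" "l < N"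
    have "?A k l - spectral_mat h z k l = (if k = l then 2 * \<i> * of_real (Im z) else 0)"
      by (simp add: spectral_mat_def complex_eq_iff)
    then show "?G i k * (?A k l - spectral_mat h z k l) * cnj (?G l i) =
        (if k = l then 2 * \<i> * of_real (Im z) * of_real ((cmod (?G i k))\<^sup>2) else 0)"
      using green_sym[OF sym z0 i kl(1)] unfolding complex_norm_square by auto
  qed
  finally have "Im (?G i i - cnj (?G i i)) = 2 * (\<Sum>k<N. Im z * (cmod (?G i k))\<^sup>2)"
    by (simp add: sum_distrib_left mult.assoc)
  then show ?thesis by (simp add: sum_distrib_left[symmetric])
qed

text \<open>For \<open>j = i\<close> the Ward identity bounds \<open>\<bar>G i i\<bar>\<^sup>2 Im z\<close> by \<open>\<bar>G i i\<bar>\<close>; the other entries follow from the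
diagonal one.\<close>

lemma green_bound:
  assumes sym: "symmetric_on N h" and z: "Im z > 0" and ij: "i < N" "j < N"
  shows "cmod (green N h z i j) \<le> 1 / Im z"
proof -
  let ?G = "green N h z"
  have ward: "(cmod (?G i k))\<^sup>2 * Im z \<le> cmod (?G i i)" if "k < N" for k
  proof -
    have "(cmod (?G i k))\<^sup>2 \<le> (\<Sum>k<N. (cmod (?G i k))\<^sup>2)"
      by (rule member_le_sum) (use that in auto)
    then have "Im z * (cmod (?G i k))\<^sup>2 \<le> Im (?G i i)"
      unfolding ward_identity[OF sym z ij(1)] using z by (intro mult_left_mono) auto
    also have "\<dots> \<le> cmod (?G i i)" using abs_Im_le_cmod[of "?G i i"] by linarith
    finally show ?thesis by (simp add: mult.commute)
  qed
  have d: "cmod (?G i i) * Im z \<le> 1"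
  proof (cases "?G i i = 0")
    case False
    have "cmod (?G i i) * (cmod (?G i i) * Im z) \<le> cmod (?G i i) * 1"
      using ward[OF ij(1)] by (simp add: power2_eq_square mult_ac)
    then show ?thesis using False by (simp add: mult_le_cancel_left)
  qed simp
  have "(cmod (?G i j) * Im z)\<^sup>2 \<le> cmod (?G i i) * Im z"
    using mult_right_mono[OF ward[OF ij(2)], of "Im z"] z by (simp add: power2_eq_square mult_ac)
  also have "\<dots> \<le> 1\<^sup>2" using d by simp
  finally have "cmod (?G i j) * Im z \<le> 1" by (rule power2_le_imp_le) simp
  then show ?thesis using z by (simp add: field_simps)
qed

lemma cauchy_schwarz_sum:
  fixes f g :: "'i \<Rightarrow> complex"
  assumes "(\<Sum>k\<in>K. (cmod (f k))\<^sup>2) \<le> a\<^sup>2" "(\<Sum>k\<in>K. (cmod (g k))\<^sup>2) \<le> b\<^sup>2" "0 \<le> a" "0 \<le> b"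
  shows "cmod (\<Sum>k\<in>K. f k * g k) \<le> a * b"
proof -
  have "cmod (\<Sum>k\<in>K. f k * g k) \<le> (\<Sum>k\<in>K. \<bar>cmod (f k)\<bar> * \<bar>cmod (g k)\<bar>)"
    by (rule order_trans[OF norm_sum]) (simp add: norm_mult)
  also have "\<dots> \<le> L2_set (\<lambda>k. cmod (f k)) K * L2_set (\<lambda>k. cmod (g k)) K"
    by (rule L2_set_mult_ineq)
  also have "\<dots> \<le> a * b"
    unfolding L2_set_def using assms
    by (intro mult_mono) (auto intro!: real_le_lsqrt real_sqrt_ge_zero sum_nonneg)
  finally show ?thesis .
qed

lemma green_lipschitz:
  assumes sym: "symmetric_on N h" and z: "Im z > 0" and w: "Im w > 0" and ij: "i < N" "j < N"
  shows "cmod (green N h z i j - green N h w i j) \<le> cmod (z - w) / (Im z * Im w)"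
proof -
  have z0: "Im z \<noteq> 0" "Im w \<noteq> 0" using z w by auto
  let ?G = "green N h z" and ?F = "green N h w"
  have b: "(\<Sum>k<N. (cmod (green N h u m k))\<^sup>2) \<le> (1 / Im u)\<^sup>2" if "m < N" "Im u > 0" for u m
  proof -
    have "Im u * (\<Sum>k<N. (cmod (green N h u m k))\<^sup>2) \<le> 1 / Im u"
      using ward_identity[OF sym that(2,1)] green_bound[OF sym that(2,1,1)] abs_Im_le_cmod[of "green N h u m m"]
      by linarith
    then show ?thesis using that by (simp add: power2_eq_square field_simps)
  qed
  have "?G i j - ?F i j = (\<Sum>k<N. \<Sum>l<N. ?G i k * (spectral_mat h w k l - spectral_mat h z k l) * ?F l j)"
    by (rule resolvent_identity[OF green_inverse(1)[OF sym z0(2)] green_inverse(2)[OF sym z0(1)] ij])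
  also have "\<dots> = (\<Sum>k<N. (z - w) * (?G i k * ?F k j))"
    by (rule double_sum_diagonal[OF ij(1)]) (auto simp: spectral_mat_def algebra_simps)
  also have "\<dots> = (z - w) * (\<Sum>k<N. ?G i k * ?F j k)"
    unfolding sum_distrib_left by (rule sum.cong) (use green_sym[OF sym z0(2) ij(2)] in auto)
  finally have e: "?G i j - ?F i j = (z - w) * (\<Sum>k<N. ?G i k * ?F j k)" .
  have "cmod (\<Sum>k<N. ?G i k * ?F j k) \<le> 1 / Im z * (1 / Im w)"
    by (rule cauchy_schwarz_sum) (use b z w ij in auto)
  then have "cmod (z - w) * cmod (\<Sum>k<N. ?G i k * ?F j k) \<le> cmod (z - w) * (1 / Im z * (1 / Im w))"
    by (rule mult_left_mono) simp
  then show ?thesis unfolding e norm_mult by simp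
qed

text \<open>Row and column \<open>i\<close> are set to zero instead of being removed. The resolvent of the result is the resolvent of
the usual minor together with the isolated entry \<open>- 1 / z\<close> at \<open>(i, i)\<close>.\<close>

definition minor :: "nat \<Rightarrow> (nat \<Rightarrow> nat \<Rightarrow> real) \<Rightarrow> nat \<Rightarrow> nat \<Rightarrow> real" where
  "minor i h k l = (if k = i \<or> l = i then 0 else h k l)"

lemma minor_sym: "symmetric_on N h \<Longrightarrow> symmetric_on N (minor i h)"
  by (auto simp: symmetric_on_def minor_def)

abbreviation others :: "nat \<Rightarrow> nat \<Rightarrow> nat set" where "others N i \<equiv> {..<N} - {i}"

context
  fixes N :: nat and h :: "nat \<Rightarrow> nat \<Rightarrow> real" and z :: complex and i :: nat
  assumes sym: "symmetric_on N h" and z: "Im z > 0" and i: "i < N"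
begin

private abbreviation (input) "G \<equiv> green N h z"
private abbreviation (input) "G' \<equiv> green N (minor i h) z"

private lemma z0: "Im z \<noteq> 0" using z by simp
private lemma zne: "z \<noteq> 0" using z by auto

lemma green_minor_row:
  assumes j: "j < N"
  shows "G' i j = (if i = j then - 1 / z else 0)" "G' j i = (if i = j then - 1 / z else 0)"
proof -
  have "kron i j = (\<Sum>k<N. spectral_mat (minor i h) z i k * G' k j)"
    using green_inverse(1)[OF minor_sym[OF sym] z0 i j] by simp
  also have "\<dots> = (\<Sum>k<N. if k = i then - z * G' i j else 0)"
    by (rule sum.cong) (auto simp: spectral_mat_def minor_def)
  also have "\<dots> = - z * G' i j" using i by simp
  finally have "- z * G' i j = kron i j" ..
  moreover have "G' i j = (- z * G' i j) / (- z)" using zne by simp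
  ultimately have "G' i j = kron i j / (- z)" by presburger
  then show 1: "G' i j = (if i = j then - 1 / z else 0)" by simp
  then show "G' j i = (if i = j then - 1 / z else 0)"
    using green_sym[OF minor_sym[OF sym] z0 i j] by simp
qed

lemma minor_perturbation:
  assumes kl: "k < N" "l < N"
  shows "G k l - G' k l = - (\<Sum>a<N. \<Sum>b<N. G k a * of_real (h a b - minor i h a b) * G' b l)"
proof -
  have "G k l - G' k l = (\<Sum>a<N. \<Sum>b<N. G k a * (spectral_mat (minor i h) z a b - spectral_mat h z a b) * G' b l)"
    by (rule resolvent_identity[OF green_inverse(1)[OF minor_sym[OF sym] z0] green_inverse(2)[OF sym z0] kl])
  also have "\<dots> = (\<Sum>a<N. \<Sum>b<N. - (G k a * of_real (h a b - minor i h a b) * G' b l))"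
    by (intro sum.cong) (auto simp: spectral_mat_def algebra_simps)
  finally show ?thesis by (simp add: sum_negf)
qed

text \<open>The two matrices differ only in row and column \<open>i\<close>. Since the resolvent of the minor vanishes between \<open>i\<close>
and \<open>l \<noteq> i\<close>, only row \<open>i\<close> of the difference contributes.\<close>

lemma minor_perturbation_column:
  assumes kl: "k < N" "l < N" "l \<noteq> i"
  shows "G k l - G' k l = - G k i * (\<Sum>b\<in>others N i. of_real (h i b) * G' b l)"
proof -
  have "(\<Sum>b<N. G k a * of_real (h a b - minor i h a b) * G' b l)
      = (if a = i then G k i * (\<Sum>b\<in>others N i. of_real (h i b) * G' b l) else 0)" if "a < N" for a
  proof -
    have "(\<Sum>b<N. G k a * of_real (h a b - minor i h a b) * G' b l)
      = (\<Sum>b\<in>others N i. G k a * of_real (h a b - minor i h a b) * G' b l)"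
      by (rule sum.mono_neutral_right) (use green_minor_row[OF kl(2)] kl(3) in auto)
    also have "\<dots> = (\<Sum>b\<in>others N i. if a = i then G k i * (of_real (h i b) * G' b l) else 0)"
      by (rule sum.cong) (auto simp: minor_def)
    finally show ?thesis by (simp add: sum_distrib_left)
  qed
  then have "(\<Sum>a<N. \<Sum>b<N. G k a * of_real (h a b - minor i h a b) * G' b l)
     = (\<Sum>a<N. if a = i then G k i * (\<Sum>b\<in>others N i. of_real (h i b) * G' b l) else 0)"
    by (intro sum.cong) auto
  also have "\<dots> = G k i * (\<Sum>b\<in>others N i. of_real (h i b) * G' b l)" using i by simp
  finally show ?thesis using minor_perturbation[OF kl(1,2)] by simp
qed

text \<open>The resolvent of the minor is a function of the entries outside row and column \<open>i\<close>. Thus, up to the factor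
\<open>G i i\<close>, an off-diagonal entry is a linear form in the entries of row \<open>i\<close> whose coefficients are
independent of that row; in \<open>schur_complement\<close> below the diagonal entry is governed by a quadratic form of
the same kind.\<close>

lemma green_off_diagonal:
  assumes l: "l < N" "l \<noteq> i"
  shows "G i l = - G i i * (\<Sum>b\<in>others N i. of_real (h i b) * G' b l)"
  using minor_perturbation_column[OF i l] green_minor_row(1)[OF l(1)] l(2) by simp

lemma schur_complement:
  "G i i * (of_real (h i i) - z - (\<Sum>k\<in>others N i. \<Sum>l\<in>others N i. of_real (h i k * h i l) * G' k l)) = 1"
proof -
  have row: "(\<Sum>k<N. spectral_mat h z i k * G k i) = 1"
    using green_inverse(1)[OF sym z0 i i] by simp
  have "(\<Sum>k<N. spectral_mat h z i k * G k i)
     = spectral_mat h z i i * G i i + (\<Sum>k\<in>others N i. of_real (h i k) * G k i)"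
    by (subst sum.remove[of _ i]) (use i in \<open>auto simp: spectral_mat_def intro!: sum.cong\<close>)
  also have "(\<Sum>k\<in>others N i. of_real (h i k) * G k i)
    = (\<Sum>k\<in>others N i. of_real (h i k) * (- G i i * (\<Sum>l\<in>others N i. of_real (h i l) * G' l k)))"
    by (rule sum.cong) (use green_off_diagonal green_sym[OF sym z0 i] in auto)
  also have "\<dots> = - G i i * (\<Sum>k\<in>others N i. \<Sum>l\<in>others N i. of_real (h i k * h i l) * G' k l)"
  proof -
    have "(\<Sum>l\<in>others N i. of_real (h i l) * G' l k) = (\<Sum>l\<in>others N i. of_real (h i l) * G' k l)"
      if "k < N" for k
      by (rule sum.cong) (use green_sym[OF minor_sym[OF sym] z0 that] in auto)
    then show ?thesis by (simp add: sum_distrib_left algebra_simps)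
  qed
  finally show ?thesis unfolding row by (simp add: spectral_mat_def algebra_simps)
qed

lemma green_diagonal_nonzero: "G i i \<noteq> 0"
proof
  assume "G i i = 0"
  from schur_complement[unfolded this mult_zero_left] show False by simp
qed

lemma green_minor_entry:
  assumes kl: "k < N" "l < N" "l \<noteq> i"
  shows "G' k l = G k l - G k i * G i l / G i i"
  using minor_perturbation_column[OF kl] green_off_diagonal[OF kl(2,3)] green_diagonal_nonzero
  by (simp add: field_simps)

lemma green_minor_trace:
  "(\<Sum>k\<in>others N i. G' k k) = (\<Sum>k<N. G k k) - (\<Sum>k<N. G i k * G i k) / G i i"
proof -
  have "(\<Sum>k\<in>others N i. G' k k) = (\<Sum>k\<in>others N i. G k k - G i k * G i k / G i i)"
    by (rule sum.cong) (use green_minor_entry green_sym[OF sym z0 i] in auto)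
  also have "\<dots> = (\<Sum>k<N. G k k - G i k * G i k / G i i)"
    by (rule sum.mono_neutral_left) (use green_diagonal_nonzero i in auto)
  finally show ?thesis by (simp add: sum_subtractf sum_divide_distrib)
qed

lemma green_minor_ward:
  assumes k: "k < N" "k \<noteq> i"
  shows "(\<Sum>l\<in>others N i. (cmod (G' k l))\<^sup>2) = Im (G' k k) / Im z"
proof -
  have "(\<Sum>l\<in>others N i. (cmod (G' k l))\<^sup>2) = (\<Sum>l<N. (cmod (G' k l))\<^sup>2)"
    by (rule sum.mono_neutral_left) (use green_minor_row[OF k(1)] k in auto)
  then show ?thesis using ward_identity[OF minor_sym[OF sym] z k(1)] z by (simp add: field_simps)
qed

text \<open>By \<open>green_minor_trace\<close> this is the change of the trace of the resolvent when a row is removed; the Ward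
identity shows that it is bounded by \<open>1 / Im z\<close> without any information on the entries.\<close>

lemma green_square_sum_bound:
  "cmod ((\<Sum>k<N. G i k * G i k) / G i i) \<le> 1 / Im z"
proof -
  have "cmod (\<Sum>k<N. G i k * G i k) \<le> (\<Sum>k<N. (cmod (G i k))\<^sup>2)"
    by (rule order_trans[OF norm_sum]) (simp add: norm_mult power2_eq_square)
  also have "\<dots> = Im (G i i) / Im z" using ward_identity[OF sym z i] z by (simp add: field_simps)
  also have "\<dots> \<le> cmod (G i i) / Im z"
    using abs_Im_le_cmod[of "G i i"] z by (intro divide_right_mono) auto
  finally show ?thesis using green_diagonal_nonzero by (simp add: norm_divide field_simps)
qed

end

section \<open>The self-consistent equation\<close>

definition green_avg :: "nat \<Rightarrow> (nat \<Rightarrow> nat \<Rightarrow> real) \<Rightarrow> complex \<Rightarrow> complex" where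
  "green_avg N h z = (\<Sum>k<N. green N h z k k) / of_nat N"

text \<open>For row \<open>i\<close>, the diagonal entry, the centred quadratic form in the Schur complement and the linear forms of
the off-diagonal entries are at most \<open>R\<close> times their typical size. Nothing else about the distribution of
the entries enters the analysis of the resolvent.\<close>

definition good_row :: "nat \<Rightarrow> (nat \<Rightarrow> nat \<Rightarrow> real) \<Rightarrow> complex \<Rightarrow> real \<Rightarrow> nat \<Rightarrow> bool" where
  "good_row N h z R i \<longleftrightarrow>
     \<bar>h i i\<bar> \<le> R / sqrt N \<and>
     cmod ((\<Sum>k\<in>others N i. \<Sum>l\<in>others N i. of_real (h i k * h i l) * green N (minor i h) z k l)
         - (\<Sum>k\<in>others N i. green N (minor i h) z k k) / of_nat N)
       \<le> R / N * sqrt (\<Sum>k\<in>others N i. \<Sum>l\<in>others N i. (cmod (green N (minor i h) z k l))\<^sup>2) \<and>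
     (\<forall>j\<in>others N i. cmod (\<Sum>k\<in>others N i. of_real (h i k) * green N (minor i h) z k j)
       \<le> R / sqrt N * sqrt (\<Sum>k\<in>others N i. (cmod (green N (minor i h) z k j))\<^sup>2))"

text \<open>The Ward identity for the minor turns the Frobenius norm of its resolvent into the imaginary part of its trace.\<close>

lemma quadratic_form_bound:
  assumes sym: "symmetric_on N h" and z: "Im z > 0" and i: "i < N"
    and good: "good_row N h z R i" and R: "R \<ge> 0"
    and b: "\<And>k. k < N \<Longrightarrow> k \<noteq> i \<Longrightarrow> Im (green N (minor i h) z k k) \<le> b" "b \<ge> 0"
  shows "cmod ((\<Sum>k\<in>others N i. \<Sum>l\<in>others N i. of_real (h i k * h i l) * green N (minor i h) z k l)
         - (\<Sum>k\<in>others N i. green N (minor i h) z k k) / of_nat N) \<le> sqrt b * (R / sqrt (N * Im z))"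
proof -
  let ?G' = "green N (minor i h) z"
  have N: "N > 0" using i by simp
  have "(\<Sum>k\<in>others N i. \<Sum>l\<in>others N i. (cmod (?G' k l))\<^sup>2) = (\<Sum>k\<in>others N i. Im (?G' k k) / Im z)"
    by (rule sum.cong) (use green_minor_ward[OF sym z i] in auto)
  also have "\<dots> \<le> (\<Sum>k\<in>others N i. b / Im z)"
    by (rule sum_mono) (use b z in \<open>auto intro: divide_right_mono\<close>)
  also have "\<dots> \<le> real N * (b / Im z)"
    using z b(2) i by (auto intro!: mult_right_mono divide_right_mono)
  finally have "sqrt (\<Sum>k\<in>others N i. \<Sum>l\<in>others N i. (cmod (?G' k l))\<^sup>2) \<le> sqrt (real N * (b / Im z))"
    by simp
  then have "R / N * sqrt (\<Sum>k\<in>others N i. \<Sum>l\<in>others N i. (cmod (?G' k l))\<^sup>2)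
      \<le> R / N * sqrt (real N * (b / Im z))"
    using R by (intro mult_left_mono) auto
  also have "\<dots> = sqrt b * (R / sqrt (N * Im z))"
  proof -
    have a: "R / (a * a) * sqrt (a * a * (b / Im z)) = sqrt b * (R / sqrt (a * a * Im z))" if "a > 0" for a :: real
    proof -
      have "sqrt (a * a * x) = a * sqrt x" for x using that by (simp add: real_sqrt_mult)
      then show ?thesis using that by (simp add: real_sqrt_divide)
    qed
    show ?thesis using a[of "sqrt N"] N by simp
  qed
  finally show ?thesis using good unfolding good_row_def by linarith
qed

lemma linear_form_bound:
  assumes sym: "symmetric_on N h" and z: "Im z > 0" and i: "i < N"
    and good: "good_row N h z R i" and R: "R \<ge> 0"
    and j: "j < N" "j \<noteq> i" and b: "Im (green N (minor i h) z j j) \<le> b"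
  shows "cmod (\<Sum>k\<in>others N i. of_real (h i k) * green N (minor i h) z k j) \<le> sqrt b * (R / sqrt (N * Im z))"
proof -
  let ?G' = "green N (minor i h) z"
  have N: "N > 0" using i by simp
  have z0: "Im z \<noteq> 0" using z by simp
  have "(\<Sum>k\<in>others N i. (cmod (?G' k j))\<^sup>2) = (\<Sum>k\<in>others N i. (cmod (?G' j k))\<^sup>2)"
    by (rule sum.cong) (use green_sym[OF minor_sym[OF sym] z0 j(1)] in auto)
  also have "\<dots> = Im (?G' j j) / Im z" by (rule green_minor_ward[OF sym z i j])
  also have "\<dots> \<le> b / Im z" using b z by (intro divide_right_mono) auto
  finally have "R / sqrt N * sqrt (\<Sum>k\<in>others N i. (cmod (?G' k j))\<^sup>2) \<le> R / sqrt N * sqrt (b / Im z)"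
    using R by (intro mult_left_mono) auto
  also have "\<dots> = sqrt b * (R / sqrt (N * Im z))" by (simp add: real_sqrt_mult real_sqrt_divide)
  moreover have "cmod (\<Sum>k\<in>others N i. of_real (h i k) * ?G' k j)
      \<le> R / sqrt N * sqrt (\<Sum>k\<in>others N i. (cmod (?G' k j))\<^sup>2)"
    using good j unfolding good_row_def by auto
  ultimately show ?thesis by linarith
qed

text \<open>Here \<open>c\<close> is a lower bound for the diagonal of the resolvent and \<open>T\<^sup>2\<close> an upper bound for \<open>Im z\<close>.\<close>

definition sce_const :: "real \<Rightarrow> real \<Rightarrow> real" where
  "sce_const c T = 2 * (T + 12 / c + 1)"

text \<open>The Schur complement on good rows reads \<open>1 / G i i = - (z + s) + O(r)\<close>. Multiplying by \<open>G i i\<close> and then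
averaging over \<open>i\<close> gives \<open>1 + s (z + s) = O(r)\<close> without a lower bound on \<open>s\<close>, and the left-hand side is
\<open>(s - m) (s - 1 / m)\<close>. The second claim compares \<open>1 / G i i\<close> with \<open>1 / m = - (z + m)\<close>.\<close>

lemma self_consistent_equation:
  fixes N :: nat
  assumes sym: "symmetric_on N h" and z: "Im z > 0" and N: "1 \<le> N * Im z" "Im z \<le> T\<^sup>2" "T \<ge> 1" "N > 0"
    and R: "R \<ge> 1" and good: "\<And>i. i < N \<Longrightarrow> good_row N h z R i"
    and c: "0 < c" "c \<le> 1" "\<And>i. i < N \<Longrightarrow> c \<le> cmod (green N h z i i)"
    and B: "\<And>i j. i < N \<Longrightarrow> j < N \<Longrightarrow> cmod (green N h z i j) \<le> 2"
  defines "r \<equiv> R / sqrt (N * Im z)" and "s \<equiv> green_avg N h z"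
  shows "cmod (s - msc z) * cmod (s - 1 / msc z) \<le> sce_const c T * r"
    and "\<And>i j. i < N \<Longrightarrow> j < N \<Longrightarrow> cmod (green N h z i j - msc z * kron i j) \<le> sce_const c T * (cmod (s - msc z) + r)"
proof -
  define G where "G = green N h z"
  define m where "m = msc z"
  define b where "b = 6 / c"
  note mr = msc_root[OF z, folded m_def]
  have b1: "b \<ge> 1" using c by (simp add: b_def field_simps)
  have sb: "sqrt b \<le> b" using b1 by (intro real_le_lsqrt) (auto simp: power2_eq_square)
  have r0: "r \<ge> 0" using R z by (simp add: r_def)
  have rNz: "1 / (real N * Im z) \<le> r"
  proof -
    have "sqrt (N * Im z) \<le> N * Im z" using N(1)
      by (intro real_le_lsqrt) (auto simp: power2_eq_square intro: mult_left_mono[of 1 "N * Im z" "N * Im z", simplified])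
    then have "1 / (N * Im z) \<le> 1 / sqrt (N * Im z)" using N z by (intro divide_left_mono) auto
    also have "\<dots> \<le> r" using R z unfolding r_def by (intro divide_right_mono) auto
    finally show ?thesis .
  qed
  have Gim: "Im (green N (minor i h) z k k) \<le> b" if "i < N" "k < N" "k \<noteq> i" for i k
  proof -
    have "Im (green N (minor i h) z k k) \<le> cmod (G k k - G k i * G i k / G i i)"
      using green_minor_entry[OF sym z that(1,2,2,3)] abs_Im_le_cmod[of "green N (minor i h) z k k"]
      unfolding G_def by simp
    also have "\<dots> \<le> cmod (G k k) + cmod (G k i) * cmod (G i k) / cmod (G i i)"
      by (rule order_trans[OF norm_triangle_ineq4]) (simp add: norm_mult norm_divide)
    also have "\<dots> \<le> 2 + 2 * 2 / c"
      using B that c(1,3) unfolding G_def by (intro add_mono frac_le mult_mono) auto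
    also have "\<dots> \<le> b" using c by (simp add: b_def field_simps)
    finally show ?thesis .
  qed
  have hii: "\<bar>h i i\<bar> \<le> T * r" if "i < N" for i
  proof -
    have "sqrt (Im z) \<le> T" using N by (intro real_le_lsqrt) auto
    then have "1 / sqrt N \<le> T / sqrt (N * Im z)"
      using z N by (simp add: real_sqrt_mult field_simps)
    then have "R / sqrt N \<le> T * r" using R mult_left_mono[of "1 / sqrt N" "T / sqrt (N * Im z)" R]
      by (simp add: r_def mult.commute)
    then show ?thesis using good[OF that] unfolding good_row_def by linarith
  qed
  define C1 where "C1 = T + b + 1"
  have inv: "cmod (1 / G i i + z + s) \<le> C1 * r" if i: "i < N" for i
  proof -
    let ?Q = "\<Sum>k\<in>others N i. \<Sum>l\<in>others N i. of_real (h i k * h i l) * green N (minor i h) z k l"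
    let ?t = "(\<Sum>k\<in>others N i. green N (minor i h) z k k) / of_nat N"
    have nz: "G i i \<noteq> 0" using green_diagonal_nonzero[OF sym z i] unfolding G_def .
    have "1 / G i i = of_real (h i i) - z - ?Q"
      using schur_complement[OF sym z i] nz unfolding G_def[symmetric]
      by (simp add: divide_eq_eq mult.commute)
    then have "1 / G i i + z + s = of_real (h i i) - (?Q - ?t) + (s - ?t)" by simp
    then have "cmod (1 / G i i + z + s) \<le> \<bar>h i i\<bar> + cmod (?Q - ?t) + cmod (s - ?t)"
      using norm_triangle_ineq[of "of_real (h i i) - (?Q - ?t)" "s - ?t"]
        norm_triangle_ineq4[of "of_real (h i i)" "?Q - ?t"] by (simp only: norm_of_real)
    moreover have "cmod (?Q - ?t) \<le> b * r"
    proof -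
      have "cmod (?Q - ?t) \<le> sqrt b * r" unfolding r_def
        by (rule quadratic_form_bound[OF sym z i good[OF i]]) (use R Gim[OF i] b1 in auto)
      then show ?thesis using mult_right_mono[OF sb r0] by linarith
    qed
    moreover have "cmod (s - ?t) \<le> r"
    proof -
      have "s - ?t = (\<Sum>k<N. G i k * G i k) / G i i / of_nat N"
        using green_minor_trace[OF sym z i] unfolding s_def green_avg_def G_def by (simp add: diff_divide_distrib)
      then have "cmod (s - ?t) \<le> 1 / Im z / N"
        using green_square_sum_bound[OF sym z i]
        by (simp only: G_def norm_divide[of _ "of_nat N"] norm_of_nat divide_right_mono of_nat_0_le_iff)
      then show ?thesis using rNz by (simp add: mult.commute)
    qed
    ultimately show ?thesis using hii[OF i] by (simp add: C1_def algebra_simps)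
  qed
  have K: "sce_const c T = 2 * (C1 + b)" by (simp add: sce_const_def C1_def b_def)
  have C1: "C1 \<ge> 0" using b1 N by (simp add: C1_def)
  have one: "cmod (1 + G i i * (z + s)) \<le> 2 * (C1 * r)" if i: "i < N" for i
  proof -
    have nz: "G i i \<noteq> 0" using green_diagonal_nonzero[OF sym z i] unfolding G_def .
    then have "1 + G i i * (z + s) = G i i * (1 / G i i + z + s)" by (simp add: distrib_left)
    then have "cmod (1 + G i i * (z + s)) = cmod (G i i) * cmod (1 / G i i + z + s)" by (metis norm_mult)
    also have "\<dots> \<le> 2 * (C1 * r)" using B[OF i i] inv[OF i] unfolding G_def[symmetric] by (intro mult_mono) auto
    finally show ?thesis .
  qed
  have fac: "(s - m) * (s - 1 / m) = 1 + s * (z + s)"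
  proof -
    have "(s - m) * (s - p) = s * s - s * (m + p) + m * p" for p by (simp add: algebra_simps)
    from this[of "1 / m"] show ?thesis using mr(1) unfolding mr(3) by (simp add: algebra_simps)
  qed
  have "(\<Sum>i<N. 1 + G i i * (z + s)) = of_nat N * (1 + s * (z + s))"
  proof -
    have "(\<Sum>i<N. G i i) = of_nat N * s" using N(4) by (simp add: s_def green_avg_def G_def)
    then show ?thesis by (simp add: sum.distrib sum_distrib_right[symmetric] distrib_left mult.assoc)
  qed
  then have "real N * cmod (1 + s * (z + s)) = cmod (\<Sum>i<N. 1 + G i i * (z + s))"
    by (simp add: norm_mult)
  also have "\<dots> \<le> (\<Sum>i<N. 2 * (C1 * r))" by (rule sum_norm_le) (use one in auto)
  finally have "cmod (1 + s * (z + s)) \<le> 2 * (C1 * r)" using N(4) by simp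
  moreover have "2 * (C1 * r) \<le> sce_const c T * r"
    unfolding K using b1 r0 by (simp add: algebra_simps)
  ultimately show "cmod (s - msc z) * cmod (s - 1 / msc z) \<le> sce_const c T * r"
    unfolding norm_mult[symmetric] m_def[symmetric] fac by linarith
  fix i j assume ij: "i < N" "j < N"
  show "cmod (green N h z i j - msc z * kron i j) \<le> sce_const c T * (cmod (s - msc z) + r)"
  proof (cases "i = j")
    case True
    have nz: "G i i \<noteq> 0" using green_diagonal_nonzero[OF sym z ij(1)] unfolding G_def .
    have "G i i - m = G i i * m * (1 / m - 1 / G i i)" using nz mr(1) by (simp add: field_simps)
    moreover have "1 / m = - z - m" using mr(3) by (metis add_diff_cancel_left')
    ultimately have "G i i - m = - (G i i * m * ((1 / G i i + z + s) - (s - m)))" by (simp add: algebra_simps)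
    then have "cmod (G i i - m) = cmod (G i i) * cmod m * cmod ((1 / G i i + z + s) - (s - m))"
      by (simp only: norm_minus_cancel norm_mult)
    also have "\<dots> \<le> 2 * 1 * (C1 * r + cmod (s - m))"
      using B[OF ij(1,1)] mr(2) inv[OF ij(1)] norm_triangle_ineq4[of "1 / G i i + z + s" "s - m"]
      unfolding G_def[symmetric] by (intro mult_mono) auto
    also have "\<dots> \<le> sce_const c T * (cmod (s - m) + r)"
    proof -
      have "1 * cmod (s - m) \<le> (C1 + b) * cmod (s - m)" using b1 C1 by (intro mult_right_mono) auto
      moreover have "0 \<le> b * r" using b1 r0 by simp
      ultimately show ?thesis unfolding K by (simp add: algebra_simps)
    qed
    finally show ?thesis using True by (simp add: G_def m_def)
  next
    case False
    have "G i j = - G i i * (\<Sum>k\<in>others N i. of_real (h i k) * green N (minor i h) z k j)"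
      unfolding G_def by (rule green_off_diagonal[OF sym z ij(1,2)]) (use False in auto)
    then have "cmod (G i j) = cmod (G i i) * cmod (\<Sum>k\<in>others N i. of_real (h i k) * green N (minor i h) z k j)"
      by (simp add: norm_mult)
    also have "\<dots> \<le> 2 * (sqrt b * r)" unfolding r_def
      by (intro mult_mono linear_form_bound[OF sym z ij(1) good[OF ij(1)]])
        (use B[OF ij(1,1)] R ij False Gim[OF ij(1,2)] in \<open>auto simp: G_def\<close>)
    also have "\<dots> \<le> 2 * (b * r)" using mult_right_mono[OF sb r0] by simp
    also have "\<dots> \<le> sce_const c T * (cmod (s - m) + r)"
    proof -
      have "0 \<le> C1 * r" "0 \<le> (C1 + b) * cmod (s - m)" using C1 r0 b1 by auto
      then show ?thesis unfolding K by (simp add: algebra_simps)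
    qed
    finally show ?thesis using False by (simp add: G_def m_def)
  qed
qed

lemma green_avg_Im_nonneg:
  assumes "symmetric_on N h" "Im z > 0"
  shows "Im (green_avg N h z) \<ge> 0"
proof -
  have "0 \<le> Im (green N h z k k)" if "k < N" for k
    unfolding ward_identity[OF assms that] using assms by (auto intro!: mult_nonneg_nonneg sum_nonneg)
  then have "0 \<le> (\<Sum>k<N. Im (green N h z k k))" by (intro sum_nonneg) auto
  then show ?thesis by (auto simp: green_avg_def Im_divide_of_nat)
qed

text \<open>At height at least one every term of the Schur complement is bounded, so no prior information on the resolvent
is needed. This starts the descent to small \<open>Im z\<close>.\<close>

lemma diagonal_lower_bound_away_from_axis:
  fixes N :: nat
  assumes sym: "symmetric_on N h" and z: "Im z \<ge> 1" and i: "i < N"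
    and R: "R \<ge> 1" "R / sqrt N \<le> 1" and good: "good_row N h z R i"
  shows "1 / (cmod z + 3) \<le> cmod (green N h z i i)"
proof -
  let ?Q = "\<Sum>k\<in>others N i. \<Sum>l\<in>others N i. of_real (h i k * h i l) * green N (minor i h) z k l"
  let ?t = "(\<Sum>k\<in>others N i. green N (minor i h) z k k) / of_nat N"
  let ?g = "green N h z i i"
  have z0: "Im z > 0" and N: "N > 0" using z i by auto
  have d: "cmod (green N (minor i h) z k k) \<le> 1" if "k < N" for k
  proof -
    have "1 / Im z \<le> 1" using z by simp
    then show ?thesis using green_bound[OF minor_sym[OF sym, of i] z0 that that] by linarith
  qed
  have "cmod (?Q - ?t) \<le> sqrt 1 * (R / sqrt (N * Im z))"
    by (rule quadratic_form_bound[OF sym z0 i good])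
      (use R d in \<open>auto intro: order_trans[OF order_trans[OF abs_ge_self abs_Im_le_cmod]]\<close>)
  also have "\<dots> \<le> R / sqrt N" using R z N by (auto simp: real_sqrt_mult intro!: divide_left_mono)
  finally have q: "cmod (?Q - ?t) \<le> 1" using R by linarith
  have "cmod (\<Sum>k\<in>others N i. green N (minor i h) z k k) \<le> (\<Sum>k\<in>others N i. 1)"
    by (rule sum_norm_le) (use d in auto)
  also have "\<dots> \<le> real N" using i by simp
  finally have t: "cmod ?t \<le> 1" using N by (simp add: norm_divide)
  have hii: "\<bar>h i i\<bar> \<le> 1" using good R unfolding good_row_def by linarith
  have "cmod (of_real (h i i) - z - ?Q) \<le> cmod z + 3"
  proof -
    have "of_real (h i i) - z - ?Q = of_real (h i i) - (z + (?Q - ?t) + ?t)" by simp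
    then have "cmod (of_real (h i i) - z - ?Q) \<le> \<bar>h i i\<bar> + (cmod z + cmod (?Q - ?t) + cmod ?t)"
      using norm_triangle_ineq4[of "of_real (h i i)" "z + (?Q - ?t) + ?t"]
        norm_triangle_ineq[of "z + (?Q - ?t)" ?t] norm_triangle_ineq[of z "?Q - ?t"]
      by (simp only: norm_of_real)
    then show ?thesis using q t hii by linarith
  qed
  then have "cmod ?g * cmod (of_real (h i i) - z - ?Q) \<le> cmod ?g * (cmod z + 3)"
    by (rule mult_left_mono) simp
  moreover have "cmod ?g * cmod (of_real (h i i) - z - ?Q) = 1"
    using arg_cong[OF schur_complement[OF sym z0 i], of cmod] by (simp only: norm_mult norm_one)
  ultimately have "1 \<le> cmod ?g * (cmod z + 3)" by simp
  moreover have "0 < cmod z + 3" by (simp add: add_nonneg_pos)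
  ultimately show ?thesis by (simp add: divide_le_eq)
qed

section \<open>Stability of the quadratic equation\<close>

text \<open>Here \<open>a\<close> and \<open>b\<close> are the distances from \<open>s\<close> to the two roots and \<open>g\<close> is the distance between the roots. If
\<open>g\<^sup>2 > 16 K r\<close>, the roots are well separated compared to the error, and the assumption that \<open>s\<close> is not
too far from the right one improves itself. Otherwise both roots approximate \<open>s\<close> to order \<open>sqrt (K r)\<close>, and
it does not matter which one is closer. The last claim unites both cases.\<close>

lemma root_selection:
  fixes a b g K r :: real
  assumes ab: "a * b \<le> K * r" and nn: "a \<ge> 0" "b \<ge> 0" "g \<ge> 0" and tri: "g \<le> a + b" "a \<le> b + g"
    and K: "K \<ge> 1" "r \<ge> 0" and sel: "g\<^sup>2 > 16 * K * r \<Longrightarrow> a \<le> g / 4"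
  shows "g\<^sup>2 > 16 * K * r \<Longrightarrow> a \<le> g / 8"
    and "a \<le> 5 * sqrt (K * r)"
    and "x \<le> g\<^sup>2 + r \<Longrightarrow> a * sqrt x \<le> 25 * K * r"
proof -
  define q where "q = sqrt (K * r)"
  have q: "q \<ge> 0" "q * q = K * r" using K by (auto simp: q_def)
  have rK: "r \<le> K * r" using K mult_right_mono[of 1 K r] by simp
  have sep: "a * g \<le> 4 / 3 * (K * r) \<and> g > 0" if "g\<^sup>2 > 16 * K * r"
  proof -
    have "a * (3 / 4 * g) \<le> a * b" using sel[OF that] tri nn by (intro mult_left_mono) auto
    moreover have "g \<noteq> 0" using that q(2) mult_nonneg_nonneg[OF q(1) q(1)] by auto
    ultimately show ?thesis using ab nn by simp
  qed
  show 1: "a \<le> g / 8" if "g\<^sup>2 > 16 * K * r"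
  proof -
    have "4 / 3 * (K * r) \<le> g / 8 * g" using that zero_le_square[of g] unfolding power2_eq_square by linarith
    then have "a * g \<le> g / 8 * g" using sep[OF that] by linarith
    then show ?thesis using sep[OF that] by (intro mult_right_le_imp_le[of a g "g / 8"]) auto
  qed
  have le4: "g \<le> 4 * q" if "\<not> g\<^sup>2 > 16 * K * r"
  proof -
    have "g\<^sup>2 \<le> (4 * q)\<^sup>2" using that q(2) by (simp add: power2_eq_square)
    then show ?thesis using q by (intro power2_le_imp_le[of g "4 * q"]) auto
  qed
  show 2: "a \<le> 5 * sqrt (K * r)" unfolding q_def[symmetric]
  proof (cases "g\<^sup>2 > 16 * K * r")
    case True
    then have "(4 * q)\<^sup>2 < g\<^sup>2" using q(2) by (simp add: power2_eq_square)
    then have "4 * q < g" by (rule power2_less_imp_less[OF _ nn(3)])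
    then have "a * (4 * q) \<le> a * g" using nn by (intro mult_left_mono) auto
    then have "a * (4 * q) \<le> 4 / 3 * (q * q)" using sep[OF True] q by simp
    then have "a * q \<le> q / 3 * q" by simp
    show "a \<le> 5 * q"
    proof (cases "q = 0")
      case True
      have "a * g \<le> 4 / 3 * (q * q)" using sep[OF \<open>16 * K * r < g\<^sup>2\<close>] unfolding q(2) by blast
      then have "a * g \<le> 0" using True by simp
      then have "a = 0" using sep[OF \<open>16 * K * r < g\<^sup>2\<close>] nn by (simp add: mult_le_0_iff)
      then show ?thesis using q by simp
    next
      case False
      then have "a \<le> q / 3" using \<open>a * q \<le> q / 3 * q\<close> q(1)
        by (intro mult_right_le_imp_le[of a q "q / 3"]) auto
      then show ?thesis using q by simp
    qed
  next
    case False
    show "a \<le> 5 * q"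
    proof (rule ccontr)
      assume "\<not> a \<le> 5 * q"
      then have a: "5 * q < a" "q < b" using le4[OF False] tri by auto
      then have "q * q < a * b" using q by (intro mult_strict_mono) auto
      then show False using ab q by simp
    qed
  qed
  show "a * sqrt x \<le> 25 * K * r" if x: "x \<le> g\<^sup>2 + r"
  proof (cases "g\<^sup>2 > 16 * K * r")
    case True
    have Kr: "0 \<le> K * r" using K by simp
    have "16 * (K * r) < g\<^sup>2" using True by simp
    then have "r \<le> g\<^sup>2" using rK Kr by linarith
    then have "x \<le> 2 * g\<^sup>2" using x by simp
    also have "\<dots> \<le> (2 * g)\<^sup>2" by (simp add: power2_eq_square)
    finally have "sqrt x \<le> 2 * g" using nn by (intro real_le_lsqrt) auto
    then have "a * sqrt x \<le> a * (2 * g)" using nn by (intro mult_left_mono) auto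
    then show ?thesis using sep[OF True] Kr by (simp add: mult.assoc mult.left_commute)
  next
    case False
    have "x \<le> 17 * (K * r)" using False x rK by simp
    also have "\<dots> \<le> (5 * q)\<^sup>2" using q(2) mult_nonneg_nonneg[OF q(1) q(1)] by (simp add: power2_eq_square)
    finally have "sqrt x \<le> 5 * q" using q by (intro real_le_lsqrt) auto
    then have "a * sqrt x \<le> a * (5 * q)" using nn by (intro mult_left_mono)
    also have "\<dots> \<le> (5 * q) * (5 * q)" using 2 q(1) unfolding q_def[symmetric] by (intro mult_right_mono) auto
    finally have "a * sqrt x \<le> (5 * q) * (5 * q)" .
    then show ?thesis using q by simp
  qed
qed

text \<open>The expression under the square root in the local law: distance to the spectral edges, height and noise.\<close>

definition edge_scale :: "nat \<Rightarrow> complex \<Rightarrow> real" where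
  "edge_scale N z = \<bar>\<bar>Re z\<bar> - 2\<bar> + Im z + 1 / sqrt (N * Im z)"

definition root_gap :: "complex \<Rightarrow> real" where
  "root_gap z = cmod (msc z - 1 / msc z)"

text \<open>What is propagated from one height to the next: a crude bound for all entries and, where the two roots are
separated, the fact that \<open>s\<close> belongs to the right one.\<close>

definition on_branch :: "real \<Rightarrow> real \<Rightarrow> nat \<Rightarrow> (nat \<Rightarrow> nat \<Rightarrow> real) \<Rightarrow> real \<Rightarrow> complex \<Rightarrow> bool" where
  "on_branch c K N h R z \<longleftrightarrow>
     (\<forall>i<N. \<forall>j<N. cmod (green N h z i j - msc z * kron i j) \<le> c / 2) \<and>
     ((root_gap z)\<^sup>2 > 16 * K * (R / sqrt (N * Im z)) \<longrightarrow> cmod (green_avg N h z - msc z) \<le> root_gap z / 8)"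

text \<open>The self-improving step. Rough two-sided bounds on the resolvent and the right choice of the root imply the
final estimates at the same point, hence again the rough information with room to spare.\<close>

lemma local_law_at_point:
  fixes N :: nat
  assumes sym: "symmetric_on N h" and z: "Im z > 0" and N: "1 \<le> N * Im z" "Im z \<le> T\<^sup>2" "T \<ge> 1" "N > 0"
    and R: "R \<ge> 1" and good: "\<And>i. i < N \<Longrightarrow> good_row N h z R i"
    and c: "0 < c" "c \<le> 1" "\<And>i. i < N \<Longrightarrow> c \<le> cmod (green N h z i i)"
    and B: "\<And>i j. i < N \<Longrightarrow> j < N \<Longrightarrow> cmod (green N h z i j) \<le> 2"
  defines "r \<equiv> R / sqrt (N * Im z)" and "s \<equiv> green_avg N h z" and "K \<equiv> sce_const c T"
  assumes sel: "(root_gap z)\<^sup>2 > 16 * K * r \<Longrightarrow> cmod (s - msc z) \<le> root_gap z / 4"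
    and small: "sqrt r \<le> c / (12 * K\<^sup>2)"
    and X: "edge_scale N z \<le> X\<^sup>2" "X \<ge> 1"
  shows "on_branch c K N h R z"
    and "cmod (s - msc z) \<le> K * (25 * K + X) * (r / sqrt (edge_scale N z))"
    and "\<And>i j. i < N \<Longrightarrow> j < N \<Longrightarrow> cmod (green N h z i j - msc z * kron i j) \<le> K * (25 * K + X) * (r / sqrt (edge_scale N z))"
proof -
  define a where "a = cmod (s - msc z)"
  define g where "g = root_gap z"
  define x where "x = edge_scale N z"
  have sce1: "a * cmod (s - 1 / msc z) \<le> K * r" unfolding a_def r_def s_def K_def
    by (rule self_consistent_equation(1)[OF sym z N R good c B])
  have sce2: "cmod (green N h z i j - msc z * kron i j) \<le> K * (a + r)" if "i < N" "j < N" for i j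
    unfolding a_def r_def s_def K_def
    by (rule self_consistent_equation(2)[OF sym z N R good c B that])
  have K1: "K \<ge> 1" using c N by (simp add: K_def sce_const_def add_increasing2)
  have r: "r \<ge> 0" using R z by (simp add: r_def)
  have rx: "1 / sqrt (N * Im z) \<le> r" using R z unfolding r_def by (intro divide_right_mono) auto
  have x0: "x > 0" using z N by (auto simp: x_def edge_scale_def intro!: add_nonneg_pos)
  have xg: "x \<le> g\<^sup>2 + r"
    using edge_distance_le[OF z] msc_root_gap[OF z] rx by (simp add: x_def g_def edge_scale_def root_gap_def)
  have tri: "g \<le> a + cmod (s - 1 / msc z)" "a \<le> cmod (s - 1 / msc z) + g"
    using norm_triangle_ineq4[of "s - 1 / msc z" "s - msc z"] norm_triangle_ineq4[of "s - 1 / msc z" "msc z - 1 / msc z"]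
    by (simp_all add: a_def g_def root_gap_def)
  have g0: "g \<ge> 0" by (simp add: g_def root_gap_def)
  have sel': "16 * K * r < g\<^sup>2 \<Longrightarrow> a \<le> g / 4" using sel by (simp add: a_def g_def)
  have rs1: "16 * K * r < g\<^sup>2 \<Longrightarrow> a \<le> g / 8" and rs2: "a \<le> 5 * sqrt (K * r)" and rs3: "a * sqrt x \<le> 25 * K * r"
    using root_selection[OF sce1 _ _ g0 tri K1 r sel'] xg by (auto simp: a_def)
  have sq: "sqrt r \<le> 1 \<and> r \<le> sqrt r"
  proof -
    have "1 * 1 \<le> K * K" using K1 by (intro mult_mono) auto
    then have "c / (12 * K\<^sup>2) \<le> 1" using c K1 by (auto simp: divide_le_eq power2_eq_square)
    then have 1: "sqrt r \<le> 1" using small by linarith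
    have "sqrt r * sqrt r \<le> sqrt r * 1" using 1 r by (intro mult_left_mono) auto
    then show ?thesis using 1 r by simp
  qed
  have "K * (a + r) \<le> c / 2"
  proof -
    have "sqrt (K * r) \<le> K * sqrt r"
      using K1 r by (auto simp: real_sqrt_mult power2_eq_square intro!: mult_right_mono real_le_lsqrt)
    moreover have "sqrt r \<le> K * sqrt r" using K1 r mult_right_mono[of 1 K "sqrt r"] by simp
    ultimately have "a + r \<le> 6 * (K * sqrt r)" using rs2 sq by linarith
    then have "K * (a + r) \<le> K * (6 * (K * sqrt r))" using K1 by (intro mult_left_mono) auto
    also have "\<dots> = 6 * K\<^sup>2 * sqrt r" by (simp add: power2_eq_square)
    also have "\<dots> \<le> 6 * K\<^sup>2 * (c / (12 * K\<^sup>2))" using small by (intro mult_left_mono) auto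
    also have "\<dots> = c / 2" using K1 by (simp add: field_simps)
    finally show ?thesis .
  qed
  then have "cmod (green N h z i j - msc z * kron i j) \<le> c / 2" if "i < N" "j < N" for i j
    using sce2[OF that] by linarith
  then show "on_branch c K N h R z"
    using rs1 unfolding on_branch_def a_def g_def r_def s_def by blast
  have ar: "a \<le> 25 * K * (r / sqrt x)" using rs3 x0 by (simp add: pos_le_divide_eq mult_ac)
  have "sqrt x \<le> X" using X by (intro real_le_lsqrt) (auto simp: x_def)
  then have "r * sqrt x \<le> X * r" using mult_right_mono[of "sqrt x" X r] r by (simp add: mult.commute)
  then have rX: "r \<le> X * (r / sqrt x)" using x0 by (simp add: pos_le_divide_eq)
  have fin: "K * (a + r) \<le> K * (25 * K + X) * (r / sqrt x)"
    using mult_left_mono[OF add_mono[OF ar rX], of K] K1 by (simp add: algebra_simps)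
  then show "\<And>i j. i < N \<Longrightarrow> j < N \<Longrightarrow> cmod (green N h z i j - msc z * kron i j) \<le> K * (25 * K + X) * (r / sqrt (edge_scale N z))"
    using sce2 unfolding x_def by (meson order_trans)
  have "a \<le> K * (a + r)" using K1 r mult_right_mono[of 1 K "a + r"] by (simp add: a_def)
  then show "cmod (s - msc z) \<le> K * (25 * K + X) * (r / sqrt (edge_scale N z))"
    using fin unfolding x_def a_def by linarith
qed

section \<open>Descent along vertical lines\<close>

abbreviation rate :: "real \<Rightarrow> nat \<Rightarrow> complex \<Rightarrow> real" where
  "rate R N z \<equiv> R / sqrt (N * Im z) / sqrt (edge_scale N z)"

abbreviation semicircle_close :: "nat \<Rightarrow> (nat \<Rightarrow> nat \<Rightarrow> real) \<Rightarrow> complex \<Rightarrow> real \<Rightarrow> bool" where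
  "semicircle_close N h z b \<equiv> cmod (green_avg N h z - msc z) \<le> b \<and>
     (\<forall>i<N. \<forall>j<N. cmod (green N h z i j - msc z * kron i j) \<le> b)"

text \<open>Both \<open>\<bar>z - 2\<bar>\<close> and \<open>\<bar>z + 2\<bar>\<close> shrink when \<open>z\<close> moves down. As the noise grows at the same time, roots that are
separated at some height have been separated at all greater heights, so the choice of the root can be carried
down from the top.\<close>

lemma root_gap_mono:
  assumes "Re z = Re w" "0 < Im w" "Im w \<le> Im z"
  shows "root_gap w \<le> root_gap z"
proof -
  have p: "(root_gap u)\<^sup>2 = cmod (u - 2) * cmod (u + 2)" if "Im u > 0" for u
    using msc_root_gap[OF that]
    by (simp add: root_gap_def norm_mult[symmetric] algebra_simps power2_eq_square)
  have "cmod (w - 2) \<le> cmod (z - 2)" "cmod (w + 2) \<le> cmod (z + 2)"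
    using assms by (auto simp: cmod_def intro!: add_left_mono power_mono)
  then have "(root_gap w)\<^sup>2 \<le> (root_gap z)\<^sup>2"
    using assms by (subst (1 2) p) (auto intro!: mult_mono)
  then show ?thesis by (rule power2_le_imp_le) (simp add: root_gap_def)
qed

text \<open>Only the square of the gap is Lipschitz in \<open>z\<close>; the square root is handled by
\<open>(g - g')\<^sup>2 \<le> g\<^sup>2 - g'\<^sup>2\<close> for \<open>g \<ge> g' \<ge> 0\<close>.\<close>

lemma root_gap_close:
  assumes "Im z > 0" "Im w > 0" "cmod z \<le> Z" "cmod w \<le> Z" "cmod (z - w) \<le> e\<^sup>2" "e \<ge> 0"
  shows "root_gap z \<le> root_gap w + (Z + 1) * e"
proof (cases "root_gap z \<le> root_gap w")
  case True
  have "0 \<le> (Z + 1) * e" using assms norm_ge_zero[of z] by (intro mult_nonneg_nonneg) linarith+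
  then show ?thesis using True by linarith
next
  case False
  have w0: "root_gap w \<ge> 0" by (simp add: root_gap_def)
  have Z: "Z \<ge> 0" using assms norm_ge_zero[of z] by linarith
  have "(root_gap z - root_gap w)\<^sup>2 \<le> (root_gap z)\<^sup>2 - (root_gap w)\<^sup>2"
  proof -
    have "root_gap w * root_gap w \<le> root_gap z * root_gap w" using False w0 by (intro mult_right_mono) auto
    then show ?thesis by (simp add: power2_eq_square algebra_simps)
  qed
  also have "\<dots> = cmod (z\<^sup>2 - 4) - cmod (w\<^sup>2 - 4)"
    using msc_root_gap assms by (simp add: root_gap_def)
  also have "\<dots> \<le> cmod ((z\<^sup>2 - 4) - (w\<^sup>2 - 4))" by (rule norm_triangle_ineq2)
  also have "\<dots> = cmod (z - w) * cmod (z + w)"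
    by (simp add: norm_mult[symmetric] algebra_simps power2_eq_square)
  also have "\<dots> \<le> e\<^sup>2 * (2 * Z)"
    using assms norm_triangle_ineq[of z w] by (intro mult_mono) auto
  also have "\<dots> \<le> ((Z + 1) * e)\<^sup>2"
  proof -
    have "2 * Z \<le> (Z + 1)\<^sup>2" by (simp add: power2_eq_square algebra_simps)
    then have "e\<^sup>2 * (2 * Z) \<le> e\<^sup>2 * (Z + 1)\<^sup>2" by (intro mult_left_mono) auto
    then show ?thesis by (simp add: power_mult_distrib mult.commute)
  qed
  finally have "root_gap z - root_gap w \<le> (Z + 1) * e"
    by (rule power2_le_imp_le) (use assms Z in auto)
  then show ?thesis by simp
qed

lemma green_avg_lipschitz:
  assumes sym: "symmetric_on N h" and z: "Im z > 0" and w: "Im w > 0" and N: "N > 0"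
  shows "cmod (green_avg N h z - green_avg N h w) \<le> cmod (z - w) / (Im z * Im w)"
proof -
  have "green_avg N h z - green_avg N h w = (\<Sum>k<N. green N h z k k - green N h w k k) / of_nat N"
    by (simp add: green_avg_def sum_subtractf diff_divide_distrib)
  moreover have "cmod (\<Sum>k<N. green N h z k k - green N h w k k) \<le> (\<Sum>k<N. cmod (z - w) / (Im z * Im w))"
    by (rule sum_norm_le) (use green_lipschitz[OF sym z w] in auto)
  ultimately show ?thesis using N by (simp add: norm_divide divide_le_eq mult.commute)
qed

text \<open>One step of the descent changes resolvent and \<open>m\<close> by at most \<open>1 / N\<^sup>2\<close>. This is far below both margins: the
crude bound on the entries has slack \<open>c / 2\<close>, and where the roots count as separated their gap is at least
\<open>1 / N\<close>.\<close>

lemma branch_step: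
  fixes N :: nat and Z :: real
  assumes sym: "symmetric_on N h" and br: "on_branch c K N h R z"
    and zw: "Re z = Re w" "1 / N \<le> Im w" "Im w \<le> Im z" "Im w \<le> 1" "cmod (z - w) \<le> 1 / N ^ 4"
    and Z: "cmod z \<le> Z" "cmod w \<le> Z" and c: "0 < c" "c \<le> 1 / (2 * (Z + 1))"
    and N: "N \<ge> 1" "4 / c \<le> N" "Z + 17 \<le> N" and KR: "K \<ge> 1" "R \<ge> 1"
  shows "\<And>i. i < N \<Longrightarrow> c \<le> cmod (green N h w i i)"
    and "\<And>i j. i < N \<Longrightarrow> j < N \<Longrightarrow> cmod (green N h w i j) \<le> 2"
    and "(root_gap w)\<^sup>2 > 16 * K * (R / sqrt (N * Im w)) \<Longrightarrow> cmod (green_avg N h w - msc w) \<le> root_gap w / 4"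
proof -
  define e where "e = 1 / (real N)\<^sup>2"
  have N0: "real N \<ge> 1" using N by simp
  have e: "e > 0" "e\<^sup>2 = 1 / N ^ 4" using N by (simp_all add: e_def power_divide)
  have eN: "e * N = 1 / N" using N by (simp add: e_def power2_eq_square)
  have e1N: "e \<le> 1 / N" using eN N0 mult_left_mono[OF N0, of e] e by simp
  have i0: "0 < 1 / real N" using N by simp
  have w0: "Im w > 0" "Im z > 0" using zw i0 by linarith+
  have Zp: "Z \<ge> 0" using Z norm_ge_zero[of z] by linarith
  have "1 / (2 * (Z + 1)) \<le> 1 / 2" using Zp by (intro divide_left_mono) auto
  then have c1: "c \<le> 1 / 2" using c by linarith
  have lip: "cmod (z - w) / (Im z * Im w) \<le> e"
  proof -
    have "1 / real N * (1 / N) \<le> Im z * Im w" using zw i0 w0 by (intro mult_mono) auto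
    then have "cmod (z - w) / (Im z * Im w) \<le> (1 / N ^ 4) / (1 / real N * (1 / N))"
      using zw i0 w0 N by (intro frac_le) auto
    also have "\<dots> = e" using N by (simp add: e_def power2_eq_square power4_eq_xxxx)
    finally show ?thesis .
  qed
  have G: "cmod (green N h z i j - green N h w i j) \<le> e" if "i < N" "j < N" for i j
    using green_lipschitz[OF sym w0(2,1) that] lip by linarith
  have S: "cmod (green_avg N h z - green_avg N h w) \<le> e"
    using green_avg_lipschitz[OF sym w0(2,1)] lip N by linarith
  have M: "cmod (msc z - msc w) \<le> e"
  proof -
    have "1 / real N * cmod (msc z - msc w) \<le> cmod (z - w)"
      by (rule msc_lipschitz[OF i0]) (use zw in auto)
    also have "\<dots> \<le> 1 / N ^ 4" by (rule zw)
    finally have "cmod (msc z - msc w) \<le> 1 / N ^ 4 * N" using N by (simp add: field_simps)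
    also have "\<dots> = e * (1 / N)" using N by (simp add: e_def power2_eq_square power4_eq_xxxx)
    also have "\<dots> \<le> e * 1" using e N by (intro mult_left_mono) auto
    finally show ?thesis by simp
  qed
  have e4: "e \<le> c / 4"
  proof -
    have "4 \<le> c * N" using N c by (simp add: divide_le_eq mult.commute)
    then have "1 / N \<le> c / 4" using N by (simp add: field_simps)
    then show ?thesis using e1N by linarith
  qed
  have near: "cmod (green N h w i j - msc w * kron i j) \<le> c" if "i < N" "j < N" for i j
  proof -
    have "cmod (green N h z i j - msc z * kron i j) \<le> c / 2" using br that by (simp add: on_branch_def)
    moreover have "cmod (msc z * kron i j - msc w * kron i j) \<le> e" using M e by auto
    moreover have "green N h w i j - msc w * kron i j =
        (green N h z i j - msc z * kron i j) - (green N h z i j - green N h w i j) + (msc z * kron i j - msc w * kron i j)"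
      by simp
    ultimately show ?thesis
      using G[OF that] e4 norm_triangle_ineq4[of "green N h z i j - msc z * kron i j" "green N h z i j - green N h w i j"]
        norm_triangle_ineq[of "(green N h z i j - msc z * kron i j) - (green N h z i j - green N h w i j)" "msc z * kron i j - msc w * kron i j"]
      by (simp only:)
  qed
  show "c \<le> cmod (green N h w i i)" if "i < N" for i
  proof -
    have "1 \<le> cmod (msc w) * (Z + 1)"
      using order_trans[OF msc_lower_bound[OF w0(1)] mult_left_mono[of "cmod w + 1" "Z + 1"]] Z by simp
    then have "1 / (Z + 1) \<le> cmod (msc w)" using Zp by (simp add: divide_le_eq)
    moreover have "2 * c \<le> 1 / (Z + 1)"
    proof -
      have "2 * c \<le> 2 * (1 / (2 * (Z + 1)))" using c(2) by (intro mult_left_mono) auto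
      also have "\<dots> = 1 / (Z + 1)" using Zp by (simp add: divide_simps)
      finally show ?thesis .
    qed
    ultimately show ?thesis
      using near[OF that that] norm_triangle_ineq3[of "green N h w i i" "msc w"] by simp
  qed
  show "cmod (green N h w i j) \<le> 2" if "i < N" "j < N" for i j
  proof -
    have "cmod (msc w * kron i j) \<le> 1" using msc_root(2)[OF w0(1)] by simp
    then show ?thesis using near[OF that] c1 norm_triangle_sub[of "green N h w i j" "msc w * kron i j"] by linarith
  qed
  assume gw: "(root_gap w)\<^sup>2 > 16 * K * (R / sqrt (N * Im w))"
  have rmono: "R / sqrt (N * Im z) \<le> R / sqrt (N * Im w)"
    using zw w0 KR N by (intro divide_left_mono) auto
  have "16 * K * (R / sqrt (N * Im z)) \<le> 16 * K * (R / sqrt (N * Im w))"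
    using rmono KR by (intro mult_left_mono) auto
  moreover have "(root_gap w)\<^sup>2 \<le> (root_gap z)\<^sup>2"
    using root_gap_mono[of z w] zw w0 by (intro power_mono) (auto simp: root_gap_def)
  ultimately have z8: "cmod (green_avg N h z - msc z) \<le> root_gap z / 8"
    using br gw unfolding on_branch_def by linarith
  have "1 / N \<le> root_gap w"
  proof -
    have "sqrt (N * Im w) \<le> real N"
    proof (rule real_le_lsqrt)
      have "real N * Im w \<le> real N * 1" using zw by (intro mult_left_mono) auto
      also have "\<dots> \<le> (real N)\<^sup>2" using N0 by (simp add: power2_eq_square)
      finally show "real N * Im w \<le> (real N)\<^sup>2" .
    qed (use w0 in auto)
    then have "1 / real N \<le> 1 / sqrt (N * Im w)" using w0 N by (intro divide_left_mono) auto
    also have "\<dots> \<le> R / sqrt (N * Im w)" using KR w0 by (intro divide_right_mono) auto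
    also have "\<dots> \<le> 16 * K * (R / sqrt (N * Im w))"
      using KR w0 mult_right_mono[of 1 "16 * K" "R / sqrt (N * Im w)"] by simp
    finally have a: "1 / real N < (root_gap w)\<^sup>2" using gw by linarith
    have "(1 / real N)\<^sup>2 \<le> 1 / N" using N0 by (simp add: power2_eq_square divide_simps)
    then have "(1 / real N)\<^sup>2 \<le> (root_gap w)\<^sup>2" using a by linarith
    then show ?thesis by (rule power2_le_imp_le) (simp add: root_gap_def)
  qed
  moreover have "(Z + 17) * e \<le> 1 / N"
    using mult_right_mono[OF N(3), of e] e eN by (simp add: mult.commute)
  ultimately have g: "(Z + 17) * e \<le> root_gap w" by linarith
  have "root_gap z \<le> root_gap w + (Z + 1) * e"
    by (rule root_gap_close) (use w0 Z zw e in auto)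
  moreover have "cmod (green_avg N h w - msc w) \<le> cmod (green_avg N h z - msc z) + e + e"
    using S M norm_triangle_ineq4[of "green_avg N h z - msc z" "green_avg N h z - green_avg N h w"]
      norm_triangle_ineq[of "(green_avg N h z - msc z) - (green_avg N h z - green_avg N h w)" "msc z - msc w"]
    by simp
  ultimately show "cmod (green_avg N h w - msc w) \<le> root_gap w / 4"
    using z8 g by (simp add: algebra_simps)
qed

text \<open>Since \<open>Im s \<ge> 0\<close> and \<open>Im (1 / m) \<le> - 1\<close>, the distance of \<open>s\<close> to the wrong root is at least one, so the
quadratic equation alone puts \<open>s\<close> next to the right root.\<close>

lemma away_from_axis:
  fixes N :: nat
  assumes sym: "symmetric_on N h" and z: "Im z \<ge> 1" "cmod z \<le> Z" and N: "N > 0" "Im z \<le> T\<^sup>2" "T \<ge> 1"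
    and R: "R \<ge> 1" "R / sqrt N \<le> 1" and good: "\<And>i. i < N \<Longrightarrow> good_row N h z R i"
    and c: "0 < c" "c \<le> 1 / (2 * (Z + 3))"
  defines "K \<equiv> sce_const c T" and "r \<equiv> R / sqrt (N * Im z)"
  assumes small: "K * r \<le> 1"
  shows "\<And>i. i < N \<Longrightarrow> c \<le> cmod (green N h z i i)"
    and "\<And>i j. i < N \<Longrightarrow> j < N \<Longrightarrow> cmod (green N h z i j) \<le> 2"
    and "(root_gap z)\<^sup>2 > 16 * K * r \<Longrightarrow> cmod (green_avg N h z - msc z) \<le> root_gap z / 4"
proof -
  have z0: "Im z > 0" using z by simp
  have Z0: "Z \<ge> 0" using z norm_ge_zero[of z] by linarith
  show c': "c \<le> cmod (green N h z i i)" if "i < N" for i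
  proof -
    have "1 / (2 * (Z + 3)) \<le> 1 / (cmod z + 3)" using z Z0 by (intro divide_left_mono) (auto intro!: mult_pos_pos add_nonneg_pos)
    then show ?thesis
      using diagonal_lower_bound_away_from_axis[OF sym z(1) that R good[OF that]] c by linarith
  qed
  show B: "cmod (green N h z i j) \<le> 2" if "i < N" "j < N" for i j
  proof -
    have "1 / Im z \<le> 1" using z by simp
    then show ?thesis using green_bound[OF sym z0 that] by linarith
  qed
  have c1: "c \<le> 1"
  proof -
    have "1 / (2 * (Z + 3)) \<le> 1" using Z0 by (simp add: divide_le_eq)
    then show ?thesis using c by linarith
  qed
  have N1: "1 \<le> N * Im z" using N z mult_mono[of 1 "real N" 1 "Im z"] by simp
  let ?s = "green_avg N h z"
  have e: "cmod (?s - msc z) * cmod (?s - 1 / msc z) \<le> K * r" unfolding K_def r_def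
    by (rule self_consistent_equation(1)[OF sym z0 N1 N(2,3,1) R(1) good c(1) c1 c' B])
  have "1 \<le> Im (?s - 1 / msc z)"
    using green_avg_Im_nonneg[OF sym z0] msc_inverse_Im[OF z0] z by simp
  then have "1 \<le> cmod (?s - 1 / msc z)" using abs_Im_le_cmod[of "?s - 1 / msc z"] by linarith
  then have a: "cmod (?s - msc z) \<le> K * r"
    using e mult_left_mono[of 1 "cmod (?s - 1 / msc z)" "cmod (?s - msc z)"] by simp
  assume g: "(root_gap z)\<^sup>2 > 16 * K * r"
  have Kr: "0 \<le> K * r" using a norm_ge_zero[of "?s - msc z"] by linarith
  have "(4 * (K * r))\<^sup>2 \<le> 16 * (K * r)"
    using mult_left_mono[OF small Kr] by (simp add: power2_eq_square)
  then have "(4 * (K * r))\<^sup>2 \<le> (root_gap z)\<^sup>2" using g by simp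
  then have "4 * (K * r) \<le> root_gap z" by (rule power2_le_imp_le) (simp add: root_gap_def)
  then show "cmod (?s - msc z) \<le> root_gap z / 4" using a by simp
qed

text \<open>Equidistant points from height one down to \<open>z\<close>. The resolvent has Lipschitz constant at most \<open>N\<^sup>2\<close> at
heights above \<open>1 / N\<close>, so \<open>N ^ 4\<close> steps are fine enough, and they are still few enough for a union
bound. If \<open>z\<close> has height at least one, all points coincide with \<open>z\<close>.\<close>

definition descent :: "nat \<Rightarrow> complex \<Rightarrow> nat \<Rightarrow> complex" where
  "descent N z k = (if Im z \<ge> 1 then z else Complex (Re z) (1 - real k * (1 - Im z) / real N ^ 4))"

text \<open>If all rows are good at all points of the descent, \<open>on_branch\<close> holds at the top by \<open>away_from_axis\<close> and is
handed down by \<open>branch_step\<close> and \<open>local_law_at_point\<close>; at the last point the latter gives the estimates.\<close>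

lemma deterministic_local_law:
  fixes \<tau> :: real
  assumes \<tau>: "0 < \<tau>" "\<tau> < 1"
  obtains C r0 N0 :: real where "C \<ge> 1" "r0 > 0"
    "\<And>N h R z. real N \<ge> N0 \<Longrightarrow> N \<ge> 1 \<Longrightarrow> symmetric_on N h \<Longrightarrow> R \<ge> 1 \<Longrightarrow>
     \<bar>Re z\<bar> \<le> 1 / \<tau> \<Longrightarrow> 1 / N \<le> Im z \<Longrightarrow> Im z \<le> 1 / \<tau> \<Longrightarrow> R / sqrt (N * Im z) \<le> r0 \<Longrightarrow>
     (\<And>k i. k \<le> N ^ 4 \<Longrightarrow> i < N \<Longrightarrow> good_row N h (descent N z k) R i) \<Longrightarrow>
     semicircle_close N h z (C * rate R N z)"
proof -
  define Z where "Z = 2 / \<tau>"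
  define T where "T = 1 / \<tau>"
  \<comment> \<open>at most half of the lower bounds for \<open>\<bar>m\<bar>\<close> and, at height at least one, for \<open>\<bar>G i i\<bar>\<close>\<close>
  define c where "c = 1 / (2 * (Z + 3))"
  define K where "K = sce_const c T"
  define X where "X = 5 / \<tau>"
  define C where "C = K * (25 * K + X)"
  \<comment> \<open>the bound on \<open>sqrt r\<close> under which the final estimate beats the crude bound \<open>c / 2\<close>\<close>
  define d where "d = c / (12 * K\<^sup>2)"
  define r0 where "r0 = d\<^sup>2"
  define N0 where "N0 = 4 / c + Z + 17"
  have T1: "T \<ge> 1" "T > 0" using \<tau> by (auto simp: T_def)
  have ZT: "Z = 2 * T" and XT: "X = 5 * T" by (simp_all add: Z_def T_def X_def)
  have Z2: "Z \<ge> 2" using T1 by (simp add: ZT)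
  have c: "0 < c" "c \<le> 1" "c \<le> 1 / (2 * (Z + 3))" "c \<le> 1 / (2 * (Z + 1))"
    using Z2 by (auto simp: c_def divide_le_eq intro!: divide_left_mono)
  have K1: "K \<ge> 1" using c T1 by (simp add: K_def sce_const_def add_increasing2)
  have X1: "X \<ge> 1" using T1 by (simp add: XT)
  have C1: "C \<ge> 1"
    unfolding C_def using mult_mono[of 1 K 1 "25 * K + X"] K1 X1 by auto
  have KK: "1 \<le> K\<^sup>2" using K1 by (simp add: one_le_power)
  have dc: "0 < d" "d \<le> c / 12"
  proof -
    show "0 < d" using c K1 by (simp add: d_def)
    have "c / (12 * K\<^sup>2) \<le> c / (12 * 1)" using c KK by (intro divide_left_mono mult_left_mono) auto
    then show "d \<le> c / 12" by (simp add: d_def)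
  qed
  have r0: "r0 > 0" using dc by (simp add: r0_def)
  have r0c: "r0 \<le> c" using dc c mult_mono[of d 1 d c] by (simp add: r0_def power2_eq_square)
  have cT: "c * T \<le> 1"
    using T1 by (simp add: c_def ZT divide_le_eq)
  have Kr0: "K * r0 \<le> 1"
  proof -
    have "K * d \<le> c / 12"
      using K1 c by (simp add: d_def power2_eq_square field_simps)
    then have "K * d * d \<le> 1 * 1" using dc c K1 by (intro mult_mono) auto
    then show ?thesis by (simp add: r0_def power2_eq_square)
  qed
  have main: "semicircle_close N h z (C * rate R N z)"
    if N: "real N \<ge> N0" "N \<ge> 1" and sym: "symmetric_on N h" and R: "R \<ge> 1"
      and z: "\<bar>Re z\<bar> \<le> 1 / \<tau>" "1 / N \<le> Im z" "Im z \<le> 1 / \<tau>" and small: "R / sqrt (N * Im z) \<le> r0"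
      and good': "\<And>k i. k \<le> N ^ 4 \<Longrightarrow> i < N \<Longrightarrow> good_row N h (descent N z k) R i" for N h R z
  proof -
    have i0: "0 < 1 / real N" using N by simp
    have z0: "Im z > 0" using z i0 by linarith
    have "4 / c > 0" using c by simp
    then have N': "N > 0" "4 / c \<le> N" "Z + 17 \<le> N"
      using N Z2 unfolding N0_def by linarith+
    have T2: "T \<le> T\<^sup>2" using T1 by (simp add: power2_eq_square)
    \<comment> \<open>the numerical side conditions hold at every point above \<open>z\<close> on its vertical line\<close>
    have pt: "1 \<le> N * Im w" "Im w \<le> T\<^sup>2" "cmod w \<le> Z" "sqrt (R / sqrt (N * Im w)) \<le> c / (12 * K\<^sup>2)"
        "K * (R / sqrt (N * Im w)) \<le> 1" "edge_scale N w \<le> X\<^sup>2" "R / sqrt (N * Im w) \<le> r0"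
      if w: "Re w = Re z" "Im z \<le> Im w" "Im w \<le> T" for w
    proof -
      have "1 / N \<le> Im w" using w z by linarith
      then show 1: "1 \<le> N * Im w" using N by (simp add: divide_le_eq mult.commute)
      show "Im w \<le> T\<^sup>2" using w T2 by linarith
      show "cmod w \<le> Z" using cmod_le[of w] w z z0 by (simp add: ZT T_def)
      have "R / sqrt (N * Im w) \<le> R / sqrt (N * Im z)"
        using w z0 N R by (intro divide_left_mono) auto
      then show r: "R / sqrt (N * Im w) \<le> r0" using small by linarith
      then have "sqrt (R / sqrt (N * Im w)) \<le> sqrt r0" by simp
      then show "sqrt (R / sqrt (N * Im w)) \<le> c / (12 * K\<^sup>2)"
        using dc by (simp add: r0_def d_def[symmetric])
      show "K * (R / sqrt (N * Im w)) \<le> 1" using mult_left_mono[OF r, of K] Kr0 K1 by linarith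
      have "1 / sqrt (N * Im w) \<le> 1" using 1 by simp
      then have "edge_scale N w \<le> X" using w z \<tau> T1 unfolding edge_scale_def XT T_def[symmetric] by linarith
      also have "\<dots> \<le> X\<^sup>2" using X1 by (simp add: power2_eq_square)
      finally show "edge_scale N w \<le> X\<^sup>2" .
    qed
    have RN: "R / sqrt N \<le> 1"
    proof -
      have "sqrt (Im z) \<le> T" using z T2 T1 z0 by (intro real_le_lsqrt) (auto simp: T_def)
      then have "R / sqrt (N * Im z) * sqrt (Im z) \<le> r0 * T"
        using small T1 r0 z0 R by (intro mult_mono) auto
      moreover have "R / sqrt (N * Im z) * sqrt (Im z) = R / sqrt N"
        using z0 by (simp add: real_sqrt_mult)
      moreover have "r0 * T \<le> c * T" using r0c T1 by (intro mult_right_mono) auto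
      ultimately show ?thesis using cT by linarith
    qed
    have zz: "Re z = Re z" "Im z \<le> Im z" "Im z \<le> T" using z by (auto simp: T_def)
    have concl: ?thesis if gd: "\<And>i. i < N \<Longrightarrow> good_row N h z R i"
      and lo: "\<And>i. i < N \<Longrightarrow> c \<le> cmod (green N h z i i)"
      and up: "\<And>i j. i < N \<Longrightarrow> j < N \<Longrightarrow> cmod (green N h z i j) \<le> 2"
      and sel: "(root_gap z)\<^sup>2 > 16 * K * (R / sqrt (N * Im z)) \<Longrightarrow> cmod (green_avg N h z - msc z) \<le> root_gap z / 4"
    proof (intro conjI allI impI)
      show "cmod (green_avg N h z - msc z) \<le> C * rate R N z"
        unfolding C_def K_def
        by (rule local_law_at_point(2)[OF sym z0 pt(1,2)[OF zz] T1(1) N'(1) R gd c(1,2) lo up sel[unfolded K_def]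
              pt(4)[OF zz, unfolded K_def] pt(6)[OF zz] X1])
      fix i j assume ij: "i < N" "j < N"
      show "cmod (green N h z i j - msc z * kron i j) \<le> C * rate R N z"
        unfolding C_def K_def
        by (rule local_law_at_point(3)[OF sym z0 pt(1,2)[OF zz] T1(1) N'(1) R gd c(1,2) lo up sel[unfolded K_def]
              pt(4)[OF zz, unfolded K_def] pt(6)[OF zz] X1 ij])
    qed
    show ?thesis
    proof (cases "Im z \<ge> 1")
      case True
      then have gd: "good_row N h z R i" if "i < N" for i using good'[of 0 i] that by (simp add: descent_def)
      note st = away_from_axis[OF sym True pt(3)[OF zz] N'(1) pt(2)[OF zz] T1(1) R RN gd c(1,3) pt(5)[OF zz, unfolded K_def]]
      show ?thesis
        by (rule concl[OF gd]) (use st in \<open>auto simp: K_def\<close>)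
    next
      case False
      define \<zeta> where "\<zeta> k = descent N z k" for k
      define \<delta> where "\<delta> = (1 - Im z) / real N ^ 4"
      have \<delta>: "\<delta> > 0" "\<delta> \<le> 1 / N ^ 4" "N ^ 4 * \<delta> = 1 - Im z"
        using False z0 N by (auto simp: \<delta>_def intro!: divide_right_mono)
      have Re\<zeta>: "Re (\<zeta> k) = Re z" and Im\<zeta>: "Im (\<zeta> k) = 1 - k * \<delta>" for k
        using False by (simp_all add: \<zeta>_def descent_def \<delta>_def)
      have range: "Im z \<le> Im (\<zeta> k)" "Im (\<zeta> k) \<le> 1" if "k \<le> N ^ 4" for k
      proof -
        have "real k \<le> real (N ^ 4)" using that by (simp only: of_nat_le_iff)
        then have "k * \<delta> \<le> real (N ^ 4) * \<delta>" using \<delta> by (intro mult_right_mono) auto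
        then show "Im z \<le> Im (\<zeta> k)" using \<delta>(3) by (simp add: Im\<zeta>)
        show "Im (\<zeta> k) \<le> 1" using \<delta> by (simp add: Im\<zeta>)
      qed
      have pw: "Re (\<zeta> k) = Re z" "Im z \<le> Im (\<zeta> k)" "Im (\<zeta> k) \<le> T" if "k \<le> N ^ 4" for k
        using range[OF that] Re\<zeta> T1 by auto
      have gd: "good_row N h (\<zeta> k) R i" if "k \<le> N ^ 4" "i < N" for k i
        unfolding \<zeta>_def by (rule good'[OF that])
      have pos: "Im (\<zeta> k) > 0" if "k \<le> N ^ 4" for k using range[OF that] z0 by linarith
      have step_conds: "c \<le> cmod (green N h (\<zeta> (Suc k)) i i)"
        "cmod (green N h (\<zeta> (Suc k)) i j) \<le> 2"
        "(root_gap (\<zeta> (Suc k)))\<^sup>2 > 16 * K * (R / sqrt (N * Im (\<zeta> (Suc k)))) \<Longrightarrow> cmod (green_avg N h (\<zeta> (Suc k)) - msc (\<zeta> (Suc k))) \<le> root_gap (\<zeta> (Suc k)) / 4"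
        if k: "Suc k \<le> N ^ 4" and br: "on_branch c K N h R (\<zeta> k)" and ij: "i < N" "j < N" for k i j
      proof -
        have k': "k \<le> N ^ 4" using k by simp
        have a: "Re (\<zeta> k) = Re (\<zeta> (Suc k))" "1 / N \<le> Im (\<zeta> (Suc k))" "Im (\<zeta> (Suc k)) \<le> Im (\<zeta> k)"
          "Im (\<zeta> (Suc k)) \<le> 1"
          using range[OF k] z Re\<zeta> \<delta> by (auto simp: Im\<zeta> algebra_simps)
        have "\<zeta> k - \<zeta> (Suc k) = Complex 0 \<delta>" by (simp add: complex_eq_iff Re\<zeta> Im\<zeta> algebra_simps)
        then have b: "cmod (\<zeta> k - \<zeta> (Suc k)) \<le> 1 / N ^ 4" using \<delta> by (simp add: cmod_def)
        note st = branch_step[OF sym br a b pt(3)[OF pw[OF k']] pt(3)[OF pw[OF k]] c(1,4) N(2) N'(2,3) K1 R]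
        show "c \<le> cmod (green N h (\<zeta> (Suc k)) i i)" using st(1) ij by blast
        show "cmod (green N h (\<zeta> (Suc k)) i j) \<le> 2" using st(2) ij by blast
        show "cmod (green_avg N h (\<zeta> (Suc k)) - msc (\<zeta> (Suc k))) \<le> root_gap (\<zeta> (Suc k)) / 4"
          if "(root_gap (\<zeta> (Suc k)))\<^sup>2 > 16 * K * (R / sqrt (N * Im (\<zeta> (Suc k))))" using st(3) that by blast
      qed
      have branch: "k \<le> N ^ 4 \<Longrightarrow> on_branch c K N h R (\<zeta> k)" for k
      proof (induction k)
        case 0
        have k: "0 \<le> N ^ 4" by simp
        have one: "Im (\<zeta> 0) \<ge> 1" by (simp add: Im\<zeta>)
        note st = away_from_axis[OF sym one pt(3)[OF pw[OF k]] N'(1) pt(2)[OF pw[OF k]] T1(1) R RN gd[OF k] c(1,3) pt(5)[OF pw[OF k], unfolded K_def]]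
        show ?case unfolding K_def
          by (rule local_law_at_point(1)[OF sym pos[OF k] pt(1,2)[OF pw[OF k]] T1(1) N'(1) R gd[OF k] c(1,2) st(1,2,3)
              pt(4)[OF pw[OF k], unfolded K_def] pt(6)[OF pw[OF k]] X1])
      next
        case (Suc k)
        have br: "on_branch c K N h R (\<zeta> k)" using Suc by simp
        note st = step_conds[OF Suc.prems br]
        show ?case unfolding K_def
          by (rule local_law_at_point(1)[OF sym pos[OF Suc.prems] pt(1,2)[OF pw[OF Suc.prems]] T1(1) N'(1) R gd[OF Suc.prems] c(1,2) st(1)[OF _ N'(1)] st(2) st(3)[OF N'(1) N'(1), unfolded K_def]
              pt(4)[OF pw[OF Suc.prems], unfolded K_def] pt(6)[OF pw[OF Suc.prems]] X1])
      qed
      obtain n where n: "N ^ 4 = Suc n" using N by (metis Suc_pred N'(1) zero_less_power)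
      have "\<zeta> (N ^ 4) = z" using \<delta>(3) by (simp add: complex_eq_iff Re\<zeta> Im\<zeta>)
      then have zn: "\<zeta> (Suc n) = z" using n by simp
      have br: "on_branch c K N h R (\<zeta> n)" and sn: "Suc n \<le> N ^ 4" using branch[of n] n by auto
      note st = step_conds[OF sn br, unfolded zn]
      show ?thesis
        by (rule concl) (use st N'(1) gd[OF sn, unfolded zn] in blast)+
    qed
  qed
  show ?thesis by (rule that[OF C1 r0 main])
qed

section \<open>Moments of linear and quadratic forms\<close>

lemma even_power_add_le:
  fixes x y :: real
  shows "(x + y) ^ (2 * p) \<le> 4 ^ p * (x ^ (2 * p) + y ^ (2 * p))"
proof -
  have "(x + y)\<^sup>2 \<le> 2 * (x\<^sup>2 + y\<^sup>2)"
    using zero_le_power2[of "x - y"] by (simp add: power2_eq_square algebra_simps)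
  also have "\<dots> \<le> 4 * max (x\<^sup>2) (y\<^sup>2)" by (simp add: max_def)
  finally have "((x + y)\<^sup>2) ^ p \<le> (4 * max (x\<^sup>2) (y\<^sup>2)) ^ p" by (intro power_mono) auto
  also have "\<dots> = 4 ^ p * (max (x\<^sup>2) (y\<^sup>2)) ^ p" by (rule power_mult_distrib)
  also have "\<dots> \<le> 4 ^ p * (x ^ (2 * p) + y ^ (2 * p))"
    by (intro mult_left_mono) (auto simp: max_def power_mult)
  finally show ?thesis by (simp add: power_mult)
qed

text \<open>The term of first order in \<open>y\<close> is kept as it is, because it vanishes in expectation for centred \<open>y\<close>. The
weight \<open>l\<close> distributes the terms of second order between the two extreme powers.\<close>

lemma even_power_sum_bound:
  fixes x y l :: real
  assumes p: "p \<ge> 1" and l: "l > 0"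
  shows "(x + y) ^ (2 * p) \<le> x ^ (2 * p) + 2 * real p * x ^ (2 * p - 1) * y
    + 4 ^ p * (l * x ^ (2 * p) + (1 + (1 / l) ^ (p - 1)) * y ^ (2 * p))"
proof -
  define E where "E = l * x ^ (2 * p) + (1 + (1 / l) ^ (p - 1)) * y ^ (2 * p)"
  define t where "t j = real (2 * p choose j) * y ^ j * x ^ (2 * p - j)" for j
  have ev: "0 \<le> u ^ (2 * p)" "\<bar>u\<bar> ^ (2 * p) = u ^ (2 * p)" for u :: real
    by (simp_all add: power_mult)
  have pw: "u ^ p = u * u ^ (p - 1)" for u :: real using p by (cases p) auto
  have E0: "0 \<le> l * x ^ (2 * p)" "0 \<le> (1 / l) ^ (p - 1) * y ^ (2 * p)" using l ev(1) by auto
  have main: "\<bar>y\<bar> ^ j * \<bar>x\<bar> ^ (2 * p - j) \<le> E" if j: "2 \<le> j" "j \<le> 2 * p" for j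
  proof (cases "\<bar>x\<bar> \<le> \<bar>y\<bar>")
    case True
    then have "\<bar>y\<bar> ^ j * \<bar>x\<bar> ^ (2 * p - j) \<le> \<bar>y\<bar> ^ j * \<bar>y\<bar> ^ (2 * p - j)"
      by (intro mult_left_mono power_mono) auto
    also have "\<dots> = y ^ (2 * p)" using j ev(2)[of y] by (simp add: power_add[symmetric])
    also have "\<dots> \<le> E" using E0 by (simp add: E_def algebra_simps)
    finally show ?thesis .
  next
    case False
    have e: "2 * p - 2 = 2 * (p - 1)" "j - 2 + (2 * p - j) = 2 * p - 2" using j p by auto
    have "\<bar>y\<bar> ^ j * \<bar>x\<bar> ^ (2 * p - j) = \<bar>y\<bar> ^ 2 * (\<bar>y\<bar> ^ (j - 2) * \<bar>x\<bar> ^ (2 * p - j))"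
      using power_add[of "\<bar>y\<bar>" 2 "j - 2"] j by (simp only: le_add_diff_inverse mult.assoc)
    also have "\<dots> \<le> \<bar>y\<bar> ^ 2 * (\<bar>x\<bar> ^ (j - 2) * \<bar>x\<bar> ^ (2 * p - j))"
      using False by (intro mult_left_mono mult_right_mono power_mono) auto
    also have "\<dots> = y\<^sup>2 * (x\<^sup>2) ^ (p - 1)"
      by (simp add: power_add[symmetric] e power_mult)
    also have "\<dots> \<le> E"
    proof (cases "y\<^sup>2 \<le> l * x\<^sup>2")
      case True
      then have "y\<^sup>2 * (x\<^sup>2) ^ (p - 1) \<le> l * x\<^sup>2 * (x\<^sup>2) ^ (p - 1)" by (intro mult_right_mono) auto
      also have "\<dots> = l * x ^ (2 * p)"
        unfolding power_mult pw[of "x\<^sup>2"] by (simp only: mult.assoc)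
      also have "\<dots> \<le> E" using E0 ev(1)[of y] by (simp add: E_def algebra_simps)
      finally show ?thesis .
    next
      case False
      then have "x\<^sup>2 \<le> 1 / l * y\<^sup>2" using l by (simp add: field_simps)
      then have "y\<^sup>2 * (x\<^sup>2) ^ (p - 1) \<le> y\<^sup>2 * (1 / l * y\<^sup>2) ^ (p - 1)"
        by (intro mult_left_mono power_mono) auto
      also have "\<dots> = (1 / l) ^ (p - 1) * y ^ (2 * p)"
        unfolding power_mult pw[of "y\<^sup>2"] by (simp only: power_mult_distrib mult_ac)
      also have "\<dots> \<le> E" using E0 ev(1)[of y] by (simp add: E_def algebra_simps)
      finally show ?thesis .
    qed
    finally show ?thesis .
  qed
  have E: "E \<ge> 0" using E0 ev(1)[of y] by (simp add: E_def algebra_simps)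
  have "(x + y) ^ (2 * p) = (\<Sum>j\<le>2 * p. t j)"
    unfolding t_def by (subst add.commute) (rule binomial_ring)
  also have "\<dots> = t 0 + t 1 + (\<Sum>j\<in>{2..2 * p}. t j)"
  proof -
    have "{..2 * p} = insert 0 (insert 1 {2..2 * p})" using p by auto
    then show ?thesis by simp
  qed
  also have "(\<Sum>j\<in>{2..2 * p}. t j) \<le> (\<Sum>j\<in>{2..2 * p}. real (2 * p choose j) * E)"
  proof (rule sum_mono)
    fix j assume j: "j \<in> {2..2 * p}"
    have "t j \<le> \<bar>t j\<bar>" by simp
    also have "\<dots> = real (2 * p choose j) * (\<bar>y\<bar> ^ j * \<bar>x\<bar> ^ (2 * p - j))"
      by (simp add: t_def abs_mult power_abs)
    also have "\<dots> \<le> real (2 * p choose j) * E" using main j by (intro mult_left_mono) auto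
    finally show "t j \<le> real (2 * p choose j) * E" .
  qed
  also have "\<dots> \<le> (\<Sum>j\<le>2 * p. real (2 * p choose j) * E)"
    by (rule sum_mono2) (use E in auto)
  also have "\<dots> = 4 ^ p * E"
    by (simp add: sum_distrib_right[symmetric] of_nat_sum[symmetric] choose_row_sum power_mult del: of_nat_sum)
  finally show ?thesis by (simp add: t_def E_def mult_ac)
qed

abbreviation iid :: "'b measure \<Rightarrow> 'i set \<Rightarrow> ('i \<Rightarrow> 'b) measure" where
  "iid Q I \<equiv> PiM I (\<lambda>_. Q)"

text \<open>The constant \<open>C\<close> for which \<open>variance_increment\<close> passes from \<open>C * A ^ p\<close> to \<open>C * (A + b) ^ p\<close>.\<close>

definition moment_const :: "nat \<Rightarrow> real \<Rightarrow> real" where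
  "moment_const p D = 2 * (4 ^ p * D + 4 ^ p * (2 * 4 ^ p) ^ (p - 1) * D)"

lemma moment_const_nonneg: "D \<ge> 0 \<Longrightarrow> moment_const p D \<ge> 0"
  by (simp add: moment_const_def)

text \<open>The inductive step for moments of sums of martingale differences: \<open>A\<close> is the accumulated variance and \<open>b\<close>
the variance of the next term. Choosing \<open>l\<close> proportional to \<open>b / A\<close> makes all new contributions multiples of
\<open>b (A + b) ^ (p - 1)\<close>, which is at most the increase from \<open>A ^ p\<close> to \<open>(A + b) ^ p\<close>. For \<open>b = 0\<close> the weight
\<open>l\<close> tends to zero.\<close>

lemma variance_increment:
  fixes A b D :: real
  assumes p: "p \<ge> 1" and nn: "A \<ge> 0" "b \<ge> 0" "D \<ge> 0"
  defines "C \<equiv> moment_const p D"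
  assumes E: "\<And>l. l > 0 \<Longrightarrow> E \<le> ennreal (C * A ^ p + 4 ^ p * (l * (C * A ^ p) + (1 + (1 / l) ^ (p - 1)) * (D * b ^ p)))"
  shows "E \<le> ennreal (C * (A + b) ^ p)"
proof -
  have C0: "C \<ge> 0" using nn by (simp add: C_def moment_const_nonneg)
  have C1: "2 * (4 ^ p * D) \<le> C" using nn by (simp add: C_def moment_const_def)
  consider "b = 0" | "A = 0" "b > 0" | "A > 0" "b > 0" using nn by linarith
  then show ?thesis
  proof cases
    case 1
    define V where "V = C * A ^ p"
    have V: "V \<ge> 0" using C0 nn by (simp add: V_def)
    have "E \<le> ennreal V"
    proof (rule ennreal_le_epsilon)
      fix e :: real assume e: "0 < e"
      define l where "l = e / (4 ^ p * (V + 1))"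
      have l: "l > 0" using e V by (simp add: l_def)
      have "4 ^ p * (l * V) = e * (V / (V + 1))" using V by (simp add: l_def)
      also have "\<dots> \<le> e * 1" using e V by (intro mult_left_mono) auto
      finally have "V + 4 ^ p * (l * V) \<le> V + e" by simp
      moreover have "E \<le> ennreal (V + 4 ^ p * (l * V))"
        using E[OF l] p unfolding 1 V_def by (simp add: power_0_left)
      ultimately have "E \<le> ennreal (V + e)" by (meson ennreal_leI order_trans)
      then show "E \<le> ennreal V + ennreal e" using V e by simp
    qed
    then show ?thesis using 1 by (simp add: V_def)
  next
    case 2
    have "2 * (4 ^ p * D) * b ^ p \<le> C * b ^ p" using C1 nn by (intro mult_right_mono) auto
    then have "4 ^ p * ((1 + 1) * (D * b ^ p)) \<le> C * b ^ p" by simp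
    moreover have "E \<le> ennreal (4 ^ p * ((1 + 1) * (D * b ^ p)))" using E[of 1] 2 p by (simp add: power_0_left)
    ultimately show ?thesis using 2 by (simp add: order_trans[OF _ ennreal_leI])
  next
    case 3
    \<comment> \<open>with this weight the first contribution takes exactly half of the available constant\<close>
    define l where "l = b / (2 * A * 4 ^ p)"
    have l: "l > 0" using 3 by (simp add: l_def)
    define W where "W = b * (A + b) ^ (p - 1)"
    have W: "W \<ge> 0" using nn by (simp add: W_def)
    have W1: "b * A ^ (p - 1) \<le> W" "b * b ^ (p - 1) \<le> W" unfolding W_def using nn
      by (auto intro!: mult_left_mono power_mono)
    have pw: "u ^ p = u * u ^ (p - 1)" for u :: real using p by (cases p) auto
    have main: "A ^ p + W \<le> (A + b) ^ p"
    proof -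
      have "A * A ^ (p - 1) \<le> A * (A + b) ^ (p - 1)" using nn by (intro mult_left_mono power_mono) auto
      then show ?thesis unfolding pw W_def by (simp add: algebra_simps)
    qed
    have t1: "4 ^ p * (l * (C * A ^ p)) = C / 2 * (b * A ^ (p - 1))"
      using 3 unfolding pw[of A] by (simp add: l_def)
    have t2: "(1 / l) ^ (p - 1) * (D * b ^ p) = (2 * 4 ^ p) ^ (p - 1) * D * (b * A ^ (p - 1))"
    proof -
      have "(1 / l) ^ (p - 1) * b ^ (p - 1) = (1 / l * b) ^ (p - 1)" by (simp only: power_mult_distrib)
      also have "1 / l * b = 2 * 4 ^ p * A" using 3 by (simp add: l_def)
      finally have eq: "(1 / l) ^ (p - 1) * b ^ (p - 1) = (2 * 4 ^ p) ^ (p - 1) * A ^ (p - 1)" by (simp only: power_mult_distrib)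
      have "(1 / l) ^ (p - 1) * (D * b ^ p) = D * b * ((1 / l) ^ (p - 1) * b ^ (p - 1))"
        unfolding pw[of b] by (simp only: mult_ac)
      also have "\<dots> = (2 * 4 ^ p) ^ (p - 1) * D * (b * A ^ (p - 1))"
        by (simp only: eq mult.assoc mult.left_commute)
      finally show ?thesis .
    qed
    have "C * A ^ p + 4 ^ p * (l * (C * A ^ p) + (1 + (1 / l) ^ (p - 1)) * (D * b ^ p))
       = C * A ^ p + C / 2 * (b * A ^ (p - 1)) + 4 ^ p * D * (b * b ^ (p - 1))
         + 4 ^ p * (2 * 4 ^ p) ^ (p - 1) * D * (b * A ^ (p - 1))"
      unfolding distrib_left distrib_right t1 t2 unfolding pw[of b] by simp
    also have "\<dots> \<le> C * A ^ p + C / 2 * W + 4 ^ p * D * W + 4 ^ p * (2 * 4 ^ p) ^ (p - 1) * D * W"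
      using W1 C0 nn by (intro add_mono mult_left_mono) auto
    also have "\<dots> = C * (A ^ p + W)" by (simp add: C_def moment_const_def algebra_simps)
    also have "\<dots> \<le> C * (A + b) ^ p" using main C0 by (intro mult_left_mono) auto
    finally show ?thesis using E[OF l] by (meson ennreal_leI order_trans)
  qed
qed

lemma (in prob_space) centered_increment:
  fixes Y :: "'a \<Rightarrow> real"
  assumes p: "p \<ge> 1" and l: "l > 0" and Y: "integrable M Y" "expectation Y = 0"
    and m: "(\<integral>\<^sup>+u. ennreal (Y u ^ (2 * p)) \<partial>M) \<le> ennreal m" "m \<ge> 0"
  shows "(\<integral>\<^sup>+u. ennreal ((x + Y u) ^ (2 * p)) \<partial>M)
    \<le> ennreal (x ^ (2 * p) + 4 ^ p * (l * x ^ (2 * p) + (1 + (1 / l) ^ (p - 1)) * m))"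
proof -
  let ?g = "\<lambda>u. x ^ (2 * p) + 2 * real p * x ^ (2 * p - 1) * Y u
    + 4 ^ p * (l * x ^ (2 * p) + (1 + (1 / l) ^ (p - 1)) * Y u ^ (2 * p))"
  have ev: "0 \<le> u ^ (2 * p)" for u :: real by (simp add: power_mult)
  have [measurable]: "Y \<in> borel_measurable M" using Y by auto
  have int: "integrable M (\<lambda>u. Y u ^ (2 * p))"
  proof (rule integrableI_nonneg)
    show "(\<integral>\<^sup>+u. ennreal (Y u ^ (2 * p)) \<partial>M) < \<infinity>" using m by (metis ennreal_less_top infinity_ennreal_def le_less_trans)
  qed (use ev in auto)
  have ig: "integrable M ?g" using int Y by auto
  have le: "(x + Y u) ^ (2 * p) \<le> ?g u" for u by (rule even_power_sum_bound[OF p l])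
  have "(\<integral>\<^sup>+u. ennreal ((x + Y u) ^ (2 * p)) \<partial>M) \<le> (\<integral>\<^sup>+u. ennreal (?g u) \<partial>M)"
    by (intro nn_integral_mono ennreal_leI le)
  also have "\<dots> = ennreal (expectation ?g)"
    by (rule nn_integral_eq_integral[OF ig]) (intro AE_I2 order_trans[OF ev le])
  also have "expectation ?g = x ^ (2 * p) + 4 ^ p * (l * x ^ (2 * p) + (1 + (1 / l) ^ (p - 1)) * expectation (\<lambda>u. Y u ^ (2 * p)))"
    using int Y by (simp add: prob_space)
  also have "ennreal \<dots> \<le> ennreal (x ^ (2 * p) + 4 ^ p * (l * x ^ (2 * p) + (1 + (1 / l) ^ (p - 1)) * m))"
  proof -
    have "ennreal (expectation (\<lambda>u. Y u ^ (2 * p))) \<le> ennreal m"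
      using m(1) nn_integral_eq_integral[OF int] ev by simp
    then have "expectation (\<lambda>u. Y u ^ (2 * p)) \<le> m" using m(2) by simp
    then show ?thesis using l by (intro ennreal_leI add_left_mono mult_left_mono) auto
  qed
  finally show ?thesis .
qed

text \<open>A law with mean \<open>\<mu>\<close> and variance \<open>v\<close> and with moment bounds of one fixed order. The tail bounds below
depend on the law only through \<open>p\<close>, \<open>D\<close> and \<open>D'\<close>; this makes them uniform over the laws \<open>P t\<close> of a mixing
space.\<close>

locale centered_law = prob_space Q for Q :: "real measure" +
  fixes \<mu> v D D' :: real and p :: nat
  assumes sets_Q: "sets Q = sets borel" and p: "p \<ge> 1"
    and int2: "integrable Q (\<lambda>u. (u - \<mu>)\<^sup>2)" and mean: "expectation (\<lambda>u. u - \<mu>) = 0"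
    and var: "expectation (\<lambda>u. (u - \<mu>)\<^sup>2) = v"
    and D: "(\<integral>\<^sup>+u. ennreal ((u - \<mu>) ^ (2 * p)) \<partial>Q) \<le> ennreal D" "D \<ge> 0"
    and D': "(\<integral>\<^sup>+u. ennreal (((u - \<mu>)\<^sup>2 - v) ^ (2 * p)) \<partial>Q) \<le> ennreal D'" "D' \<ge> 0"
begin

lemmas [measurable_cong] = sets_Q

lemma int1: "integrable Q (\<lambda>u. u - \<mu>)"
  by (rule square_integrable_imp_integrable[OF _ int2]) measurable

sublocale PQ: product_sigma_finite "\<lambda>_. Q" ..

lemma prob_space_PiM_Q: "prob_space (iid Q I)"
  by (intro prob_space_PiM) (rule prob_space_axioms)

abbreviation quad_const :: real where
  "quad_const \<equiv> moment_const p (4 ^ p * (D * moment_const p D + D'))"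

abbreviation lin_form :: "('s \<Rightarrow> 'i) \<Rightarrow> 's set \<Rightarrow> ('s \<Rightarrow> real) \<Rightarrow> ('i \<Rightarrow> real) \<Rightarrow> real" where
  "lin_form f S a x \<equiv> \<Sum>k\<in>S. a k * (x (f k) - \<mu>)"

abbreviation quad_form :: "('s \<Rightarrow> 'i) \<Rightarrow> 's set \<Rightarrow> ('s \<Rightarrow> 's \<Rightarrow> real) \<Rightarrow> ('i \<Rightarrow> real) \<Rightarrow> real" where
  "quad_form f S a x \<equiv> (\<Sum>k\<in>S. \<Sum>l\<in>S. a k l * ((x (f k) - \<mu>) * (x (f l) - \<mu>))) - v * (\<Sum>k\<in>S. a k k)"

lemma linear_form_measurable [measurable]:
  "(\<lambda>x. lin_form f S a x) \<in> borel_measurable (iid Q (f ` S))"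
  by measurable

text \<open>Induction over the summands: the last coordinate is integrated first, with the other coordinates fixed.\<close>

lemma linear_form_moment:
  fixes f :: "'s \<Rightarrow> 'i" and a :: "'s \<Rightarrow> real"
  assumes "finite S" "inj_on f S"
  shows "(\<integral>\<^sup>+x. ennreal (lin_form f S a x ^ (2 * p)) \<partial>iid Q (f ` S))
    \<le> ennreal (moment_const p D * (\<Sum>k\<in>S. (a k)\<^sup>2) ^ p)"
  using assms
proof (induction S rule: finite_induct)
  case empty
  show ?case using p by (simp add: power_0_left)
next
  case (insert s S)
  let ?C = "moment_const p D" and ?A = "\<Sum>k\<in>S. (a k)\<^sup>2"
  let ?X = "\<lambda>x. lin_form f S a x"
  have fin: "finite (f ` S)" and nin: "f s \<notin> f ` S" and inj: "inj_on f S"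
    using insert by auto
  have A0: "?A \<ge> 0" by (simp add: sum_nonneg)
  interpret P: prob_space "iid Q (f ` S)" by (rule prob_space_PiM_Q)
  have ev: "0 \<le> u ^ (2 * p)" for u :: real by (simp add: power_mult)
  have [measurable]: "?X \<in> borel_measurable (iid Q (f ` S))" by measurable
  have meas: "(\<lambda>x. ennreal (lin_form f (insert s S) a x ^ (2 * p))) \<in> borel_measurable (iid Q (f ` insert s S))"
    by measurable
  have split: "(\<Sum>k\<in>insert s S. a k * ((x(f s := y)) (f k) - \<mu>)) = ?X x + a s * (y - \<mu>)" for x y
  proof -
    have "(\<Sum>k\<in>S. a k * ((x(f s := y)) (f k) - \<mu>)) = ?X x"
    proof (rule sum.cong[OF refl])
      fix k assume "k \<in> S"
      then have "f k \<noteq> f s" using nin by (metis imageI)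
      then show "a k * ((x(f s := y)) (f k) - \<mu>) = a k * (x (f k) - \<mu>)" by simp
    qed
    then show ?thesis using insert by simp
  qed
  let ?E = "\<integral>\<^sup>+x. ennreal (lin_form f (insert s S) a x ^ (2 * p)) \<partial>iid Q (f ` insert s S)"
  have "?E \<le> ennreal (?C * (?A + (a s)\<^sup>2) ^ p)"
  proof (rule variance_increment[OF p A0 _ D(2)])
    fix l :: real assume l: "l > 0"
    let ?c1 = "1 + 4 ^ p * l" and ?c2 = "4 ^ p * ((1 + (1 / l) ^ (p - 1)) * (D * ((a s)\<^sup>2) ^ p))"
    have c: "?c1 \<ge> 0" "?c2 \<ge> 0" using l D(2) by auto
    have "?E = (\<integral>\<^sup>+x. \<integral>\<^sup>+y. ennreal ((\<Sum>k\<in>insert s S. a k * ((x(f s := y)) (f k) - \<mu>)) ^ (2 * p)) \<partial>Q \<partial>iid Q (f ` S))"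
      using meas unfolding image_insert by (rule PQ.product_nn_integral_insert[OF fin nin])
    also have "\<dots> = (\<integral>\<^sup>+x. \<integral>\<^sup>+y. ennreal ((?X x + a s * (y - \<mu>)) ^ (2 * p)) \<partial>Q \<partial>iid Q (f ` S))"
      unfolding split ..
    also have "\<dots> \<le> (\<integral>\<^sup>+x. ennreal (?X x ^ (2 * p) + 4 ^ p * (l * ?X x ^ (2 * p) + (1 + (1 / l) ^ (p - 1)) * (D * ((a s)\<^sup>2) ^ p))) \<partial>iid Q (f ` S))"
    proof (intro nn_integral_mono centered_increment[OF p l])
      show "integrable Q (\<lambda>y. a s * (y - \<mu>))" using int1 by simp
      show "expectation (\<lambda>y. a s * (y - \<mu>)) = 0" using mean int1 by simp
      have "(\<integral>\<^sup>+u. ennreal ((a s * (u - \<mu>)) ^ (2 * p)) \<partial>Q) = (\<integral>\<^sup>+u. ennreal (((a s)\<^sup>2) ^ p) * ennreal ((u - \<mu>) ^ (2 * p)) \<partial>Q)"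
        by (rule nn_integral_cong) (simp add: power_mult_distrib power_mult ennreal_mult)
      also have "\<dots> = ennreal (((a s)\<^sup>2) ^ p) * (\<integral>\<^sup>+u. ennreal ((u - \<mu>) ^ (2 * p)) \<partial>Q)"
        by (rule nn_integral_cmult) measurable
      also have "\<dots> \<le> ennreal (((a s)\<^sup>2) ^ p) * ennreal D" using D by (intro mult_left_mono) auto
      finally show "(\<integral>\<^sup>+u. ennreal ((a s * (u - \<mu>)) ^ (2 * p)) \<partial>Q) \<le> ennreal (D * ((a s)\<^sup>2) ^ p)"
        using D by (simp add: ennreal_mult mult.commute)
    qed (use D in auto)
    also have "\<dots> = (\<integral>\<^sup>+x. ennreal ?c1 * ennreal (?X x ^ (2 * p)) + ennreal ?c2 \<partial>iid Q (f ` S))"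
    proof (rule nn_integral_cong)
      fix x
      have "?X x ^ (2 * p) + 4 ^ p * (l * ?X x ^ (2 * p) + (1 + (1 / l) ^ (p - 1)) * (D * ((a s)\<^sup>2) ^ p)) = ?c1 * ?X x ^ (2 * p) + ?c2"
        by (simp add: algebra_simps)
      then show "ennreal (?X x ^ (2 * p) + 4 ^ p * (l * ?X x ^ (2 * p) + (1 + (1 / l) ^ (p - 1)) * (D * ((a s)\<^sup>2) ^ p))) = ennreal ?c1 * ennreal (?X x ^ (2 * p)) + ennreal ?c2"
        using c ev by (simp only: ennreal_plus ennreal_mult mult_nonneg_nonneg)
    qed
    also have "\<dots> = ennreal ?c1 * (\<integral>\<^sup>+x. ennreal (?X x ^ (2 * p)) \<partial>iid Q (f ` S)) + ennreal ?c2"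
      by (subst nn_integral_add) (auto simp: nn_integral_cmult P.emeasure_space_1)
    also have "\<dots> \<le> ennreal ?c1 * ennreal (?C * ?A ^ p) + ennreal ?c2"
      using insert.IH[OF inj] by (intro add_right_mono mult_left_mono) auto
    also have "\<dots> = ennreal (?c1 * (?C * ?A ^ p) + ?c2)"
      using c A0 moment_const_nonneg[OF D(2), of p] by (simp add: ennreal_mult ennreal_plus)
    also have "?c1 * (?C * ?A ^ p) + ?c2 = ?C * ?A ^ p + 4 ^ p * (l * (?C * ?A ^ p) + (1 + (1 / l) ^ (p - 1)) * (D * ((a s)\<^sup>2) ^ p))"
      by (simp add: algebra_simps)
    finally show "?E \<le> ennreal (?C * ?A ^ p + 4 ^ p * (l * (?C * ?A ^ p) + (1 + (1 / l) ^ (p - 1)) * (D * ((a s)\<^sup>2) ^ p)))" .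
  qed simp
  then show ?case using insert by (simp add: add.commute)
qed

lemma quadratic_form_measurable [measurable]:
  "(\<lambda>x. quad_form f S a x) \<in> borel_measurable (iid Q (f ` S))"
  by measurable

text \<open>A new index \<open>s\<close> adds \<open>(y - \<mu>) L + a s s ((y - \<mu>)\<^sup>2 - v)\<close> to the form, where \<open>y\<close> is the new coordinate and
\<open>L\<close> a linear form in the old ones. This is centred for fixed old coordinates, and \<open>linear_form_moment\<close>
controls the moments of \<open>L\<close>. The factor 2 in front of the squares leaves room for \<open>(a k s + a s k)\<^sup>2\<close>.\<close>

lemma quadratic_form_moment:
  fixes f :: "'s \<Rightarrow> 'i" and a :: "'s \<Rightarrow> 's \<Rightarrow> real"
  assumes "finite S" "inj_on f S"
  shows "(\<integral>\<^sup>+x. ennreal (quad_form f S a x ^ (2 * p)) \<partial>iid Q (f ` S))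
    \<le> ennreal (quad_const * (2 * (\<Sum>k\<in>S. \<Sum>l\<in>S. (a k l)\<^sup>2)) ^ p)"
  using assms
proof (induction S rule: finite_induct)
  case empty
  show ?case using p by (simp add: power_0_left)
next
  case (insert s S)
  define c1 where "c1 = moment_const p D"
  define d where "d = 4 ^ p * (D * c1 + D')"
  define C where "C = moment_const p d"
  define A where "A = 2 * (\<Sum>k\<in>S. \<Sum>l\<in>S. (a k l)\<^sup>2)"
  define \<beta> where "\<beta> = (\<Sum>k\<in>S. (a k s + a s k)\<^sup>2)"
  define \<sigma> where "\<sigma> = (\<Sum>k\<in>S. (a k s)\<^sup>2 + (a s k)\<^sup>2)"
  define b where "b = 2 * (\<sigma> + (a s s)\<^sup>2)"
  let ?P = "iid Q (f ` S)"
  define X where "X x = quad_form f S a x" for x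
  define L where "L x = (\<Sum>k\<in>S. (a k s + a s k) * (x (f k) - \<mu>))" for x
  have fin: "finite (f ` S)" and nin: "f s \<notin> f ` S" and inj: "inj_on f S"
    using insert by auto
  have c1: "c1 \<ge> 0" using D by (simp add: c1_def moment_const_nonneg)
  have d: "d \<ge> 0" using c1 D D' by (simp add: d_def)
  have C: "C \<ge> 0" using d by (simp add: C_def moment_const_nonneg)
  have A0: "A \<ge> 0" by (simp add: A_def sum_nonneg)
  have \<beta>0: "\<beta> \<ge> 0" by (simp add: \<beta>_def sum_nonneg)
  have \<beta>b: "\<beta> \<le> b"
  proof -
    have "(u + w)\<^sup>2 \<le> 2 * (u\<^sup>2 + w\<^sup>2)" for u w :: real
      using zero_le_power2[of "u - w"] by (simp add: power2_eq_square algebra_simps)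
    then have "\<beta> \<le> (\<Sum>k\<in>S. 2 * ((a k s)\<^sup>2 + (a s k)\<^sup>2))" unfolding \<beta>_def by (rule sum_mono)
    then have "\<beta> \<le> 2 * \<sigma>" by (simp only: sum_distrib_left \<sigma>_def)
    then show ?thesis unfolding b_def by (simp add: distrib_left add_increasing2)
  qed
  have b0: "b \<ge> 0" using \<beta>0 \<beta>b by linarith
  have "\<sigma> \<ge> 0" by (simp add: \<sigma>_def sum_nonneg)
  then have assb: "(a s s)\<^sup>2 \<le> b" by (simp add: b_def)
  interpret P: prob_space ?P by (rule prob_space_PiM_Q)
  have ev: "0 \<le> u ^ (2 * p)" for u :: real by (simp add: power_mult)
  have [measurable]: "X \<in> borel_measurable ?P" unfolding X_def by measurable
  have [measurable]: "L \<in> borel_measurable ?P" unfolding L_def by measurable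
  have split: "(\<Sum>k\<in>insert s S. \<Sum>l\<in>insert s S. a k l * (((x(f s := y)) (f k) - \<mu>) * ((x(f s := y)) (f l) - \<mu>)))
      - v * (\<Sum>k\<in>insert s S. a k k) = X x + ((y - \<mu>) * L x + a s s * ((y - \<mu>)\<^sup>2 - v))" for x y
  proof -
    let ?y = "\<lambda>k. (x(f s := y)) (f k) - \<mu>"
    have ys: "?y s = y - \<mu>" by simp
    have yk: "?y k = x (f k) - \<mu>" if "k \<in> S" for k
    proof -
      have "f k \<noteq> f s" using nin that by (metis imageI)
      then show ?thesis by simp
    qed
    have "(\<Sum>k\<in>insert s S. \<Sum>l\<in>insert s S. a k l * (?y k * ?y l))
      = a s s * (?y s * ?y s) + ((\<Sum>l\<in>S. a s l * (?y s * ?y l)) + (\<Sum>k\<in>S. a k s * (?y k * ?y s))) + (\<Sum>k\<in>S. \<Sum>l\<in>S. a k l * (?y k * ?y l))"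
      using insert(1,2) by (simp add: sum.distrib del: fun_upd_apply)
    also have "(\<Sum>l\<in>S. a s l * (?y s * ?y l)) + (\<Sum>k\<in>S. a k s * (?y k * ?y s)) = (y - \<mu>) * L x"
      unfolding L_def sum_distrib_left sum.distrib[symmetric]
      by (rule sum.cong) (simp_all only: yk ys algebra_simps)
    also have "(\<Sum>k\<in>S. \<Sum>l\<in>S. a k l * (?y k * ?y l)) = X x + v * (\<Sum>k\<in>S. a k k)"
      unfolding X_def by (simp add: yk del: fun_upd_apply)
    finally show ?thesis unfolding sum.insert[OF insert(1,2)] ys by (simp add: algebra_simps power2_eq_square)
  qed
  let ?E = "\<integral>\<^sup>+x. ennreal (quad_form f (insert s S) a x ^ (2 * p)) \<partial>iid Q (f ` insert s S)"
  have meas: "(\<lambda>x. ennreal (quad_form f (insert s S) a x ^ (2 * p)))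
      \<in> borel_measurable (iid Q (f ` insert s S))"
    by measurable
  have "?E \<le> ennreal (C * (A + b) ^ p)"
    unfolding C_def
  proof (rule variance_increment[OF p A0 b0 d], fold C_def)
    fix l :: real assume l: "l > 0"
    define e where "e = 1 + (1 / l) ^ (p - 1)"
    have e: "e \<ge> 0" using l by (simp add: e_def)
    let ?c1 = "1 + 4 ^ p * l" and ?c2 = "4 ^ p * (e * (4 ^ p * D))" and ?c3 = "4 ^ p * (e * (4 ^ p * (((a s s)\<^sup>2) ^ p * D')))"
    have c: "?c1 \<ge> 0" "?c2 \<ge> 0" "?c3 \<ge> 0" using l D(2) D'(2) e by auto
    have "?E = (\<integral>\<^sup>+x. \<integral>\<^sup>+y. ennreal ((X x + ((y - \<mu>) * L x + a s s * ((y - \<mu>)\<^sup>2 - v))) ^ (2 * p)) \<partial>Q \<partial>?P)"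
      using meas unfolding image_insert split[symmetric] by (rule PQ.product_nn_integral_insert[OF fin nin])
    also have "\<dots> \<le> (\<integral>\<^sup>+x. ennreal (X x ^ (2 * p) + 4 ^ p * (l * X x ^ (2 * p) + e * (4 ^ p * (L x ^ (2 * p) * D + ((a s s)\<^sup>2) ^ p * D')))) \<partial>?P)"
      unfolding e_def
    proof (intro nn_integral_mono centered_increment[OF p l])
      fix x
      have i2: "integrable Q (\<lambda>y. (y - \<mu>)\<^sup>2 - v)" using int2 by simp
      show "integrable Q (\<lambda>y. (y - \<mu>) * L x + a s s * ((y - \<mu>)\<^sup>2 - v))"
        using int1 i2 by (intro Bochner_Integration.integrable_add integrable_mult_right integrable_mult_left) auto
      have "expectation (\<lambda>y. (y - \<mu>) * L x + a s s * ((y - \<mu>)\<^sup>2 - v)) = expectation (\<lambda>y. y - \<mu>) * L x + a s s * expectation (\<lambda>y. (y - \<mu>)\<^sup>2 - v)"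
        by (subst Bochner_Integration.integral_add) (use int1 i2 in \<open>auto intro: integrable_mult_right integrable_mult_left\<close>)
      also have "expectation (\<lambda>y. (y - \<mu>)\<^sup>2 - v) = 0" using int2 var by (simp add: prob_space)
      finally show "expectation (\<lambda>y. (y - \<mu>) * L x + a s s * ((y - \<mu>)\<^sup>2 - v)) = 0" using mean by simp
      have "(\<integral>\<^sup>+y. ennreal (((y - \<mu>) * L x + a s s * ((y - \<mu>)\<^sup>2 - v)) ^ (2 * p)) \<partial>Q)
        \<le> (\<integral>\<^sup>+y. ennreal (4 ^ p * L x ^ (2 * p)) * ennreal ((y - \<mu>) ^ (2 * p)) + ennreal (4 ^ p * ((a s s)\<^sup>2) ^ p) * ennreal (((y - \<mu>)\<^sup>2 - v) ^ (2 * p)) \<partial>Q)"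
      proof (rule nn_integral_mono)
        fix y
        have "((y - \<mu>) * L x + a s s * ((y - \<mu>)\<^sup>2 - v)) ^ (2 * p)
          \<le> 4 ^ p * (((y - \<mu>) * L x) ^ (2 * p) + (a s s * ((y - \<mu>)\<^sup>2 - v)) ^ (2 * p))" by (rule even_power_add_le)
        also have "\<dots> = 4 ^ p * L x ^ (2 * p) * (y - \<mu>) ^ (2 * p) + 4 ^ p * ((a s s)\<^sup>2) ^ p * ((y - \<mu>)\<^sup>2 - v) ^ (2 * p)"
          unfolding power_mult_distrib power_mult[of "a s s"] distrib_left by (simp only: mult_ac)
        finally show "ennreal (((y - \<mu>) * L x + a s s * ((y - \<mu>)\<^sup>2 - v)) ^ (2 * p))
          \<le> ennreal (4 ^ p * L x ^ (2 * p)) * ennreal ((y - \<mu>) ^ (2 * p)) + ennreal (4 ^ p * ((a s s)\<^sup>2) ^ p) * ennreal (((y - \<mu>)\<^sup>2 - v) ^ (2 * p))"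
          using ev by (simp add: ennreal_mult[symmetric] ennreal_plus[symmetric] ennreal_leI del: ennreal_plus)
      qed
      also have "\<dots> = ennreal (4 ^ p * L x ^ (2 * p)) * (\<integral>\<^sup>+y. ennreal ((y - \<mu>) ^ (2 * p)) \<partial>Q) + ennreal (4 ^ p * ((a s s)\<^sup>2) ^ p) * (\<integral>\<^sup>+y. ennreal (((y - \<mu>)\<^sup>2 - v) ^ (2 * p)) \<partial>Q)"
        by (subst nn_integral_add) (auto simp: nn_integral_cmult)
      also have "\<dots> \<le> ennreal (4 ^ p * L x ^ (2 * p)) * ennreal D + ennreal (4 ^ p * ((a s s)\<^sup>2) ^ p) * ennreal D'"
        using D D' by (intro add_mono mult_left_mono) auto
      also have "\<dots> = ennreal (4 ^ p * (L x ^ (2 * p) * D + ((a s s)\<^sup>2) ^ p * D'))"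
        using ev D(2) D'(2) by (simp add: ennreal_mult[symmetric] ennreal_plus[symmetric] distrib_left mult.assoc del: ennreal_plus)
      finally show "(\<integral>\<^sup>+y. ennreal (((y - \<mu>) * L x + a s s * ((y - \<mu>)\<^sup>2 - v)) ^ (2 * p)) \<partial>Q)
        \<le> ennreal (4 ^ p * (L x ^ (2 * p) * D + ((a s s)\<^sup>2) ^ p * D'))" .
      show "0 \<le> 4 ^ p * (L x ^ (2 * p) * D + ((a s s)\<^sup>2) ^ p * D')" using ev D(2) D'(2) by auto
    qed
    also have "\<dots> = (\<integral>\<^sup>+x. ennreal ?c1 * ennreal (X x ^ (2 * p)) + (ennreal ?c2 * ennreal (L x ^ (2 * p)) + ennreal ?c3) \<partial>?P)"
    proof (rule nn_integral_cong)
      fix x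
      have "X x ^ (2 * p) + 4 ^ p * (l * X x ^ (2 * p) + e * (4 ^ p * (L x ^ (2 * p) * D + ((a s s)\<^sup>2) ^ p * D'))) = ?c1 * X x ^ (2 * p) + (?c2 * L x ^ (2 * p) + ?c3)"
        by (simp add: algebra_simps)
      then show "ennreal (X x ^ (2 * p) + 4 ^ p * (l * X x ^ (2 * p) + e * (4 ^ p * (L x ^ (2 * p) * D + ((a s s)\<^sup>2) ^ p * D')))) = ennreal ?c1 * ennreal (X x ^ (2 * p)) + (ennreal ?c2 * ennreal (L x ^ (2 * p)) + ennreal ?c3)"
        using c ev by (simp only: ennreal_plus ennreal_mult mult_nonneg_nonneg add_nonneg_nonneg)
    qed
    also have "\<dots> = ennreal ?c1 * (\<integral>\<^sup>+x. ennreal (X x ^ (2 * p)) \<partial>?P) + (ennreal ?c2 * (\<integral>\<^sup>+x. ennreal (L x ^ (2 * p)) \<partial>?P) + ennreal ?c3)"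
      by (subst nn_integral_add, measurable, subst nn_integral_add, measurable) (auto simp: nn_integral_cmult P.emeasure_space_1)
    also have "\<dots> \<le> ennreal ?c1 * ennreal (C * A ^ p) + (ennreal ?c2 * ennreal (c1 * \<beta> ^ p) + ennreal ?c3)"
      using insert.IH[OF inj] linear_form_moment[OF insert(1) inj, of "\<lambda>k. a k s + a s k"]
      unfolding X_def L_def A_def \<beta>_def C_def d_def c1_def by (intro add_mono mult_left_mono) auto
    also have "\<dots> = ennreal (?c1 * (C * A ^ p) + (?c2 * (c1 * \<beta> ^ p) + ?c3))"
      using c C A0 c1 \<beta>0 by (simp only: ennreal_plus ennreal_mult mult_nonneg_nonneg add_nonneg_nonneg zero_le_power)
    also have "\<dots> \<le> ennreal (?c1 * (C * A ^ p) + (?c2 * (c1 * b ^ p) + 4 ^ p * (e * (4 ^ p * (b ^ p * D')))))"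
      using \<beta>b \<beta>0 assb c c1 e D'(2) by (intro ennreal_leI add_left_mono add_mono mult_left_mono mult_right_mono power_mono) auto
    also have "?c1 * (C * A ^ p) + (?c2 * (c1 * b ^ p) + 4 ^ p * (e * (4 ^ p * (b ^ p * D')))) = C * A ^ p + 4 ^ p * (l * (C * A ^ p) + e * (d * b ^ p))"
      unfolding d_def by (simp add: algebra_simps)
    finally show "?E \<le> ennreal (C * A ^ p + 4 ^ p * (l * (C * A ^ p) + (1 + (1 / l) ^ (p - 1)) * (d * b ^ p)))"
      unfolding e_def .
  qed
  moreover have "A + b = 2 * (\<Sum>k\<in>insert s S. \<Sum>l\<in>insert s S. (a k l)\<^sup>2)"
    using insert(1,2) by (simp add: A_def b_def \<sigma>_def sum.distrib)
  ultimately show ?case unfolding C_def d_def c1_def by simp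
qed

end

section \<open>Tail bounds for linear and quadratic forms\<close>

lemma (in prob_space) even_moment_tail:
  fixes F :: "'a \<Rightarrow> real"
  assumes [measurable]: "F \<in> borel_measurable M"
    and V: "(\<integral>\<^sup>+x. ennreal (F x ^ (2 * p)) \<partial>M) \<le> ennreal V" and t: "t > 0"
  shows "emeasure M {x \<in> space M. t < \<bar>F x\<bar>} \<le> ennreal (V / t ^ (2 * p))"
proof -
  let ?c = "ennreal (1 / t ^ (2 * p))"
  have "emeasure M {x \<in> space M. t < \<bar>F x\<bar>} \<le> emeasure M {x \<in> space M. 1 \<le> ?c * ennreal (F x ^ (2 * p))}"
  proof (intro emeasure_mono subsetI)
    fix x assume x: "x \<in> {x \<in> space M. t < \<bar>F x\<bar>}"
    have "t ^ (2 * p) \<le> \<bar>F x\<bar> ^ (2 * p)" using x t by (intro power_mono) auto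
    then have "1 \<le> 1 / t ^ (2 * p) * F x ^ (2 * p)" using t by (simp add: power_mult)
    then have "ennreal 1 \<le> ennreal (1 / t ^ (2 * p) * F x ^ (2 * p))" by (rule ennreal_leI)
    also have "\<dots> = ?c * ennreal (F x ^ (2 * p))" using t by (intro ennreal_mult) (auto simp: power_mult)
    finally show "x \<in> {x \<in> space M. 1 \<le> ?c * ennreal (F x ^ (2 * p))}" using x by simp
  qed measurable
  also have "\<dots> \<le> ?c * (\<integral>\<^sup>+x. ennreal (F x ^ (2 * p)) * indicator (space M) x \<partial>M)"
    by (rule nn_integral_Markov_inequality) measurable
  also have "(\<integral>\<^sup>+x. ennreal (F x ^ (2 * p)) * indicator (space M) x \<partial>M) = (\<integral>\<^sup>+x. ennreal (F x ^ (2 * p)) \<partial>M)"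
    by (rule nn_integral_cong) simp
  also have "?c * \<dots> \<le> ?c * ennreal V" by (intro mult_left_mono V) simp
  also have "\<dots> = ennreal (V / t ^ (2 * p))" using t by (simp add: ennreal_mult'[symmetric])
  finally show ?thesis .
qed

text \<open>\<open>A\<close> plays the role of the variance. For \<open>A = 0\<close> the threshold is zero and the moments alone would not
exclude exceptional points, whence the separate assumption.\<close>

lemma (in prob_space) complex_moment_tail:
  fixes F :: "'a \<Rightarrow> complex"
  assumes [measurable]: "F \<in> borel_measurable M"
    and re: "(\<integral>\<^sup>+x. ennreal (Re (F x) ^ (2 * p)) \<partial>M) \<le> ennreal (C * A ^ p)"
    and im: "(\<integral>\<^sup>+x. ennreal (Im (F x) ^ (2 * p)) \<partial>M) \<le> ennreal (C * A ^ p)"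
    and A: "A \<ge> 0" "A = 0 \<Longrightarrow> (\<forall>x\<in>space M. F x = 0)" and t: "t > 0" and C: "C \<ge> 0"
  shows "emeasure M {x \<in> space M. 2 * t * sqrt A < cmod (F x)} \<le> ennreal (2 * C / t ^ (2 * p))"
proof (cases "A = 0")
  case True
  then have empty: "{x \<in> space M. 2 * t * sqrt A < cmod (F x)} = {}" using A(2) by auto
  show ?thesis unfolding empty by simp
next
  case False
  then have tA: "t * sqrt A > 0" using A t by simp
  have q: "C * A ^ p / (t * sqrt A) ^ (2 * p) = C / t ^ (2 * p)"
    using False A by (simp add: power_mult_distrib power_mult)
  have "emeasure M {x \<in> space M. 2 * t * sqrt A < cmod (F x)}
     \<le> emeasure M ({x \<in> space M. t * sqrt A < \<bar>Re (F x)\<bar>} \<union> {x \<in> space M. t * sqrt A < \<bar>Im (F x)\<bar>})"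
  proof (intro emeasure_mono subsetI)
    fix x assume x: "x \<in> {x \<in> space M. 2 * t * sqrt A < cmod (F x)}"
    then have "2 * (t * sqrt A) < \<bar>Re (F x)\<bar> + \<bar>Im (F x)\<bar>" using cmod_le[of "F x"] by simp
    then have "t * sqrt A < \<bar>Re (F x)\<bar> \<or> t * sqrt A < \<bar>Im (F x)\<bar>" by linarith
    then show "x \<in> {x \<in> space M. t * sqrt A < \<bar>Re (F x)\<bar>} \<union> {x \<in> space M. t * sqrt A < \<bar>Im (F x)\<bar>}" using x by auto
  qed measurable
  also have "\<dots> \<le> emeasure M {x \<in> space M. t * sqrt A < \<bar>Re (F x)\<bar>} + emeasure M {x \<in> space M. t * sqrt A < \<bar>Im (F x)\<bar>}"
    by (rule emeasure_subadditive) measurable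
  also have "\<dots> \<le> ennreal (C / t ^ (2 * p)) + ennreal (C / t ^ (2 * p))"
    using even_moment_tail[OF _ re tA] even_moment_tail[OF _ im tA] unfolding q by (intro add_mono) auto
  also have "\<dots> = ennreal (2 * C / t ^ (2 * p))" using C t by (simp add: ennreal_plus[symmetric] del: ennreal_plus)
  finally show ?thesis .
qed

lemma sum_bound_sqrt_card:
  fixes a :: "'s \<Rightarrow> complex"
  assumes "card S \<le> n" "(\<Sum>k\<in>S. (cmod (a k))\<^sup>2) \<le> A"
  shows "cmod (\<Sum>k\<in>S. a k) \<le> sqrt n * sqrt A"
proof -
  have A: "A \<ge> 0" using assms(2) by (meson order_trans sum_nonneg zero_le_power2)
  have "cmod (\<Sum>k\<in>S. a k * 1) \<le> sqrt A * sqrt n"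
    by (rule cauchy_schwarz_sum) (use assms A in auto)
  then show ?thesis by (simp add: mult.commute)
qed

context centered_law
begin

lemma centered_linear_tail:
  fixes f :: "'s \<Rightarrow> 'i" and a :: "'s \<Rightarrow> complex"
  assumes S: "finite S" "inj_on f S" and t: "t > 0"
  defines "P \<equiv> iid Q (f ` S)" and "A \<equiv> \<Sum>k\<in>S. (cmod (a k))\<^sup>2"
  shows "emeasure P {x \<in> space P. 2 * t * sqrt A < cmod (\<Sum>k\<in>S. a k * of_real (x (f k) - \<mu>))}
    \<le> ennreal (2 * moment_const p D / t ^ (2 * p))"
proof -
  interpret P: prob_space P unfolding P_def by (rule prob_space_PiM_Q)
  let ?F = "\<lambda>x. \<Sum>k\<in>S. a k * of_real (x (f k) - \<mu>)"
  have c: "moment_const p D \<ge> 0" by (rule moment_const_nonneg[OF D(2)])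
  have le: "(\<integral>\<^sup>+x. ennreal ((\<Sum>k\<in>S. r (a k) * (x (f k) - \<mu>)) ^ (2 * p)) \<partial>P) \<le> ennreal (moment_const p D * A ^ p)"
    if r: "\<And>w. (r w)\<^sup>2 \<le> (cmod w)\<^sup>2" for r
  proof -
    have "(\<Sum>k\<in>S. (r (a k))\<^sup>2) ^ p \<le> A ^ p"
      unfolding A_def by (intro power_mono sum_mono r sum_nonneg) auto
    then show ?thesis
      using linear_form_moment[OF S, of "\<lambda>k. r (a k)"] c unfolding P_def
      by (meson ennreal_leI mult_left_mono order_trans)
  qed
  show ?thesis
  proof (rule P.complex_moment_tail[OF _ _ _ _ _ t c])
    show "?F \<in> borel_measurable P" unfolding P_def by measurable
    show "(\<integral>\<^sup>+x. ennreal (Re (?F x) ^ (2 * p)) \<partial>P) \<le> ennreal (moment_const p D * A ^ p)"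
      using le[of Re] by (simp add: cmod_power2)
    show "(\<integral>\<^sup>+x. ennreal (Im (?F x) ^ (2 * p)) \<partial>P) \<le> ennreal (moment_const p D * A ^ p)"
      using le[of Im] by (simp add: cmod_power2)
    show "A \<ge> 0" by (simp add: A_def sum_nonneg)
    show "\<forall>x\<in>space P. ?F x = 0" if "A = 0"
      using that S unfolding A_def by (subst (asm) sum_nonneg_eq_0_iff) auto
  qed
qed

lemma centered_quadratic_tail:
  fixes f :: "'s \<Rightarrow> 'i" and a :: "'s \<Rightarrow> 's \<Rightarrow> complex"
  assumes S: "finite S" "inj_on f S" and t: "t > 0"
  defines "P \<equiv> iid Q (f ` S)" and "A \<equiv> \<Sum>k\<in>S. \<Sum>l\<in>S. (cmod (a k l))\<^sup>2"
    and "C \<equiv> quad_const * 2 ^ p"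
  shows "emeasure P {x \<in> space P. 2 * t * sqrt A < cmod ((\<Sum>k\<in>S. \<Sum>l\<in>S. a k l * of_real ((x (f k) - \<mu>) * (x (f l) - \<mu>))) - of_real v * (\<Sum>k\<in>S. a k k))}
    \<le> ennreal (2 * C / t ^ (2 * p))"
proof -
  interpret P: prob_space P unfolding P_def by (rule prob_space_PiM_Q)
  let ?F = "\<lambda>x. (\<Sum>k\<in>S. \<Sum>l\<in>S. a k l * of_real ((x (f k) - \<mu>) * (x (f l) - \<mu>))) - of_real v * (\<Sum>k\<in>S. a k k)"
  let ?R = "\<lambda>r x. (\<Sum>k\<in>S. \<Sum>l\<in>S. r (a k l) * ((x (f k) - \<mu>) * (x (f l) - \<mu>))) - v * (\<Sum>k\<in>S. r (a k k))"
  have d: "4 ^ p * (D * moment_const p D + D') \<ge> 0" using D(2) D'(2) moment_const_nonneg[OF D(2), of p] by simp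
  have c: "C \<ge> 0" unfolding C_def using moment_const_nonneg[OF d, of p] by simp
  have le: "(\<integral>\<^sup>+x. ennreal (?R r x ^ (2 * p)) \<partial>P) \<le> ennreal (C * A ^ p)"
    if r: "\<And>w. (r w)\<^sup>2 \<le> (cmod w)\<^sup>2" for r
  proof -
    have "(2 * (\<Sum>k\<in>S. \<Sum>l\<in>S. (r (a k l))\<^sup>2)) ^ p \<le> (2 * A) ^ p"
      unfolding A_def by (intro power_mono mult_left_mono sum_mono r mult_nonneg_nonneg sum_nonneg) auto
    then have "quad_const * (2 * (\<Sum>k\<in>S. \<Sum>l\<in>S. (r (a k l))\<^sup>2)) ^ p \<le> C * A ^ p"
      using mult_left_mono[OF _ moment_const_nonneg[OF d, of p]] unfolding C_def power_mult_distrib[of 2 A] mult.assoc by blast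
    then show ?thesis
      using quadratic_form_moment[OF S, of "\<lambda>k l. r (a k l)"] unfolding P_def
      by (meson ennreal_leI order_trans)
  qed
  show ?thesis
  proof (rule P.complex_moment_tail[OF _ _ _ _ _ t c])
    show "?F \<in> borel_measurable P" unfolding P_def by measurable
    show "(\<integral>\<^sup>+x. ennreal (Re (?F x) ^ (2 * p)) \<partial>P) \<le> ennreal (C * A ^ p)"
      using le[of Re] by (simp add: cmod_power2)
    show "(\<integral>\<^sup>+x. ennreal (Im (?F x) ^ (2 * p)) \<partial>P) \<le> ennreal (C * A ^ p)"
      using le[of Im] by (simp add: cmod_power2)
    show "A \<ge> 0" by (simp add: A_def sum_nonneg)
    show "\<forall>x\<in>space P. ?F x = 0" if "A = 0"
    proof -
      have "\<forall>k\<in>S. \<forall>l\<in>S. a k l = 0"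
        using that S unfolding A_def
        by (subst (asm) sum_nonneg_eq_0_iff) (auto simp: sum_nonneg sum_nonneg_eq_0_iff)
      then show ?thesis by simp
    qed
  qed
qed

text \<open>The mean contributes at most \<open>\<bar>\<mu>\<bar> sqrt n\<close> times the norm of the coefficients, by Cauchy-Schwarz. Under the
assumption on \<open>\<mu>\<close> this is no larger than the fluctuations.\<close>

lemma linear_tail:
  fixes f :: "'s \<Rightarrow> 'i" and a :: "'s \<Rightarrow> complex"
  assumes S: "finite S" "inj_on f S" "card S \<le> n" and L: "L > 0" "\<bar>\<mu>\<bar> * sqrt n \<le> L"
  defines "P \<equiv> iid Q (f ` S)"
  shows "emeasure P {x \<in> space P. 3 * L * sqrt (\<Sum>k\<in>S. (cmod (a k))\<^sup>2) < cmod (\<Sum>k\<in>S. a k * of_real (x (f k)))}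
    \<le> ennreal (2 * moment_const p D / L ^ (2 * p))"
proof -
  define A where "A = (\<Sum>k\<in>S. (cmod (a k))\<^sup>2)"
  have meas: "{x \<in> space P. 2 * L * sqrt A < cmod (\<Sum>k\<in>S. a k * of_real (x (f k) - \<mu>))} \<in> sets P"
    unfolding P_def by measurable
  have "emeasure P {x \<in> space P. 3 * L * sqrt A < cmod (\<Sum>k\<in>S. a k * of_real (x (f k)))}
    \<le> emeasure P {x \<in> space P. 2 * L * sqrt A < cmod (\<Sum>k\<in>S. a k * of_real (x (f k) - \<mu>))}"
  proof (rule emeasure_mono[OF _ meas], safe)
    fix x assume x: "3 * L * sqrt A < cmod (\<Sum>k\<in>S. a k * of_real (x (f k)))"
    have "(\<Sum>k\<in>S. a k * of_real (x (f k))) = (\<Sum>k\<in>S. a k * of_real (x (f k) - \<mu>)) + of_real \<mu> * (\<Sum>k\<in>S. a k)"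
      by (simp add: sum_distrib_left sum.distrib[symmetric] algebra_simps)
    then have "cmod (\<Sum>k\<in>S. a k * of_real (x (f k))) \<le> cmod (\<Sum>k\<in>S. a k * of_real (x (f k) - \<mu>)) + \<bar>\<mu>\<bar> * cmod (\<Sum>k\<in>S. a k)"
      by (metis norm_mult norm_of_real norm_triangle_ineq)
    moreover have "\<bar>\<mu>\<bar> * cmod (\<Sum>k\<in>S. a k) \<le> \<bar>\<mu>\<bar> * (sqrt n * sqrt A)"
      by (intro mult_left_mono sum_bound_sqrt_card S) (auto simp: A_def)
    moreover have "\<bar>\<mu>\<bar> * (sqrt n * sqrt A) \<le> L * sqrt A"
      using mult_right_mono[OF L(2), of "sqrt A"] by (simp add: A_def sum_nonneg mult.assoc)
    ultimately show "2 * L * sqrt A < cmod (\<Sum>k\<in>S. a k * of_real (x (f k) - \<mu>))" using x by linarith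
  qed
  also have "\<dots> \<le> ennreal (2 * moment_const p D / L ^ (2 * p))"
    unfolding P_def A_def by (rule centered_linear_tail[OF S(1,2) L(1)])
  finally show ?thesis unfolding A_def .
qed

text \<open>Expanding in \<open>x - \<mu>\<close> leaves four terms: the centred quadratic form, a linear form with factor \<open>\<mu>\<close>, the
double sum of the coefficients with factor \<open>\<mu>\<^sup>2\<close>, and their trace with factor \<open>v - 1\<close>. By Cauchy-Schwarz
the last three are bounded by the Frobenius norm as soon as \<open>\<mu>\<close> and \<open>v - 1\<close> are of order \<open>1 / sqrt n\<close>. This
is why a random mean and variance of this size do not change the local law.\<close>

lemma quadratic_tail:
  fixes f :: "'s \<Rightarrow> 'i" and a :: "'s \<Rightarrow> 's \<Rightarrow> complex"
  assumes S: "finite S" "inj_on f S" "card S \<le> n"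
    and L: "L \<ge> 1" "\<bar>\<mu>\<bar> * sqrt n \<le> L" "\<bar>v - 1\<bar> * sqrt n \<le> 2 * L\<^sup>2"
  defines "P \<equiv> iid Q (f ` S)"
    and "C \<equiv> quad_const * 2 ^ p + moment_const p D"
  shows "emeasure P {x \<in> space P. 9 * L\<^sup>2 * sqrt (\<Sum>k\<in>S. \<Sum>l\<in>S. (cmod (a k l))\<^sup>2)
      < cmod ((\<Sum>k\<in>S. \<Sum>l\<in>S. a k l * of_real (x (f k) * x (f l))) - (\<Sum>k\<in>S. a k k))}
    \<le> ennreal (2 * C / L ^ (2 * p))"
proof -
  define A where "A = (\<Sum>k\<in>S. \<Sum>l\<in>S. (cmod (a k l))\<^sup>2)"
  define b where "b k = (\<Sum>l\<in>S. a k l + a l k)" for k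
  define B where "B = (\<Sum>k\<in>S. (cmod (b k))\<^sup>2)"
  have A0: "A \<ge> 0" by (simp add: A_def sum_nonneg)
  have B: "sqrt B \<le> 2 * sqrt n * sqrt A"
  proof -
    have "(cmod (b k))\<^sup>2 \<le> n * (\<Sum>l\<in>S. 2 * ((cmod (a k l))\<^sup>2 + (cmod (a l k))\<^sup>2))" if "k \<in> S" for k
    proof -
      have "(cmod (u + w))\<^sup>2 \<le> 2 * ((cmod u)\<^sup>2 + (cmod w)\<^sup>2)" for u w
      proof -
        have "(cmod (u + w))\<^sup>2 \<le> (cmod u + cmod w)\<^sup>2" by (intro power_mono norm_triangle_ineq) auto
        also have "\<dots> \<le> 2 * ((cmod u)\<^sup>2 + (cmod w)\<^sup>2)"
          using zero_le_power2[of "cmod u - cmod w"] by (simp add: power2_eq_square algebra_simps)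
        finally show ?thesis .
      qed
      then have "cmod (b k) \<le> sqrt n * sqrt (\<Sum>l\<in>S. 2 * ((cmod (a k l))\<^sup>2 + (cmod (a l k))\<^sup>2))"
        unfolding b_def by (intro sum_bound_sqrt_card S sum_mono)
      then have "(cmod (b k))\<^sup>2 \<le> (sqrt n * sqrt (\<Sum>l\<in>S. 2 * ((cmod (a k l))\<^sup>2 + (cmod (a l k))\<^sup>2)))\<^sup>2"
        by (intro power_mono) auto
      then show ?thesis by (simp add: power_mult_distrib sum_nonneg)
    qed
    then have "B \<le> (\<Sum>k\<in>S. n * (\<Sum>l\<in>S. 2 * ((cmod (a k l))\<^sup>2 + (cmod (a l k))\<^sup>2)))"
      unfolding B_def by (rule sum_mono)
    also have "\<dots> = n * (2 * (A + (\<Sum>k\<in>S. \<Sum>l\<in>S. (cmod (a l k))\<^sup>2)))"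
      by (simp only: sum_distrib_left[symmetric] sum.distrib A_def)
    also have "(\<Sum>k\<in>S. \<Sum>l\<in>S. (cmod (a l k))\<^sup>2) = A" unfolding A_def by (rule sum.swap)
    finally have "B \<le> (2 * sqrt n * sqrt A)\<^sup>2" using A0 by (simp add: power_mult_distrib)
    then show ?thesis by (intro real_le_lsqrt) (auto simp: A0)
  qed
  have all: "cmod (\<Sum>k\<in>S. \<Sum>l\<in>S. a k l) \<le> n * sqrt A"
  proof -
    have "cmod (\<Sum>(k,l)\<in>S \<times> S. a k l) \<le> sqrt (n * n) * sqrt A"
    proof -
      have "card (S \<times> S) \<le> n * n" using S(3) by (simp add: card_cartesian_product mult_mono)
      moreover have "(\<Sum>z\<in>S \<times> S. (cmod (case z of (k, l) \<Rightarrow> a k l))\<^sup>2) \<le> A"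
        unfolding A_def sum.cartesian_product by (simp add: case_prod_unfold)
      ultimately show ?thesis using sum_bound_sqrt_card[of "S \<times> S" "n * n" "\<lambda>(k,l). a k l" A] by simp
    qed
    then show ?thesis by (simp add: sum.cartesian_product)
  qed
  have diag: "cmod (\<Sum>k\<in>S. a k k) \<le> sqrt n * sqrt A"
  proof (rule sum_bound_sqrt_card[OF S(3)])
    show "(\<Sum>k\<in>S. (cmod (a k k))\<^sup>2) \<le> A" unfolding A_def
      using S(1) by (intro sum_mono member_le_sum[of _ S "\<lambda>l. (cmod (a _ l))\<^sup>2"]) auto
  qed
  define F where "F x = (\<Sum>k\<in>S. \<Sum>l\<in>S. a k l * of_real ((x (f k) - \<mu>) * (x (f l) - \<mu>))) - of_real v * (\<Sum>k\<in>S. a k k)" for x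
  define W where "W x = (\<Sum>k\<in>S. b k * of_real (x (f k) - \<mu>))" for x
  have [measurable]: "F \<in> borel_measurable P" "W \<in> borel_measurable P" unfolding F_def W_def P_def by measurable
  have expand: "(\<Sum>k\<in>S. \<Sum>l\<in>S. a k l * of_real (x (f k) * x (f l))) - (\<Sum>k\<in>S. a k k)
     = F x + of_real \<mu> * W x + of_real (\<mu>\<^sup>2) * (\<Sum>k\<in>S. \<Sum>l\<in>S. a k l) + of_real (v - 1) * (\<Sum>k\<in>S. a k k)" for x
  proof -
    let ?y = "\<lambda>k. complex_of_real (x (f k) - \<mu>)"
    have "a k l * of_real (x (f k) * x (f l)) = a k l * of_real ((x (f k) - \<mu>) * (x (f l) - \<mu>))
        + of_real \<mu> * (a k l * ?y k) + of_real \<mu> * (a k l * ?y l) + of_real (\<mu>\<^sup>2) * a k l" for k l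
      by (simp add: algebra_simps power2_eq_square)
    then have "(\<Sum>k\<in>S. \<Sum>l\<in>S. a k l * of_real (x (f k) * x (f l)))
      = (\<Sum>k\<in>S. \<Sum>l\<in>S. a k l * of_real ((x (f k) - \<mu>) * (x (f l) - \<mu>)))
       + of_real \<mu> * ((\<Sum>k\<in>S. \<Sum>l\<in>S. a k l * ?y k) + (\<Sum>k\<in>S. \<Sum>l\<in>S. a k l * ?y l)) + of_real (\<mu>\<^sup>2) * (\<Sum>k\<in>S. \<Sum>l\<in>S. a k l)"
      by (simp only: sum.distrib sum_distrib_left distrib_left add.assoc)
    also have "(\<Sum>k\<in>S. \<Sum>l\<in>S. a k l * ?y l) = (\<Sum>k\<in>S. \<Sum>l\<in>S. a l k * ?y k)" by (rule sum.swap)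
    also have "(\<Sum>k\<in>S. \<Sum>l\<in>S. a k l * ?y k) + (\<Sum>k\<in>S. \<Sum>l\<in>S. a l k * ?y k) = W x"
      unfolding W_def b_def by (simp only: sum.distrib sum_distrib_right distrib_right)
    finally show ?thesis by (simp add: F_def algebra_simps)
  qed
  have "emeasure P {x \<in> space P. 9 * L\<^sup>2 * sqrt A < cmod ((\<Sum>k\<in>S. \<Sum>l\<in>S. a k l * of_real (x (f k) * x (f l))) - (\<Sum>k\<in>S. a k k))}
    \<le> emeasure P ({x \<in> space P. 2 * L * sqrt A < cmod (F x)} \<union> {x \<in> space P. 2 * L * sqrt B < cmod (W x)})"
  proof (rule emeasure_mono, rule subsetI, rule ccontr)
    fix x assume x: "x \<in> {x \<in> space P. 9 * L\<^sup>2 * sqrt A < cmod ((\<Sum>k\<in>S. \<Sum>l\<in>S. a k l * of_real (x (f k) * x (f l))) - (\<Sum>k\<in>S. a k k))}"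
      and "x \<notin> {x \<in> space P. 2 * L * sqrt A < cmod (F x)} \<union> {x \<in> space P. 2 * L * sqrt B < cmod (W x)}"
    then have FW: "cmod (F x) \<le> 2 * L * sqrt A" "cmod (W x) \<le> 2 * L * sqrt B" by auto
    have sA: "sqrt A \<ge> 0" using A0 by simp
    have LL: "L \<le> L\<^sup>2" using L by (simp add: power2_eq_square)
    have 1: "cmod (F x) \<le> 2 * (L\<^sup>2 * sqrt A)" using FW(1) mult_right_mono[OF LL sA] by linarith
    have 2: "\<bar>\<mu>\<bar> * cmod (W x) \<le> 4 * (L\<^sup>2 * sqrt A)"
    proof -
      have "cmod (W x) \<le> 2 * L * (2 * sqrt n * sqrt A)"
        using FW(2) mult_left_mono[OF B, of "2 * L"] L by linarith
      then have "\<bar>\<mu>\<bar> * cmod (W x) \<le> \<bar>\<mu>\<bar> * (2 * L * (2 * sqrt n * sqrt A))" by (intro mult_left_mono) auto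
      also have "\<dots> = (\<bar>\<mu>\<bar> * sqrt n) * (4 * L * sqrt A)" by simp
      also have "\<dots> \<le> L * (4 * L * sqrt A)" using L sA by (intro mult_right_mono) auto
      finally show ?thesis by (simp add: power2_eq_square mult.assoc)
    qed
    have 3: "\<mu>\<^sup>2 * cmod (\<Sum>k\<in>S. \<Sum>l\<in>S. a k l) \<le> L\<^sup>2 * sqrt A"
    proof -
      have "\<mu>\<^sup>2 * cmod (\<Sum>k\<in>S. \<Sum>l\<in>S. a k l) \<le> \<mu>\<^sup>2 * (n * sqrt A)" using all by (intro mult_left_mono) auto
      also have "\<dots> = (\<bar>\<mu>\<bar> * sqrt n)\<^sup>2 * sqrt A" by (simp add: power_mult_distrib)
      also have "\<dots> \<le> L\<^sup>2 * sqrt A" using L sA by (intro mult_right_mono power_mono) auto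
      finally show ?thesis .
    qed
    have 4: "\<bar>v - 1\<bar> * cmod (\<Sum>k\<in>S. a k k) \<le> 2 * (L\<^sup>2 * sqrt A)"
    proof -
      have "\<bar>v - 1\<bar> * cmod (\<Sum>k\<in>S. a k k) \<le> \<bar>v - 1\<bar> * (sqrt n * sqrt A)" using diag by (intro mult_left_mono) auto
      also have "\<dots> \<le> 2 * L\<^sup>2 * sqrt A" using mult_right_mono[OF L(3) sA] by (simp add: mult.assoc)
      finally show ?thesis by simp
    qed
    have "cmod (F x + of_real \<mu> * W x + of_real (\<mu>\<^sup>2) * (\<Sum>k\<in>S. \<Sum>l\<in>S. a k l) + of_real (v - 1) * (\<Sum>k\<in>S. a k k))
      \<le> cmod (F x) + \<bar>\<mu>\<bar> * cmod (W x) + \<mu>\<^sup>2 * cmod (\<Sum>k\<in>S. \<Sum>l\<in>S. a k l) + \<bar>v - 1\<bar> * cmod (\<Sum>k\<in>S. a k k)"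
    proof -
      have t4: "cmod (p + q + r + s) \<le> cmod p + cmod q + cmod r + cmod s" for p q r s
        using norm_triangle_ineq[of "p + q + r" s] norm_triangle_ineq[of "p + q" r] norm_triangle_ineq[of p q] by linarith
      show ?thesis
        using t4[of "F x" "of_real \<mu> * W x" "of_real (\<mu>\<^sup>2) * (\<Sum>k\<in>S. \<Sum>l\<in>S. a k l)" "of_real (v - 1) * (\<Sum>k\<in>S. a k k)"]
        unfolding norm_mult norm_of_real by simp
    qed
    then show False using x 1 2 3 4 unfolding expand by simp
  qed measurable
  also have "\<dots> \<le> emeasure P {x \<in> space P. 2 * L * sqrt A < cmod (F x)} + emeasure P {x \<in> space P. 2 * L * sqrt B < cmod (W x)}"
    by (rule emeasure_subadditive) measurable
  also have "\<dots> \<le> ennreal (2 * (quad_const * 2 ^ p) / L ^ (2 * p)) + ennreal (2 * moment_const p D / L ^ (2 * p))"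
    unfolding F_def W_def P_def A_def B_def using L
    by (intro add_mono centered_quadratic_tail centered_linear_tail S) auto
  also have "\<dots> = ennreal (2 * C / L ^ (2 * p))"
  proof -
    have "moment_const p D \<ge> 0" "quad_const \<ge> 0"
      using D(2) D'(2) moment_const_nonneg[OF D(2), of p] by (auto intro!: moment_const_nonneg)
    then show ?thesis using L by (simp add: ennreal_plus[symmetric] C_def add_divide_distrib distrib_left del: ennreal_plus)
  qed
  finally show ?thesis unfolding A_def .
qed

end

section \<open>Rows and their minors\<close>

lemma det_measurable:
  fixes b :: "'a \<Rightarrow> nat \<Rightarrow> nat \<Rightarrow> complex"
  assumes "\<And>i j. i < n \<Longrightarrow> j < n \<Longrightarrow> (\<lambda>\<omega>. b \<omega> i j) \<in> borel_measurable M"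
  shows "(\<lambda>\<omega>. det (mat n n (\<lambda>(i, j). b \<omega> i j))) \<in> borel_measurable M"
proof -
  have "det (mat n n (\<lambda>(i, j). b \<omega> i j)) = (\<Sum>p\<in>{p. p permutes {0..<n}}. signof p * (\<Prod>i = 0..<n. b \<omega> i (p i)))" for \<omega>
  proof -
    have "(\<Prod>i = 0..<n. mat n n (\<lambda>(i, j). b \<omega> i j) $$ (i, p i)) = (\<Prod>i = 0..<n. b \<omega> i (p i))" if "p permutes {0..<n}" for p
    proof (rule prod.cong[OF refl])
      fix i assume "i \<in> {0..<n}"
      then have "i < n" "p i < n" using permutes_in_image[OF that, of i] by auto
      then show "mat n n (\<lambda>(i, j). b \<omega> i j) $$ (i, p i) = b \<omega> i (p i)" by simp
    qed
    then show ?thesis by (subst det_def'[of _ n]) (auto intro!: sum.cong)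
  qed
  moreover have "(\<lambda>\<omega>. \<Sum>p\<in>{p. p permutes {0..<n}}. signof p * (\<Prod>i = 0..<n. b \<omega> i (p i))) \<in> borel_measurable M"
  proof (intro borel_measurable_sum borel_measurable_times borel_measurable_prod borel_measurable_const assms)
    fix p i assume "p \<in> {p. p permutes {0..<n}}" "i \<in> {0..<n}"
    then show "i < n" "p i < n" using permutes_in_image[of p "{0..<n}" i] by auto
  qed
  ultimately show ?thesis by presburger
qed

text \<open>By Cramer's rule the entries of the resolvent are quotients of polynomials in the matrix entries.\<close>

lemma green_measurable:
  fixes h :: "'a \<Rightarrow> nat \<Rightarrow> nat \<Rightarrow> real"
  assumes h: "\<And>i j. i < N \<Longrightarrow> j < N \<Longrightarrow> (\<lambda>\<omega>. h \<omega> i j) \<in> borel_measurable M"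
    and sym: "\<And>\<omega>. \<omega> \<in> space M \<Longrightarrow> symmetric_on N (h \<omega>)" and z: "Im z \<noteq> 0" and ij: "i < N" "j < N"
  shows "(\<lambda>\<omega>. green N (h \<omega>) z i j) \<in> borel_measurable M"
proof -
  define A where "A \<omega> = mat N N (\<lambda>(i, j). spectral_mat (h \<omega>) z i j)" for \<omega>
  have A: "A \<omega> \<in> carrier_mat N N" for \<omega> by (simp add: A_def)
  have sm: "(\<lambda>\<omega>. spectral_mat (h \<omega>) z i j) \<in> borel_measurable M" if "i < N" "j < N" for i j
    unfolding spectral_mat_def using h[OF that] by measurable
  have formula: "green N (h \<omega>) z i j = cofactor (A \<omega>) j i / det (A \<omega>)" if \<omega>: "\<omega> \<in> space M" for \<omega>
  proof (rule green_unique[OF sym[OF \<omega>] z ij, symmetric, where F = "\<lambda>i j. cofactor (A \<omega>) j i / det (A \<omega>)"])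
    fix i j assume ij: "i < N" "j < N"
    have d: "det (A \<omega>) \<noteq> 0" unfolding A_def by (rule shifted_mat_det_nonzero[OF sym[OF \<omega>] z])
    have "(adj_mat (A \<omega>) * A \<omega>) $$ (i, j) = (\<Sum>k<N. cofactor (A \<omega>) k i * spectral_mat (h \<omega>) z k j)"
      using ij A[of \<omega>] adj_mat(1)[OF A[of \<omega>]]
      by (auto simp: scalar_prod_def adj_mat_def atLeast0LessThan A_def intro!: sum.cong)
    moreover have "(adj_mat (A \<omega>) * A \<omega>) $$ (i, j) = det (A \<omega>) * kron i j"
      unfolding adj_mat(3)[OF A[of \<omega>]] using ij by simp
    ultimately have e: "(\<Sum>k<N. cofactor (A \<omega>) k i * spectral_mat (h \<omega>) z k j) = det (A \<omega>) * kron i j" by (metis (no_types))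
    have "(\<Sum>k<N. cofactor (A \<omega>) k i * spectral_mat (h \<omega>) z k j) / det (A \<omega>) = kron i j"
      unfolding e using d by simp
    then show "(\<Sum>k<N. cofactor (A \<omega>) k i / det (A \<omega>) * spectral_mat (h \<omega>) z k j) = kron i j"
      by (simp add: sum_divide_distrib)
  qed
  have "(\<lambda>\<omega>. det (A \<omega>)) \<in> borel_measurable M" unfolding A_def by (rule det_measurable) (rule sm)
  moreover have "(\<lambda>\<omega>. cofactor (A \<omega>) j i) \<in> borel_measurable M"
  proof -
    let ?b = "\<lambda>\<omega> i' j'. spectral_mat (h \<omega>) z (if i' < j then i' else Suc i') (if j' < i then j' else Suc j')"
    have "mat_delete (A \<omega>) j i = mat (N - 1) (N - 1) (\<lambda>(i', j'). ?b \<omega> i' j')" for \<omega>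
      unfolding mat_delete_def A_def using ij by (intro eq_matI) auto
    moreover have "(\<lambda>\<omega>. det (mat (N - 1) (N - 1) (\<lambda>(i', j'). ?b \<omega> i' j'))) \<in> borel_measurable M"
      by (rule det_measurable) (rule sm, auto)
    ultimately show ?thesis unfolding cofactor_def by simp
  qed
  ultimately have "(\<lambda>\<omega>. cofactor (A \<omega>) j i / det (A \<omega>)) \<in> borel_measurable M" by measurable
  then show ?thesis using formula by (subst measurable_cong[of M _ "\<lambda>\<omega>. cofactor (A \<omega>) j i / det (A \<omega>)"]) auto
qed

lemma green_cong:
  assumes "\<And>k l. k < N \<Longrightarrow> l < N \<Longrightarrow> h k l = h' k l"
  shows "green N h z = green N h' z"
proof -
  have "mat N N (\<lambda>(i, j). h i j) = mat N N (\<lambda>(i, j). h' i j)" using assms by (intro eq_matI) auto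
  then show ?thesis by (simp add: green_def fun_eq_iff)
qed

definition upper_pairs :: "nat \<Rightarrow> (nat \<times> nat) set" where
  "upper_pairs N = {(i, j). i \<le> j \<and> j < N}"

text \<open>Positions \<open>(i, k)\<close> and \<open>(k, i)\<close> of a symmetric matrix carry the same independent variable.\<close>

definition entry_index :: "nat \<Rightarrow> nat \<Rightarrow> nat \<times> nat" where
  "entry_index i k = (min i k, max i k)"

definition entry_matrix :: "nat \<Rightarrow> (nat \<times> nat \<Rightarrow> real) \<Rightarrow> nat \<Rightarrow> nat \<Rightarrow> real" where
  "entry_matrix N x i j = x (entry_index i j) / sqrt N"

lemma finite_upper_pairs: "finite (upper_pairs N)"
  by (rule finite_subset[of _ "{..<N} \<times> {..<N}"]) (auto simp: upper_pairs_def)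

lemma entry_index_in_upper_pairs: "i < N \<Longrightarrow> k < N \<Longrightarrow> entry_index i k \<in> upper_pairs N"
  by (auto simp: entry_index_def upper_pairs_def)

lemma entry_index_inj: "inj_on (entry_index i) S"
  by (auto simp: inj_on_def entry_index_def min_def max_def split: if_splits)

lemma entry_index_commute: "entry_index i k = entry_index k i"
  by (simp add: entry_index_def min.commute max.commute)

lemma entry_index_notin_row: "k \<noteq> i \<Longrightarrow> l \<noteq> i \<Longrightarrow> entry_index k l \<notin> entry_index i ` S"
  by (auto simp: entry_index_def min_def max_def split: if_splits)

lemma entry_matrix_sym: "symmetric_on N (entry_matrix N x)"
  by (simp add: symmetric_on_def entry_matrix_def entry_index_commute)

context centered_law
begin

lemma linear_tail_set:
  "{x \<in> space (iid Q (f ` S)). c < cmod (\<Sum>k\<in>S. a k * of_real (x (f k)))} \<in> sets (iid Q (f ` S))"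
  by measurable

lemma quadratic_tail_set:
  "{x \<in> space (iid Q (f ` S)). c < cmod ((\<Sum>k\<in>S. \<Sum>l\<in>S. a k l * of_real (x (f k) * x (f l))) - b)} \<in> sets (iid Q (f ` S))"
  by measurable

text \<open>Fubini: a bound for all sections at fixed coordinates in \<open>J\<close> is a bound for the whole event.\<close>

lemma emeasure_PiM_sections:
  assumes J: "finite J" "finite K" "J \<inter> K = {}"
    and E: "E \<in> sets (iid Q (J \<union> K))"
    and c: "\<And>y. y \<in> space (iid Q J) \<Longrightarrow> emeasure (iid Q K) {x \<in> space (iid Q K). merge J K (y, x) \<in> E} \<le> c"
  shows "emeasure (iid Q (J \<union> K)) E \<le> c"
proof -
  interpret P: prob_space "iid Q J" by (rule prob_space_PiM_Q)
  have "emeasure (iid Q (J \<union> K)) E = (\<integral>\<^sup>+w. indicator E w \<partial>iid Q (J \<union> K))"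
    using E by simp
  also have "\<dots> = (\<integral>\<^sup>+y. \<integral>\<^sup>+x. indicator E (merge J K (y, x)) \<partial>iid Q K \<partial>iid Q J)"
    by (rule PQ.product_nn_integral_fold) (use J E in auto)
  also have "\<dots> \<le> (\<integral>\<^sup>+y. c \<partial>iid Q J)"
  proof (rule nn_integral_mono)
    fix y assume y: "y \<in> space (iid Q J)"
    have [measurable]: "(\<lambda>x. merge J K (y, x)) \<in> measurable (iid Q K) (iid Q (J \<union> K))"
      using y by (rule measurable_compose[OF measurable_Pair1' measurable_merge])
    have "(\<lambda>x. merge J K (y, x)) -` E \<inter> space (iid Q K) \<in> sets (iid Q K)"
      by (rule measurable_sets[OF _ E]) measurable
    moreover have "(\<lambda>x. merge J K (y, x)) -` E \<inter> space (iid Q K) = {x \<in> space (iid Q K). merge J K (y, x) \<in> E}" by auto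
    ultimately have S: "{x \<in> space (iid Q K). merge J K (y, x) \<in> E} \<in> sets (iid Q K)" by simp
    have "(\<integral>\<^sup>+x. indicator E (merge J K (y, x)) \<partial>iid Q K)
       = (\<integral>\<^sup>+x. indicator {x \<in> space (iid Q K). merge J K (y, x) \<in> E} x \<partial>iid Q K)"
      by (rule nn_integral_cong) (auto simp: indicator_def)
    also have "\<dots> = emeasure (iid Q K) {x \<in> space (iid Q K). merge J K (y, x) \<in> E}" using S by simp
    finally show "(\<integral>\<^sup>+x. indicator E (merge J K (y, x)) \<partial>iid Q K) \<le> c" using c[OF y] by simp
  qed
  also have "\<dots> = c" by (simp add: P.emeasure_space_1)
  finally show ?thesis .
qed

lemma entry_matrix_measurable:
  assumes "i < N" "j < N"
  shows "(\<lambda>x. entry_matrix N x i j) \<in> borel_measurable (iid Q (upper_pairs N))"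
proof -
  have "(\<lambda>x. x (entry_index i j)) \<in> measurable (iid Q (upper_pairs N)) Q"
    by (rule measurable_component_singleton) (rule entry_index_in_upper_pairs[OF assms])
  then have "(\<lambda>x. x (entry_index i j)) \<in> borel_measurable (iid Q (upper_pairs N))"
    by (simp cong: measurable_cong_sets add: sets_Q)
  then show ?thesis unfolding entry_matrix_def by measurable
qed

lemma entry_green_measurable:
  assumes "Im z \<noteq> 0" "k < N" "l < N"
  shows "(\<lambda>x. green N (minor i (entry_matrix N x)) z k l) \<in> borel_measurable (iid Q (upper_pairs N))"
proof (rule green_measurable[OF _ _ assms])
  fix a b assume "a < N" "b < N"
  from entry_matrix_measurable[OF this]
  show "(\<lambda>x. minor i (entry_matrix N x) a b) \<in> borel_measurable (iid Q (upper_pairs N))"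
    unfolding minor_def by (cases "a = i \<or> b = i") auto
qed (rule minor_sym[OF entry_matrix_sym])

definition row_entries :: "nat \<Rightarrow> nat \<Rightarrow> (nat \<times> nat) set" where
  "row_entries N i = entry_index i ` others N i"

lemma row_split:
  assumes i: "i < N"
  shows "upper_pairs N = (upper_pairs N - row_entries N i) \<union> row_entries N i"
    "(upper_pairs N - row_entries N i) \<inter> row_entries N i = {}"
    "finite (upper_pairs N - row_entries N i)" "finite (row_entries N i)"
  using entry_index_in_upper_pairs[OF i] finite_upper_pairs[of N] by (auto simp: row_entries_def)

text \<open>The independence of row \<open>i\<close> and its minor: the resolvent of the minor does not see the coordinates of row
\<open>i\<close>, which are those replaced by \<open>x\<close>.\<close>

lemma minor_green_merge:
  assumes i: "i < N"
  shows "green N (minor i (entry_matrix N (merge (upper_pairs N - row_entries N i) (row_entries N i) (y, x)))) z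
    = green N (minor i (entry_matrix N y)) z"
proof (rule green_cong)
  fix k l assume kl: "k < N" "l < N"
  show "minor i (entry_matrix N (merge (upper_pairs N - row_entries N i) (row_entries N i) (y, x))) k l = minor i (entry_matrix N y) k l"
  proof (cases "k = i \<or> l = i")
    case False
    then have "entry_index k l \<in> upper_pairs N - row_entries N i"
      using entry_index_notin_row[of k i l "others N i"] entry_index_in_upper_pairs[OF kl] by (auto simp: row_entries_def)
    then show ?thesis using False by (simp add: minor_def entry_matrix_def merge_def)
  qed (simp add: minor_def)
qed

lemma merge_row:
  assumes "k \<in> others N i"
  shows "merge (upper_pairs N - row_entries N i) (row_entries N i) (y, x) (entry_index i k) = x (entry_index i k)"
  using assms by (auto simp: merge_def row_entries_def)

lemma card_others: "i < N \<Longrightarrow> card (others N i) \<le> N"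
  by simp

text \<open>In each section the coefficients of the form are constants, so \<open>linear_tail\<close> applies; likewise for the
quadratic form and \<open>quadratic_tail\<close> in \<open>row_quadratic_bad\<close>.\<close>

lemma row_linear_bad:
  fixes N :: nat
  assumes i: "i < N" and j: "j < N" and z: "Im z \<noteq> 0" and L: "L \<ge> 1" "\<bar>\<mu>\<bar> * sqrt N \<le> L"
  defines "P \<equiv> iid Q (upper_pairs N)" and "Gm \<equiv> \<lambda>w. green N (minor i (entry_matrix N w)) z"
  defines "E \<equiv> {w \<in> space P. 3 * L * sqrt (\<Sum>k\<in>others N i. (cmod (Gm w k j))\<^sup>2) < cmod (\<Sum>k\<in>others N i. Gm w k j * of_real (w (entry_index i k)))}"
  shows "E \<in> sets P" "emeasure P E \<le> ennreal (2 * moment_const p D / L ^ (2 * p))"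
proof -
  have [measurable]: "(\<lambda>w. Gm w k j) \<in> borel_measurable P" if "k \<in> others N i" for k
    unfolding Gm_def P_def using that by (intro entry_green_measurable z j) auto
  have [measurable]: "(\<lambda>w. w (entry_index i k)) \<in> borel_measurable P" if "k \<in> others N i" for k
  proof -
    have "(\<lambda>x. x (entry_index i k)) \<in> measurable P Q" unfolding P_def
      by (rule measurable_component_singleton) (use entry_index_in_upper_pairs i that in auto)
    then show ?thesis by (simp cong: measurable_cong_sets add: sets_Q)
  qed
  show E: "E \<in> sets P" unfolding E_def by measurable
  let ?J = "upper_pairs N - row_entries N i" and ?K = "row_entries N i"
  note sp = row_split[OF i]
  have "emeasure (iid Q (?J \<union> ?K)) E \<le> ennreal (2 * moment_const p D / L ^ (2 * p))"
  proof (rule emeasure_PiM_sections[OF sp(3,4,2)])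
    show "E \<in> sets (iid Q (?J \<union> ?K))" using E unfolding P_def sp(1)[symmetric] .
    fix y assume y: "y \<in> space (iid Q ?J)"
    let ?a = "\<lambda>k. green N (minor i (entry_matrix N y)) z k j"
    have "{x \<in> space (iid Q ?K). merge ?J ?K (y, x) \<in> E}
      \<subseteq> {x \<in> space (iid Q (entry_index i ` others N i)). 3 * L * sqrt (\<Sum>k\<in>others N i. (cmod (?a k))\<^sup>2) < cmod (\<Sum>k\<in>others N i. ?a k * of_real (x (entry_index i k)))}"
      unfolding E_def Gm_def by (auto simp: minor_green_merge[OF i] merge_row row_entries_def[symmetric] simp del: Diff_iff insert_iff)
    moreover have "{x \<in> space (iid Q (entry_index i ` others N i)). 3 * L * sqrt (\<Sum>k\<in>others N i. (cmod (?a k))\<^sup>2) < cmod (\<Sum>k\<in>others N i. ?a k * of_real (x (entry_index i k)))} \<in> sets (iid Q (entry_index i ` others N i))"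
      by (rule linear_tail_set)
    ultimately have "emeasure (iid Q ?K) {x \<in> space (iid Q ?K). merge ?J ?K (y, x) \<in> E}
       \<le> emeasure (iid Q (entry_index i ` others N i)) {x \<in> space (iid Q (entry_index i ` others N i)). 3 * L * sqrt (\<Sum>k\<in>others N i. (cmod (?a k))\<^sup>2) < cmod (\<Sum>k\<in>others N i. ?a k * of_real (x (entry_index i k)))}"
      unfolding row_entries_def by (rule emeasure_mono)
    also have "\<dots> \<le> ennreal (2 * moment_const p D / L ^ (2 * p))"
      by (rule linear_tail[OF _ entry_index_inj card_others[OF i]]) (use L in auto)
    finally show "emeasure (iid Q ?K) {x \<in> space (iid Q ?K). merge ?J ?K (y, x) \<in> E} \<le> ennreal (2 * moment_const p D / L ^ (2 * p))" .
  qed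
  then show "emeasure P E \<le> ennreal (2 * moment_const p D / L ^ (2 * p))" unfolding P_def sp(1)[symmetric] .
qed

definition tail_const :: real where
  "tail_const = quad_const * 2 ^ p + moment_const p D"

lemma row_quadratic_bad:
  fixes N :: nat
  assumes i: "i < N" and z: "Im z \<noteq> 0" and L: "L \<ge> 1" "\<bar>\<mu>\<bar> * sqrt N \<le> L" "\<bar>v - 1\<bar> * sqrt N \<le> 2 * L\<^sup>2"
  defines "P \<equiv> iid Q (upper_pairs N)" and "Gm \<equiv> \<lambda>w. green N (minor i (entry_matrix N w)) z"
  defines "E \<equiv> {w \<in> space P. 9 * L\<^sup>2 * sqrt (\<Sum>k\<in>others N i. \<Sum>l\<in>others N i. (cmod (Gm w k l))\<^sup>2)
    < cmod ((\<Sum>k\<in>others N i. \<Sum>l\<in>others N i. Gm w k l * of_real (w (entry_index i k) * w (entry_index i l))) - (\<Sum>k\<in>others N i. Gm w k k))}"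
  shows "E \<in> sets P" "emeasure P E \<le> ennreal (2 * tail_const / L ^ (2 * p))"
proof -
  have [measurable]: "(\<lambda>w. Gm w k l) \<in> borel_measurable P" if "k \<in> others N i" "l \<in> others N i" for k l
    unfolding Gm_def P_def using that by (intro entry_green_measurable z) auto
  have [measurable]: "(\<lambda>w. w (entry_index i k)) \<in> borel_measurable P" if "k \<in> others N i" for k
  proof -
    have "(\<lambda>x. x (entry_index i k)) \<in> measurable P Q" unfolding P_def
      by (rule measurable_component_singleton) (use entry_index_in_upper_pairs i that in auto)
    then show ?thesis by (simp cong: measurable_cong_sets add: sets_Q)
  qed
  show E: "E \<in> sets P" unfolding E_def by measurable
  let ?J = "upper_pairs N - row_entries N i" and ?K = "row_entries N i"
  note sp = row_split[OF i]
  have "emeasure (iid Q (?J \<union> ?K)) E \<le> ennreal (2 * tail_const / L ^ (2 * p))"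
  proof (rule emeasure_PiM_sections[OF sp(3,4,2)])
    show "E \<in> sets (iid Q (?J \<union> ?K))" using E unfolding P_def sp(1)[symmetric] .
    fix y assume y: "y \<in> space (iid Q ?J)"
    let ?a = "green N (minor i (entry_matrix N y)) z"
    let ?F = "{x \<in> space (iid Q (entry_index i ` others N i)). 9 * L\<^sup>2 * sqrt (\<Sum>k\<in>others N i. \<Sum>l\<in>others N i. (cmod (?a k l))\<^sup>2)
      < cmod ((\<Sum>k\<in>others N i. \<Sum>l\<in>others N i. ?a k l * of_real (x (entry_index i k) * x (entry_index i l))) - (\<Sum>k\<in>others N i. ?a k k))}"
    have "{x \<in> space (iid Q ?K). merge ?J ?K (y, x) \<in> E} \<subseteq> ?F"
      unfolding E_def Gm_def by (auto simp: minor_green_merge[OF i] merge_row row_entries_def[symmetric] simp del: Diff_iff insert_iff)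
    moreover have "?F \<in> sets (iid Q (entry_index i ` others N i))" by (rule quadratic_tail_set)
    ultimately have "emeasure (iid Q ?K) {x \<in> space (iid Q ?K). merge ?J ?K (y, x) \<in> E}
       \<le> emeasure (iid Q (entry_index i ` others N i)) ?F"
      unfolding row_entries_def by (rule emeasure_mono)
    also have "\<dots> \<le> ennreal (2 * tail_const / L ^ (2 * p))"
      unfolding tail_const_def by (rule quadratic_tail[OF _ entry_index_inj card_others[OF i] L]) auto
    finally show "emeasure (iid Q ?K) {x \<in> space (iid Q ?K). merge ?J ?K (y, x) \<in> E} \<le> ennreal (2 * tail_const / L ^ (2 * p))" .
  qed
  then show "emeasure P E \<le> ennreal (2 * tail_const / L ^ (2 * p))" unfolding P_def sp(1)[symmetric] .
qed

lemma diagonal_bad: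
  fixes N :: nat
  assumes i: "i < N" and L: "L \<ge> 1" "\<bar>\<mu>\<bar> * sqrt N \<le> L"
  defines "P \<equiv> iid Q (upper_pairs N)"
  defines "E \<equiv> {w \<in> space P. 3 * L < \<bar>w (i, i)\<bar>}"
  shows "E \<in> sets P" "emeasure P E \<le> ennreal (2 * moment_const p D / L ^ (2 * p))"
proof -
  have ii: "(i, i) \<in> upper_pairs N" using i by (simp add: upper_pairs_def)
  have [measurable]: "(\<lambda>w. w (i, i)) \<in> borel_measurable P"
  proof -
    have "(\<lambda>x. x (i, i)) \<in> measurable P Q" unfolding P_def by (rule measurable_component_singleton[OF ii])
    then show ?thesis by (simp cong: measurable_cong_sets add: sets_Q)
  qed
  show E: "E \<in> sets P" unfolding E_def by measurable
  let ?J = "upper_pairs N - {(i, i)}" and ?K = "{(i, i)}"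
  have sp: "?J \<union> ?K = upper_pairs N" "finite ?J" using ii finite_upper_pairs by auto
  have "emeasure (iid Q (?J \<union> ?K)) E \<le> ennreal (2 * moment_const p D / L ^ (2 * p))"
  proof (rule emeasure_PiM_sections[OF sp(2)])
    show "E \<in> sets (iid Q (?J \<union> ?K))" using E unfolding P_def sp(1) .
    fix y
    let ?P = "iid Q ((\<lambda>_. (i, i)) ` {i})"
    let ?F = "{x \<in> space ?P. 3 * L * sqrt (\<Sum>k\<in>{i}. (cmod 1)\<^sup>2) < cmod (\<Sum>k\<in>{i}. 1 * of_real (x (i, i)))}"
    have "{x \<in> space (iid Q ?K). merge ?J ?K (y, x) \<in> E} \<subseteq> ?F" unfolding E_def by (auto simp: merge_def)
    moreover have "?F \<in> sets ?P" by (rule linear_tail_set)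
    ultimately have "emeasure (iid Q ?K) {x \<in> space (iid Q ?K). merge ?J ?K (y, x) \<in> E} \<le> emeasure ?P ?F"
      using emeasure_mono[of _ ?F ?P] by simp
    also have "\<dots> \<le> ennreal (2 * moment_const p D / L ^ (2 * p))"
      by (rule linear_tail[of "{i}" "\<lambda>_. (i, i)" N L "\<lambda>_. 1"]) (use L i in auto)
    finally show "emeasure (iid Q ?K) {x \<in> space (iid Q ?K). merge ?J ?K (y, x) \<in> E} \<le> ennreal (2 * moment_const p D / L ^ (2 * p))" .
  qed auto
  then show "emeasure P E \<le> ennreal (2 * moment_const p D / L ^ (2 * p))" unfolding P_def sp(1) .
qed

end

section \<open>The event that all rows are good\<close>

context centered_law
begin

lemma moment_const_le_tail_const: "moment_const p D \<le> tail_const"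
proof -
  have "0 \<le> quad_const"
    using D(2) D'(2) moment_const_nonneg[OF D(2), of p] by (auto intro!: moment_const_nonneg)
  then show ?thesis by (simp add: tail_const_def)
qed

lemma tail_const_nonneg: "tail_const \<ge> 0"
  using moment_const_le_tail_const moment_const_nonneg[OF D(2), of p] by linarith

text \<open>The \<open>N + 2\<close> events are the diagonal entry, the quadratic form and one linear form for each column.\<close>

lemma row_bad_event:
  fixes N i :: nat
  assumes i: "i < N" and z: "Im z \<noteq> 0" and L: "L \<ge> 1" "\<bar>\<mu>\<bar> * sqrt N \<le> L" "\<bar>v - 1\<bar> * sqrt N \<le> 2 * L\<^sup>2"
  defines "P \<equiv> iid Q (upper_pairs N)"
  shows "\<exists>E\<in>sets P. emeasure P E \<le> ennreal (real (N + 2) * (2 * tail_const / L ^ (2 * p))) \<and>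
    (\<forall>w\<in>space P - E. good_row N (entry_matrix N w) z (9 * L\<^sup>2) i)"
proof -
  define c where "c = 2 * tail_const / L ^ (2 * p)"
  have c0: "c \<ge> 0" using tail_const_nonneg L by (simp add: c_def)
  have mc: "ennreal (2 * moment_const p D / L ^ (2 * p)) \<le> ennreal c"
    unfolding c_def using moment_const_le_tail_const L by (intro ennreal_leI divide_right_mono mult_left_mono) auto
  define Gm where "Gm = (\<lambda>w. green N (minor i (entry_matrix N w)) z)"
  define E1 where "E1 = {w \<in> space P. 3 * L < \<bar>w (i, i)\<bar>}"
  define E2 where "E2 = {w \<in> space P. 9 * L\<^sup>2 * sqrt (\<Sum>k\<in>others N i. \<Sum>l\<in>others N i. (cmod (Gm w k l))\<^sup>2)
    < cmod ((\<Sum>k\<in>others N i. \<Sum>l\<in>others N i. Gm w k l * of_real (w (entry_index i k) * w (entry_index i l))) - (\<Sum>k\<in>others N i. Gm w k k))}"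
  define E3 where "E3 j = {w \<in> space P. 3 * L * sqrt (\<Sum>k\<in>others N i. (cmod (Gm w k j))\<^sup>2) < cmod (\<Sum>k\<in>others N i. Gm w k j * of_real (w (entry_index i k)))}" for j
  have e1: "E1 \<in> sets P" "emeasure P E1 \<le> ennreal c"
    unfolding E1_def P_def using diagonal_bad[OF i L(1,2)] mc by (auto intro: order_trans)
  have e2: "E2 \<in> sets P" "emeasure P E2 \<le> ennreal c"
    unfolding E2_def P_def Gm_def c_def using row_quadratic_bad[OF i z L] by auto
  have e3: "E3 j \<in> sets P" "emeasure P (E3 j) \<le> ennreal c" if "j < N" for j
    unfolding E3_def P_def Gm_def using row_linear_bad[OF i that z L(1,2)] mc by (auto intro: order_trans)
  let ?E = "E1 \<union> E2 \<union> (\<Union>j<N. E3 j)"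
  have e3': "(\<Union>j<N. E3 j) \<in> sets P" using e3 by auto
  have "emeasure P ?E \<le> emeasure P E1 + emeasure P E2 + emeasure P (\<Union>j<N. E3 j)"
    using emeasure_subadditive[of "E1 \<union> E2" P "\<Union>j<N. E3 j"] emeasure_subadditive[of E1 P E2] e1 e2 e3'
    by (meson add_right_mono order_trans sets.Un)
  also have "emeasure P (\<Union>j<N. E3 j) \<le> (\<Sum>j<N. emeasure P (E3 j))"
    using e3 by (intro emeasure_subadditive_finite) auto
  also have "\<dots> \<le> (\<Sum>j<N. ennreal c)" using e3 by (intro sum_mono) auto
  also have "emeasure P E1 + emeasure P E2 + (\<Sum>j<N. ennreal c) \<le> ennreal c + ennreal c + (\<Sum>j<N. ennreal c)"
    using e1 e2 by (intro add_mono) auto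
  also have "\<dots> = ennreal (real (N + 2) * c)"
    using c0 by (simp add: ennreal_plus[symmetric] ennreal_mult[symmetric] ennreal_of_nat_eq_real_of_nat algebra_simps del: ennreal_plus)
  finally have "emeasure P ?E \<le> ennreal (real (N + 2) * c)" by (simp add: add_left_mono)
  moreover have "good_row N (entry_matrix N w) z (9 * L\<^sup>2) i" if w: "w \<in> space P - ?E" for w
  proof -
    have N: "real N > 0" using i by simp
    have LL: "3 * L \<le> 9 * L\<^sup>2" using L by (simp add: power2_eq_square)
    have hk: "of_real (entry_matrix N w i k) = complex_of_real (w (entry_index i k)) / of_real (sqrt N)" for k
      by (simp add: entry_matrix_def)
    have d: "\<bar>w (i, i)\<bar> \<le> 9 * L\<^sup>2" using w LL by (auto simp: E1_def)
    have q: "cmod ((\<Sum>k\<in>others N i. \<Sum>l\<in>others N i. Gm w k l * of_real (w (entry_index i k) * w (entry_index i l))) - (\<Sum>k\<in>others N i. Gm w k k))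
      \<le> 9 * L\<^sup>2 * sqrt (\<Sum>k\<in>others N i. \<Sum>l\<in>others N i. (cmod (Gm w k l))\<^sup>2)"
      using w by (auto simp: E2_def)
    have l: "cmod (\<Sum>k\<in>others N i. Gm w k j * of_real (w (entry_index i k))) \<le> 3 * L * sqrt (\<Sum>k\<in>others N i. (cmod (Gm w k j))\<^sup>2)"
      if "j \<in> others N i" for j
      using w that by (auto simp: E3_def not_less)
    have Gw: "green N (minor i (entry_matrix N w)) z = Gm w" by (simp add: Gm_def)
    show ?thesis unfolding good_row_def Gw
    proof (intro conjI ballI)
      show "\<bar>entry_matrix N w i i\<bar> \<le> 9 * L\<^sup>2 / sqrt N"
        using d N by (simp add: entry_matrix_def entry_index_def divide_right_mono)
      have "(\<Sum>k\<in>others N i. \<Sum>l\<in>others N i. of_real (entry_matrix N w i k * entry_matrix N w i l) * Gm w k l)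
        = (\<Sum>k\<in>others N i. \<Sum>l\<in>others N i. Gm w k l * of_real (w (entry_index i k) * w (entry_index i l))) / of_nat N"
      proof -
        have "of_real (entry_matrix N w i k * entry_matrix N w i l) * Gm w k l = Gm w k l * of_real (w (entry_index i k) * w (entry_index i l)) / of_nat N" for k l
        proof -
          have "entry_matrix N w i k * entry_matrix N w i l = w (entry_index i k) * w (entry_index i l) / N" by (simp add: entry_matrix_def)
          then show ?thesis by simp
        qed
        then show ?thesis by (simp add: sum_divide_distrib)
      qed
      then have "(\<Sum>k\<in>others N i. \<Sum>l\<in>others N i. of_real (entry_matrix N w i k * entry_matrix N w i l) * Gm w k l) - (\<Sum>k\<in>others N i. Gm w k k) / of_nat N
        = ((\<Sum>k\<in>others N i. \<Sum>l\<in>others N i. Gm w k l * of_real (w (entry_index i k) * w (entry_index i l))) - (\<Sum>k\<in>others N i. Gm w k k)) / of_nat N"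
        by (simp only: diff_divide_distrib)
      then show "cmod ((\<Sum>k\<in>others N i. \<Sum>l\<in>others N i. of_real (entry_matrix N w i k * entry_matrix N w i l) * Gm w k l) - (\<Sum>k\<in>others N i. Gm w k k) / of_nat N)
        \<le> 9 * L\<^sup>2 / N * sqrt (\<Sum>k\<in>others N i. \<Sum>l\<in>others N i. (cmod (Gm w k l))\<^sup>2)"
        using divide_right_mono[OF q, of "real N"] N by (simp only: norm_divide norm_of_nat) simp
      fix j assume j: "j \<in> others N i"
      have "(\<Sum>k\<in>others N i. of_real (entry_matrix N w i k) * Gm w k j) = (\<Sum>k\<in>others N i. Gm w k j * of_real (w (entry_index i k))) / of_real (sqrt N)"
        unfolding sum_divide_distrib hk by (rule sum.cong) simp_all
      moreover have "cmod (\<Sum>k\<in>others N i. Gm w k j * of_real (w (entry_index i k))) \<le> 9 * L\<^sup>2 * sqrt (\<Sum>k\<in>others N i. (cmod (Gm w k j))\<^sup>2)"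
        by (rule order_trans[OF l[OF j] mult_right_mono[OF LL]]) (simp add: sum_nonneg)
      ultimately show "cmod (\<Sum>k\<in>others N i. of_real (entry_matrix N w i k) * Gm w k j) \<le> 9 * L\<^sup>2 / sqrt N * sqrt (\<Sum>k\<in>others N i. (cmod (Gm w k j))\<^sup>2)"
        using divide_right_mono[of _ _ "sqrt N"] N by (simp add: norm_divide)
    qed
  qed
  ultimately show ?thesis using e1 e2 e3' unfolding c_def by (intro bexI[of _ ?E]) auto
qed

lemma good_rows_event:
  fixes N :: nat
  assumes Z: "finite Z" "\<And>z. z \<in> Z \<Longrightarrow> Im z \<noteq> 0"
    and L: "L \<ge> 1" "\<bar>\<mu>\<bar> * sqrt N \<le> L" "\<bar>v - 1\<bar> * sqrt N \<le> 2 * L\<^sup>2"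
  defines "P \<equiv> iid Q (upper_pairs N)"
  shows "\<exists>E\<in>sets P. emeasure P E \<le> ennreal (real (card Z * N * (N + 2)) * (2 * tail_const / L ^ (2 * p))) \<and>
    (\<forall>w\<in>space P - E. \<forall>z\<in>Z. \<forall>i<N. good_row N (entry_matrix N w) z (9 * L\<^sup>2) i)"
proof -
  define c where "c = real (N + 2) * (2 * tail_const / L ^ (2 * p))"
  have c0: "c \<ge> 0" using tail_const_nonneg L by (simp add: c_def)
  have "\<forall>q\<in>Z \<times> {..<N}. \<exists>E. E \<in> sets P \<and> emeasure P E \<le> ennreal c \<and>
      (\<forall>w\<in>space P - E. good_row N (entry_matrix N w) (fst q) (9 * L\<^sup>2) (snd q))"
  proof
    fix q assume "q \<in> Z \<times> {..<N}"
    then have "snd q < N" "Im (fst q) \<noteq> 0" using Z by auto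
    from row_bad_event[OF this L] show "\<exists>E. E \<in> sets P \<and> emeasure P E \<le> ennreal c \<and>
      (\<forall>w\<in>space P - E. good_row N (entry_matrix N w) (fst q) (9 * L\<^sup>2) (snd q))"
      unfolding P_def c_def by blast
  qed
  then obtain E where E: "\<And>q. q \<in> Z \<times> {..<N} \<Longrightarrow> E q \<in> sets P \<and> emeasure P (E q) \<le> ennreal c \<and>
      (\<forall>w\<in>space P - E q. good_row N (entry_matrix N w) (fst q) (9 * L\<^sup>2) (snd q))"
    by metis
  have fin: "finite (Z \<times> {..<N})" using Z by auto
  have "emeasure P (\<Union>q\<in>Z \<times> {..<N}. E q) \<le> (\<Sum>q\<in>Z \<times> {..<N}. emeasure P (E q))"
    using E fin by (intro emeasure_subadditive_finite) auto
  also have "\<dots> \<le> (\<Sum>q\<in>Z \<times> {..<N}. ennreal c)" using E by (intro sum_mono) auto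
  also have "\<dots> = ennreal (real (card Z * N) * c)"
    using c0 by (simp add: card_cartesian_product ennreal_mult ennreal_of_nat_eq_real_of_nat)
  finally have "emeasure P (\<Union>q\<in>Z \<times> {..<N}. E q) \<le> ennreal (real (card Z * N * (N + 2)) * (2 * tail_const / L ^ (2 * p)))"
    by (simp only: c_def of_nat_mult mult.assoc)
  moreover have "(\<Union>q\<in>Z \<times> {..<N}. E q) \<in> sets P" using E fin by auto
  moreover have "\<forall>w\<in>space P - (\<Union>q\<in>Z \<times> {..<N}. E q). \<forall>z\<in>Z. \<forall>i<N. good_row N (entry_matrix N w) z (9 * L\<^sup>2) i"
    using E by fastforce
  ultimately show ?thesis by blast
qed

end

definition law_error :: "real mat \<Rightarrow> complex \<Rightarrow> real" where
  "law_error A z = max (Lambda A z) (cmod (normalized_trace A z - msc z))"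

abbreviation local_law_error :: "nat \<Rightarrow> (nat \<Rightarrow> nat \<Rightarrow> real) \<Rightarrow> complex \<Rightarrow> real" where
  "local_law_error N h z \<equiv> law_error (mat N N (\<lambda>(i, j). h i j)) z"

lemma local_law_error_eq:
  assumes sym: "symmetric_on N h" and z: "Im z \<noteq> 0"
  shows "local_law_error N h z = max (Max ((\<lambda>(i, j). cmod (green N h z i j - msc z * kron i j)) ` ({..<N} \<times> {..<N})))
     (cmod (green_avg N h z - msc z))"
proof -
  have "Lambda (mat N N (\<lambda>(i, j). h i j)) z = Max ((\<lambda>(i, j). cmod (green N h z i j - msc z * kron i j)) ` ({..<N} \<times> {..<N}))"
  proof -
    have "{f i j |i j. i < N \<and> j < N} = (\<lambda>(i, j). f i j) ` ({..<N} \<times> {..<N})" for f :: "nat \<Rightarrow> nat \<Rightarrow> real" by auto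
    then show ?thesis unfolding Lambda_def green_def dim_row_mat by presburger
  qed
  moreover have "normalized_trace (mat N N (\<lambda>(i, j). h i j)) z = green_avg N h z"
    using resolvent_inverse(1)[OF sym z] by (simp add: normalized_trace_def mat_trace_def green_avg_def green_def)
  ultimately show ?thesis by (simp add: law_error_def)
qed

lemma local_law_error_measurable:
  fixes h :: "'a \<Rightarrow> nat \<Rightarrow> nat \<Rightarrow> real"
  assumes h: "\<And>i j. i < N \<Longrightarrow> j < N \<Longrightarrow> (\<lambda>\<omega>. h \<omega> i j) \<in> borel_measurable M"
    and sym: "\<And>\<omega>. \<omega> \<in> space M \<Longrightarrow> symmetric_on N (h \<omega>)" and z: "Im z \<noteq> 0"
  shows "(\<lambda>\<omega>. local_law_error N (h \<omega>) z) \<in> borel_measurable M"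
proof -
  have g[measurable]: "(\<lambda>\<omega>. green N (h \<omega>) z i j) \<in> borel_measurable M" if "i < N" "j < N" for i j
    by (rule green_measurable[OF h sym z that])
  have "(\<lambda>\<omega>. Max ((\<lambda>q. cmod (green N (h \<omega>) z (fst q) (snd q) - msc z * kron (fst q) (snd q))) ` ({..<N} \<times> {..<N}))) \<in> borel_measurable M"
    by (rule borel_measurable_Max) auto
  moreover have "(\<lambda>\<omega>. green_avg N (h \<omega>) z) \<in> borel_measurable M"
    unfolding green_avg_def by (intro borel_measurable_divide borel_measurable_sum g) auto
  ultimately have "(\<lambda>\<omega>. max (Max ((\<lambda>(i, j). cmod (green N (h \<omega>) z i j - msc z * kron i j)) ` ({..<N} \<times> {..<N}))) (cmod (green_avg N (h \<omega>) z - msc z))) \<in> borel_measurable M"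
    by (simp add: case_prod_unfold)
  then show ?thesis using local_law_error_eq[OF sym z] by (subst measurable_cong) auto
qed

lemma local_law_error_le:
  assumes sym: "symmetric_on N h" and z: "Im z \<noteq> 0" and N: "N \<ge> 1"
    and "cmod (green_avg N h z - msc z) \<le> b" "\<And>i j. i < N \<Longrightarrow> j < N \<Longrightarrow> cmod (green N h z i j - msc z * kron i j) \<le> b"
  shows "local_law_error N h z \<le> b"
  unfolding local_law_error_eq[OF sym z] using assms(4,5) N by (auto simp: lessThan_empty_iff)

section \<open>Independent entries\<close>

lemma second_moment_integrable:
  assumes Q: "prob_space Q" "sets Q = sets borel" and m: "(\<integral>\<^sup>+y. ennreal (\<bar>y - c\<bar> ^ 2) \<partial>Q) \<le> ennreal K"
  shows "integrable Q (\<lambda>y. (y - c)\<^sup>2)" "integrable Q (\<lambda>y. y)" "integrable Q (\<lambda>y. y\<^sup>2)"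
proof -
  interpret Q: prob_space Q by (rule Q)
  note [measurable_cong] = Q(2)
  show i2: "integrable Q (\<lambda>y. (y - c)\<^sup>2)"
  proof (rule integrableI_nonneg)
    show "(\<integral>\<^sup>+y. ennreal ((y - c)\<^sup>2) \<partial>Q) < \<infinity>" using m by (auto intro: le_less_trans)
  qed auto
  have i1: "integrable Q (\<lambda>y. y - c)"
    by (rule Q.square_integrable_imp_integrable[OF _ i2]) measurable
  from Bochner_Integration.integrable_add[OF this Q.integrable_const[of c]]
  show "integrable Q (\<lambda>y. y)" by simp
  have "integrable Q (\<lambda>y. (y - c)\<^sup>2 + 2 * c * (y - c) + c\<^sup>2)" using i1 i2 by simp
  then show "integrable Q (\<lambda>y. y\<^sup>2)" by (simp add: power2_eq_square algebra_simps)
qed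

lemma centered_law_of_moments:
  fixes K :: "nat \<Rightarrow> real"
  assumes Q: "prob_space Q" "sets Q = sets borel" and p: "p \<ge> 1" and K: "\<And>q. K q \<ge> 0"
    and m: "\<And>q. even q \<Longrightarrow> q > 0 \<Longrightarrow> (\<integral>\<^sup>+y. ennreal (\<bar>y - moment Q 1\<bar> ^ q) \<partial>Q) \<le> ennreal (K q)"
  shows "centered_law Q (moment Q 1) (moment Q 2 - (moment Q 1)\<^sup>2) (K (2 * p)) (4 ^ p * (K (4 * p) + K 2 ^ (2 * p))) p"
proof -
  interpret Q: prob_space Q by (rule Q)
  note [measurable_cong] = Q(2)
  define c where "c = moment Q 1"
  define v where "v = moment Q 2 - c\<^sup>2"
  note ints = second_moment_integrable[OF Q m[of 2, folded c_def]]
  have i2: "integrable Q (\<lambda>y. (y - c)\<^sup>2)" and i1: "integrable Q (\<lambda>y. y)" and i3: "integrable Q (\<lambda>y. y\<^sup>2)"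
    using ints by auto
  have c: "c = (\<integral>y. y \<partial>Q)" by (simp add: c_def moment_def)
  have var: "(\<integral>y. (y - c)\<^sup>2 \<partial>Q) = v"
  proof -
    have "(\<integral>y. (y - c)\<^sup>2 \<partial>Q) = (\<integral>y. y\<^sup>2 - 2 * c * y + c\<^sup>2 \<partial>Q)"
      by (rule Bochner_Integration.integral_cong) (simp_all add: power2_eq_square algebra_simps)
    also have "\<dots> = (\<integral>y. y\<^sup>2 \<partial>Q) - 2 * c * (\<integral>y. y \<partial>Q) + c\<^sup>2"
      using i1 i3 by (simp add: Q.prob_space)
    finally show ?thesis unfolding c[symmetric] by (simp add: v_def moment_def power2_eq_square)
  qed
  have v0: "v \<ge> 0" unfolding var[symmetric] by simp
  have vK: "v \<le> K 2"
  proof -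
    have "ennreal v = (\<integral>\<^sup>+y. ennreal ((y - c)\<^sup>2) \<partial>Q)"
      unfolding var[symmetric] by (rule nn_integral_eq_integral[symmetric, OF i2]) simp
    also have "\<dots> \<le> ennreal (K 2)" using m[of 2] by (simp add: c_def)
    finally show ?thesis using K by simp
  qed
  have ev: "\<bar>u\<bar> ^ (2 * q) = u ^ (2 * q)" "0 \<le> u ^ (2 * q)" for u :: real and q by (simp_all add: power_mult)
  have D': "(\<integral>\<^sup>+u. ennreal (((u - c)\<^sup>2 - v) ^ (2 * p)) \<partial>Q) \<le> ennreal (4 ^ p * (K (4 * p) + K 2 ^ (2 * p)))"
  proof -
    have "(\<integral>\<^sup>+u. ennreal (((u - c)\<^sup>2 - v) ^ (2 * p)) \<partial>Q) \<le> (\<integral>\<^sup>+u. ennreal (4 ^ p) * ennreal (\<bar>u - c\<bar> ^ (4 * p)) + ennreal (4 ^ p * K 2 ^ (2 * p)) \<partial>Q)"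
    proof (rule nn_integral_mono)
      fix u
      have "((u - c)\<^sup>2 - v) ^ (2 * p) \<le> 4 ^ p * (((u - c)\<^sup>2) ^ (2 * p) + (- v) ^ (2 * p))"
        using even_power_add_le[of "(u - c)\<^sup>2" "- v" p] by simp
      also have "(- v) ^ (2 * p) = v ^ (2 * p)" by (simp add: power_mult)
      also have "\<dots> \<le> K 2 ^ (2 * p)" using v0 vK by (intro power_mono)
      also have "((u - c)\<^sup>2) ^ (2 * p) = \<bar>u - c\<bar> ^ (4 * p)"
      proof -
        have "((u - c)\<^sup>2) ^ (2 * p) = (\<bar>u - c\<bar>\<^sup>2) ^ (2 * p)" by simp
        also have "\<dots> = \<bar>u - c\<bar> ^ (2 * (2 * p))" by (simp only: power_mult)
        also have "2 * (2 * p) = 4 * p" by simp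
        finally show ?thesis .
      qed
      finally have "((u - c)\<^sup>2 - v) ^ (2 * p) \<le> 4 ^ p * \<bar>u - c\<bar> ^ (4 * p) + 4 ^ p * K 2 ^ (2 * p)"
        by (simp add: distrib_left)
      then show "ennreal (((u - c)\<^sup>2 - v) ^ (2 * p)) \<le> ennreal (4 ^ p) * ennreal (\<bar>u - c\<bar> ^ (4 * p)) + ennreal (4 ^ p * K 2 ^ (2 * p))"
        using K by (simp add: ennreal_mult[symmetric] ennreal_plus[symmetric] ennreal_leI del: ennreal_plus)
    qed
    also have "\<dots> = ennreal (4 ^ p) * (\<integral>\<^sup>+u. ennreal (\<bar>u - c\<bar> ^ (4 * p)) \<partial>Q) + ennreal (4 ^ p * K 2 ^ (2 * p))"
      by (subst nn_integral_add) (auto simp: nn_integral_cmult Q.emeasure_space_1)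
    also have "\<dots> \<le> ennreal (4 ^ p) * ennreal (K (4 * p)) + ennreal (4 ^ p * K 2 ^ (2 * p))"
      using m[of "4 * p"] p by (intro add_right_mono mult_left_mono) (auto simp: c_def)
    also have "\<dots> = ennreal (4 ^ p * (K (4 * p) + K 2 ^ (2 * p)))"
      using K by (simp add: ennreal_mult[symmetric] ennreal_plus[symmetric] distrib_left del: ennreal_plus)
    finally show ?thesis .
  qed
  have D: "(\<integral>\<^sup>+u. ennreal ((u - c) ^ (2 * p)) \<partial>Q) \<le> ennreal (K (2 * p))"
    using m[of "2 * p"] p by (simp only: ev c_def) simp
  show ?thesis unfolding c_def[symmetric] v_def[symmetric]
    by unfold_locales (use Q p i1 i2 c var D D' K in \<open>auto simp: Q.prob_space\<close>)
qed

lemma descent_Im_pos: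
  fixes k N :: nat
  assumes "Im z > 0" "k \<le> N ^ 4" "N \<ge> 1"
  shows "Im (descent N z k) > 0"
proof (cases "Im z \<ge> 1")
  case False
  have "real k \<le> real N ^ 4" using assms(2) by (metis of_nat_le_iff of_nat_power)
  then have "real k * (1 - Im z) \<le> real N ^ 4 * (1 - Im z)" using False by (intro mult_right_mono) auto
  then have "real k * (1 - Im z) / real N ^ 4 \<le> 1 - Im z" using assms(3) by (simp add: divide_le_eq mult.commute)
  then show ?thesis using False assms(1) by (simp add: descent_def)
qed (use assms in \<open>simp add: descent_def\<close>)

text \<open>The factor \<open>N ^ 6\<close> counts the events of the union bound: about \<open>N ^ 4\<close> points of the descent, \<open>N\<close> rows and
\<open>N + 2\<close> events for each of them. Apart from \<open>L\<close> and \<open>p\<close>, the probability bound depends on the law only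
through its moment bounds.\<close>

lemma local_law_iid_entries:
  fixes \<tau> :: real
  assumes \<tau>: "0 < \<tau>" "\<tau> < 1"
  obtains C r0 N0 :: real where "C \<ge> 1" "r0 > 0"
    "\<And>N Q \<mu> v D D' p L z. real N \<ge> N0 \<Longrightarrow> N \<ge> 1 \<Longrightarrow> centered_law Q \<mu> v D D' p \<Longrightarrow>
     L \<ge> 1 \<Longrightarrow> \<bar>\<mu>\<bar> * sqrt N \<le> L \<Longrightarrow> \<bar>v - 1\<bar> * sqrt N \<le> 2 * L\<^sup>2 \<Longrightarrow>
     \<bar>Re z\<bar> \<le> 1 / \<tau> \<Longrightarrow> 1 / N \<le> Im z \<Longrightarrow> Im z \<le> 1 / \<tau> \<Longrightarrow> 9 * L\<^sup>2 / sqrt (N * Im z) \<le> r0 \<Longrightarrow>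
     emeasure (iid Q (upper_pairs N)) {x \<in> space (iid Q (upper_pairs N)).
        C * rate (9 * L\<^sup>2) N z < local_law_error N (entry_matrix N x) z}
     \<le> ennreal (12 * real N ^ 6 * (centered_law.tail_const D D' p / L ^ (2 * p)))"
proof (rule deterministic_local_law[OF \<tau>])
  fix C r0 N0 :: real assume C: "C \<ge> 1" and r0: "r0 > 0" and det:
    "\<And>N h R z. real N \<ge> N0 \<Longrightarrow> N \<ge> 1 \<Longrightarrow> symmetric_on N h \<Longrightarrow> R \<ge> 1 \<Longrightarrow>
     \<bar>Re z\<bar> \<le> 1 / \<tau> \<Longrightarrow> 1 / N \<le> Im z \<Longrightarrow> Im z \<le> 1 / \<tau> \<Longrightarrow> R / sqrt (N * Im z) \<le> r0 \<Longrightarrow>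
     (\<And>k i. k \<le> N ^ 4 \<Longrightarrow> i < N \<Longrightarrow> good_row N h (descent N z k) R i) \<Longrightarrow>
     semicircle_close N h z (C * rate R N z)"
  have main: "emeasure (iid Q (upper_pairs N)) {x \<in> space (iid Q (upper_pairs N)).
        C * rate (9 * L\<^sup>2) N z < local_law_error N (entry_matrix N x) z}
     \<le> ennreal (12 * real N ^ 6 * (centered_law.tail_const D D' p / L ^ (2 * p)))"
    if N: "real N \<ge> N0" "N \<ge> 1" and law: "centered_law Q \<mu> v D D' p"
      and L: "L \<ge> 1" "\<bar>\<mu>\<bar> * sqrt N \<le> L" "\<bar>v - 1\<bar> * sqrt N \<le> 2 * L\<^sup>2"
      and z: "\<bar>Re z\<bar> \<le> 1 / \<tau>" "1 / N \<le> Im z" "Im z \<le> 1 / \<tau>" and small: "9 * L\<^sup>2 / sqrt (N * Im z) \<le> r0"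
    for N Q \<mu> v D D' p L z
  proof -
    interpret centered_law Q \<mu> v D D' p by (rule law)
    have i0: "0 < 1 / real N" using N by simp
    then have z0: "Im z > 0" using z by linarith
    define Zs where "Zs = descent N z ` {..N ^ 4}"
    have Zs: "finite Zs" "\<And>w. w \<in> Zs \<Longrightarrow> Im w \<noteq> 0"
    proof -
      fix w assume "w \<in> Zs"
      then obtain k where "k \<le> N ^ 4" "w = descent N z k" by (auto simp: Zs_def)
      then show "Im w \<noteq> 0" using descent_Im_pos[OF z0 _ N(2), of k] by simp
    qed (simp add: Zs_def)
    let ?P = "iid Q (upper_pairs N)"
    obtain E where E: "E \<in> sets ?P" "emeasure ?P E \<le> ennreal (real (card Zs * N * (N + 2)) * (2 * tail_const / L ^ (2 * p)))"
      and good: "\<And>w \<zeta> i. w \<in> space ?P - E \<Longrightarrow> \<zeta> \<in> Zs \<Longrightarrow> i < N \<Longrightarrow> good_row N (entry_matrix N w) \<zeta> (9 * L\<^sup>2) i"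
      using good_rows_event[OF Zs L] by blast
    have "1 \<le> L\<^sup>2" using L(1) by (simp add: one_le_power)
    then have R: "9 * L\<^sup>2 \<ge> 1" by linarith
    have "emeasure ?P {x \<in> space ?P. C * rate (9 * L\<^sup>2) N z < local_law_error N (entry_matrix N x) z} \<le> emeasure ?P E"
    proof (rule emeasure_mono[OF _ E(1)], rule subsetI, rule ccontr)
      fix x assume x: "x \<in> {x \<in> space ?P. C * rate (9 * L\<^sup>2) N z < local_law_error N (entry_matrix N x) z}" and "x \<notin> E"
      then have "x \<in> space ?P - E" by simp
      note gd = good[OF this]
      have "semicircle_close N (entry_matrix N x) z (C * rate (9 * L\<^sup>2) N z)"
        by (rule det[OF N entry_matrix_sym R z small]) (rule gd, auto simp: Zs_def)
      then have "local_law_error N (entry_matrix N x) z \<le> C * rate (9 * L\<^sup>2) N z"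
        using z0 by (intro local_law_error_le[OF entry_matrix_sym _ N(2)]) auto
      then show False using x by simp
    qed
    also have "\<dots> \<le> ennreal (12 * real N ^ 6 * (tail_const / L ^ (2 * p)))"
    proof (rule order_trans[OF E(2)], rule ennreal_leI)
      have "card Zs \<le> card {..N ^ 4}" unfolding Zs_def by (rule card_image_le) simp
      also have "\<dots> \<le> 2 * N ^ 4" using N by simp
      finally have "card Zs * N * (N + 2) \<le> 2 * N ^ 4 * N * (3 * N)" using N by (intro mult_mono) auto
      also have "\<dots> = 6 * N ^ 6" by (simp add: numeral_eq_Suc algebra_simps)
      finally have "real (card Zs * N * (N + 2)) \<le> real (6 * N ^ 6)" by (simp only: of_nat_le_iff)
      then have "real (card Zs * N * (N + 2)) * (2 * tail_const / L ^ (2 * p)) \<le> real (6 * N ^ 6) * (2 * tail_const / L ^ (2 * p))"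
        using tail_const_nonneg L by (intro mult_right_mono) auto
      then show "real (card Zs * N * (N + 2)) * (2 * tail_const / L ^ (2 * p)) \<le> 12 * real N ^ 6 * (tail_const / L ^ (2 * p))"
        by simp
    qed
    finally show ?thesis .
  qed
  show thesis by (rule that[OF C r0 main])
qed

text \<open>The preimages of open sets are the sets that generate the weak topology.\<close>

lemma bounded_continuous_integral_measurable:
  fixes f :: "real \<Rightarrow> real"
  assumes f: "continuous_on UNIV f" "bounded (range f)"
  shows "(\<lambda>Q. \<integral>x. f x \<partial>Q) \<in> borel_measurable weak_borel"
proof (rule borel_measurableI)
  fix U :: "real set" assume U: "open U"
  have "{Q \<in> space (prob_algebra borel). (\<integral>x. f x \<partial>Q) \<in> U} \<in> {{Q \<in> space (prob_algebra borel). (\<integral>x. f x \<partial>Q) \<in> U} | f U.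
        continuous_on UNIV f \<and> bounded (range f) \<and> open (U :: real set)}" using f U by auto
  then have "openin weak_topology {Q \<in> space (prob_algebra borel). (\<integral>x. f x \<partial>Q) \<in> U}"
    unfolding weak_topology_def by (rule topology_generated_by_Basis)
  moreover have "(\<lambda>Q. \<integral>x. f x \<partial>Q) -` U \<inter> space weak_borel = {Q \<in> space (prob_algebra borel). (\<integral>x. f x \<partial>Q) \<in> U}"
    by (auto simp: space_weak_borel)
  moreover have "{U. openin weak_topology U} \<subseteq> Pow (topspace weak_topology)" by (auto dest: openin_subset)
  ultimately show "(\<lambda>Q. \<integral>x. f x \<partial>Q) -` U \<inter> space weak_borel \<in> sets weak_borel"
    unfolding weak_borel_def by (simp add: sets_measure_of sigma_sets.Basic)
qed

text \<open>A truncated power is bounded and continuous, and its integrals converge to the moment by dominated convergence.\<close>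

lemma moment_measurable:
  assumes P: "P \<in> measurable T weak_borel" and int: "\<And>t. t \<in> space T \<Longrightarrow> integrable (P t) (\<lambda>x. x ^ l)"
  shows "(\<lambda>t. moment (P t) l) \<in> borel_measurable T"
proof (rule borel_measurable_LIMSEQ_real)
  define f where "f n x = max (- real n) (min (real n) (x ^ l))" for n x
  show "(\<lambda>t. \<integral>x. f n x \<partial>P t) \<in> borel_measurable T" for n
  proof (rule measurable_compose[OF P bounded_continuous_integral_measurable])
    show "continuous_on UNIV (f n)" unfolding f_def by (intro continuous_intros)
    show "bounded (range (f n))" unfolding bounded_iff f_def by (intro exI[of _ "real n"]) auto
  qed
  fix t assume t: "t \<in> space T"
  have "P t \<in> space (prob_algebra borel)" using measurable_space[OF P t] by (simp add: space_weak_borel)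
  then have s: "sets (P t) = sets borel" by (simp add: space_prob_algebra)
  note [measurable_cong] = s
  show "(\<lambda>n. \<integral>x. f n x \<partial>P t) \<longlonglongrightarrow> moment (P t) l"
    unfolding moment_def
  proof (rule integral_dominated_convergence[where w = "\<lambda>x. \<bar>x ^ l\<bar>"])
    show "integrable (P t) (\<lambda>x. \<bar>x ^ l\<bar>)" using int[OF t] by (rule integrable_abs)
    show "AE x in P t. (\<lambda>n. f n x) \<longlonglongrightarrow> x ^ l"
    proof (rule AE_I2)
      fix x
      obtain n0 where n0: "\<bar>x ^ l\<bar> \<le> real n0" using real_arch_simple by blast
      have "f n x = x ^ l" if "n \<ge> n0" for n using n0 that by (auto simp: f_def)
      then show "(\<lambda>n. f n x) \<longlonglongrightarrow> x ^ l" by (intro tendsto_eventually) (auto simp: eventually_sequentially)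
    qed
    show "AE x in P t. norm (f n x) \<le> \<bar>x ^ l\<bar>" for n by (rule AE_I2) (auto simp: f_def)
  qed (auto simp: f_def)
qed

section \<open>Mixtures\<close>

lemma powr_power_nat:
  fixes x e :: real
  assumes "x > 0"
  shows "(x powr e) ^ n = x powr (e * real n)"
proof -
  have "(x powr e) powr real n = (x powr e) ^ n" by (rule powr_realpow) (use assms in simp)
  then show ?thesis unfolding powr_powr by simp
qed

lemma (in prob_space) moment_deviation:
  fixes F :: "'a \<Rightarrow> real"
  assumes [measurable]: "F \<in> borel_measurable M" and x: "x > 0"
    and m: "(\<integral>\<^sup>+\<omega>. ennreal (\<bar>F \<omega>\<bar> ^ (2 * q)) \<partial>M) \<le> ennreal (K * x powr (- real (2 * q) / 2))"
  shows "emeasure M {\<omega> \<in> space M. x powr (e - 1 / 2) < \<bar>F \<omega>\<bar>} \<le> ennreal (K * x powr (- (2 * real q * e)))"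
proof -
  have ev: "\<bar>u\<bar> ^ (2 * q) = u ^ (2 * q)" for u :: real by (simp add: power_mult)
  have "emeasure M {\<omega> \<in> space M. x powr (e - 1 / 2) < \<bar>F \<omega>\<bar>} \<le> ennreal (K * x powr (- real (2 * q) / 2) / (x powr (e - 1 / 2)) ^ (2 * q))"
    by (rule even_moment_tail) (use m x in \<open>auto simp: ev\<close>)
  also have "K * x powr (- real (2 * q) / 2) / (x powr (e - 1 / 2)) ^ (2 * q) = K * x powr (- (2 * real q * e))"
  proof -
    have "(x powr (e - 1 / 2)) ^ (2 * q) = x powr ((e - 1 / 2) * real (2 * q))"
      by (rule powr_power_nat[OF x])
    then have "x powr (- real (2 * q) / 2) / (x powr (e - 1 / 2)) ^ (2 * q) = x powr (- real (2 * q) / 2 - (e - 1 / 2) * real (2 * q))"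
      by (simp add: powr_diff)
    also have "- real (2 * q) / 2 - (e - 1 / 2) * real (2 * q) = - (2 * real q * e)" by (simp add: algebra_simps)
    finally show ?thesis by (simp add: times_divide_eq_right[symmetric] del: times_divide_eq_right)
  qed
  finally show ?thesis .
qed

lemma powr_ge_of_base:
  fixes x c a :: real
  assumes "a > 0" "c \<ge> 0" "x \<ge> c powr (1 / a)"
  shows "x powr a \<ge> c"
proof -
  have "(c powr (1 / a)) powr a \<le> x powr a" using assms by (intro powr_mono2) auto
  then show ?thesis using assms by (simp add: powr_powr)
qed

lemma spectral_domain_scale:
  assumes \<tau>: "0 < \<tau>" "\<tau> < 1" and N: "N \<ge> 1" and z: "z \<in> spectral_domain \<tau> N"
  shows "\<bar>Re z\<bar> \<le> 1 / \<tau>" "1 / real N \<le> Im z" "Im z \<le> 1 / \<tau>" "real N powr \<tau> \<le> real N * Im z"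
proof -
  have i: "1 / real N powr (1 - \<tau>) \<le> Im z" using z by (simp add: spectral_domain_def)
  show "\<bar>Re z\<bar> \<le> 1 / \<tau>" "Im z \<le> 1 / \<tau>" using z by (auto simp: spectral_domain_def abs_le_iff)
  have "real N powr (1 - \<tau>) \<le> real N powr 1" using N \<tau> by (intro powr_mono) auto
  then have "1 / real N \<le> 1 / real N powr (1 - \<tau>)" using N by (intro divide_left_mono) auto
  then show "1 / real N \<le> Im z" using i by linarith
  have "real N powr \<tau> = real N * (1 / real N powr (1 - \<tau>))" using N by (simp add: powr_diff)
  also have "\<dots> \<le> real N * Im z" using i by (intro mult_left_mono) auto
  finally show "real N powr \<tau> \<le> real N * Im z" .
qed

lemma curie_weiss_moment_bounds:
  assumes "curie_weiss_type M T P H"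
  obtains K :: "nat \<Rightarrow> real" where "\<And>q. K q \<ge> 0"
    "\<And>q N. even q \<Longrightarrow> q > 0 \<Longrightarrow> N \<ge> 1 \<Longrightarrow> (\<integral>\<^sup>+ t. ennreal (\<bar>moment (P N t) 1\<bar> ^ q) \<partial>T N) \<le> ennreal (K q * real N powr (- real q / 2))"
    "\<And>q N. even q \<Longrightarrow> q > 0 \<Longrightarrow> N \<ge> 1 \<Longrightarrow> (\<integral>\<^sup>+ t. ennreal (\<bar>1 - moment (P N t) 2\<bar> ^ q) \<partial>T N) \<le> ennreal (K q * real N powr (- real q / 2))"
    "\<And>q N t. even q \<Longrightarrow> q > 0 \<Longrightarrow> N \<ge> 1 \<Longrightarrow> t \<in> space (T N) \<Longrightarrow> (\<integral>\<^sup>+ y. ennreal (\<bar>y - moment (P N t) 1\<bar> ^ q) \<partial>P N t) \<le> ennreal (K q)"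
proof -
  define B where "B q K \<longleftrightarrow> (\<forall>N\<ge>1.
        (\<integral>\<^sup>+ t. ennreal (\<bar>moment (P N t) 1\<bar> ^ q) \<partial>T N) \<le> ennreal (K * real N powr (- real q / 2)) \<and>
        (\<integral>\<^sup>+ t. ennreal (\<bar>1 - moment (P N t) 2\<bar> ^ q) \<partial>T N) \<le> ennreal (K * real N powr (- real q / 2)) \<and>
        (SUP t\<in>space (T N). \<integral>\<^sup>+ y. ennreal (\<bar>y - moment (P N t) 1\<bar> ^ q) \<partial>P N t) \<le> ennreal K)"
    for q :: nat and K :: real
  have "\<forall>q. \<exists>K. K \<ge> 0 \<and> (even q \<and> q > 0 \<longrightarrow> B q K)"
  proof
    fix q :: nat
    show "\<exists>K. K \<ge> 0 \<and> (even q \<and> q > 0 \<longrightarrow> B q K)"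
    proof (cases "even q \<and> q > 0")
      case True
      from assms[unfolded curie_weiss_type_def, THEN conjunct2, THEN conjunct2, THEN spec, of q, THEN mp, OF True]
      show ?thesis by (rule ex_forward) (simp add: B_def)
    qed (auto intro: exI[of _ 0])
  qed
  from choice[OF this] obtain K where K0: "\<And>q. K q \<ge> 0" and KB: "\<And>q. even q \<Longrightarrow> q > 0 \<Longrightarrow> B q (K q)" by auto
  note K = K0 KB[unfolded B_def]
  show thesis
  proof (rule that[of K])
    fix q N :: nat and t assume q: "even q" "q > 0" and N: "N \<ge> 1" and t: "t \<in> space (T N)"
    have "(SUP t\<in>space (T N). \<integral>\<^sup>+ y. ennreal (\<bar>y - moment (P N t) 1\<bar> ^ q) \<partial>P N t) \<le> ennreal (K q)"
      using K(2)[OF q, THEN spec, THEN mp, OF N] by simp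
    then show "(\<integral>\<^sup>+ y. ennreal (\<bar>y - moment (P N t) 1\<bar> ^ q) \<partial>P N t) \<le> ennreal (K q)"
      by (rule order_trans[OF SUP_upper[OF t]])
  next
    fix q N :: nat assume q: "even q" "q > 0" and N: "N \<ge> 1"
    show "(\<integral>\<^sup>+ t. ennreal (\<bar>moment (P N t) 1\<bar> ^ q) \<partial>T N) \<le> ennreal (K q * real N powr (- real q / 2))"
      "(\<integral>\<^sup>+ t. ennreal (\<bar>1 - moment (P N t) 2\<bar> ^ q) \<partial>T N) \<le> ennreal (K q * real N powr (- real q / 2))"
      using K(2)[OF q, THEN spec, THEN mp, OF N] by simp_all
  qed (rule K(1))
qed

text \<open>\<open>G\<close> is the set of well-behaved mixing parameters; outside of it the conditional probability is only bounded
by one.\<close>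

lemma de_finetti_tail:
  assumes df: "de_finetti_type M I X T P" and B: "B \<in> sets (iid borel I)"
    and G: "G \<in> sets T" "emeasure T (space T - G) \<le> c"
    and b: "\<And>t. t \<in> G \<Longrightarrow> emeasure (iid (P t) I) B \<le> d"
  shows "emeasure M {\<omega> \<in> space M. (\<lambda>i\<in>I. X i \<omega>) \<in> B} \<le> c + d"
proof -
  interpret T: prob_space T using df by (simp add: de_finetti_type_def)
  have law: "P t \<in> space (prob_algebra borel)" if "t \<in> space T" for t
  proof -
    have "P \<in> measurable T weak_borel" using df by (simp add: de_finetti_type_def)
    from measurable_space[OF this that] show ?thesis by (simp add: space_weak_borel)
  qed
  have "emeasure M {\<omega> \<in> space M. (\<lambda>i\<in>I. X i \<omega>) \<in> B} = (\<integral>\<^sup>+ t. emeasure (iid (P t) I) B \<partial>T)"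
    using df B by (simp add: de_finetti_type_def)
  also have "\<dots> \<le> (\<integral>\<^sup>+ t. indicator (space T - G) t + d \<partial>T)"
  proof (rule nn_integral_mono)
    fix t assume t: "t \<in> space T"
    show "emeasure (iid (P t) I) B \<le> indicator (space T - G) t + d"
    proof (cases "t \<in> G")
      case True
      then show ?thesis using b by simp
    next
      case False
      have "prob_space (iid (P t) I)"
        by (rule prob_space_PiM) (use law[OF t] in \<open>simp add: space_prob_algebra\<close>)
      then have "emeasure (iid (P t) I) B \<le> 1" by (rule prob_space.emeasure_le_1)
      then show ?thesis using False t by (simp add: add_increasing2)
    qed
  qed
  also have "\<dots> = emeasure T (space T - G) + d"
    using G by (subst nn_integral_add) (auto simp: T.emeasure_space_1)
  finally show ?thesis using G(2) by (meson add_right_mono order_trans)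
qed

lemma powr_div_le:
  fixes x e D :: real
  assumes x: "x \<ge> 1" and p: "6 + D \<le> e * real (2 * p)"
  shows "x ^ 6 / (x powr e) ^ (2 * p) \<le> x powr (- D)"
proof -
  have "x ^ 6 / (x powr e) ^ (2 * p) = x powr (6 - e * real (2 * p))"
  proof -
    have "x ^ 6 = x powr 6" using x powr_realpow[of x 6] by simp
    then show ?thesis using x powr_power_nat[of x e "2 * p"] by (simp only: powr_diff)
  qed
  also have "\<dots> \<le> x powr (- D)" using x p by (intro powr_mono) auto
  finally show ?thesis .
qed

lemma curie_weiss_entry_matrix:
  assumes cw: "curie_weiss_type M T P H" and N: "N \<ge> 1"
  shows "\<exists>X. de_finetti_type M (upper_pairs N) X (T N) (P N) \<and>
    (\<forall>\<omega>\<in>space M. H N \<omega> = mat N N (\<lambda>(i, j). entry_matrix N (\<lambda>q\<in>upper_pairs N. X q \<omega>) i j))"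
proof -
  from cw[unfolded curie_weiss_type_def, THEN conjunct2, THEN conjunct1, THEN spec, of N, THEN mp, OF N]
  obtain X where X: "de_finetti_type M {(i, j). i \<le> j \<and> j < N} X (T N) (P N)"
    "\<And>\<omega> i j. \<omega> \<in> space M \<Longrightarrow> i \<le> j \<Longrightarrow> j < N \<Longrightarrow> H N \<omega> $$ (i, j) = 1 / sqrt (real N) * X (i, j) \<omega>"
    by auto
  show ?thesis
  proof (intro exI conjI ballI)
    show "de_finetti_type M (upper_pairs N) X (T N) (P N)" using X(1) by (simp add: upper_pairs_def)
    fix \<omega> assume \<omega>: "\<omega> \<in> space M"
    have H: "H N \<omega> \<in> carrier_mat N N" "transpose_mat (H N \<omega>) = H N \<omega>"
      using cw N \<omega> unfolding curie_weiss_type_def by auto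
    show "H N \<omega> = mat N N (\<lambda>(i, j). entry_matrix N (\<lambda>q\<in>upper_pairs N. X q \<omega>) i j)"
    proof (rule eq_matI)
      fix i j assume "i < dim_row (mat N N (\<lambda>(i, j). entry_matrix N (\<lambda>q\<in>upper_pairs N. X q \<omega>) i j))"
        "j < dim_col (mat N N (\<lambda>(i, j). entry_matrix N (\<lambda>q\<in>upper_pairs N. X q \<omega>) i j))"
      then have ij: "i < N" "j < N" by auto
      have "H N \<omega> $$ (i, j) = H N \<omega> $$ (min i j, max i j)"
      proof (cases "i \<le> j")
        case False
        have "H N \<omega> $$ (i, j) = transpose_mat (H N \<omega>) $$ (j, i)" using H(1) ij by simp
        then show ?thesis using H(2) False by (simp add: min_def max_def)
      qed (simp add: min_def max_def)
      also have "\<dots> = 1 / sqrt (real N) * X (entry_index i j) \<omega>"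
        unfolding entry_index_def by (rule X(2)[OF \<omega>]) (use ij in auto)
      finally show "H N \<omega> $$ (i, j) = mat N N (\<lambda>(i, j). entry_matrix N (\<lambda>q\<in>upper_pairs N. X q \<omega>) i j) $$ (i, j)"
        using ij entry_index_in_upper_pairs[OF ij] by (simp add: entry_matrix_def)
    qed (use H in auto)
  qed
qed

lemma curie_weiss_error_measurable:
  assumes cw: "curie_weiss_type M T P H" and N: "N \<ge> 1" and z: "Im z \<noteq> 0"
  shows "(\<lambda>\<omega>. law_error (H N \<omega>) z) \<in> borel_measurable M"
proof -
  obtain X where X: "de_finetti_type M (upper_pairs N) X (T N) (P N)"
    "\<And>\<omega>. \<omega> \<in> space M \<Longrightarrow> H N \<omega> = mat N N (\<lambda>(i, j). entry_matrix N (\<lambda>q\<in>upper_pairs N. X q \<omega>) i j)"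
    using curie_weiss_entry_matrix[OF cw N] by auto
  have "(\<lambda>\<omega>. local_law_error N (entry_matrix N (\<lambda>q\<in>upper_pairs N. X q \<omega>)) z) \<in> borel_measurable M"
  proof (rule local_law_error_measurable[OF _ entry_matrix_sym z])
    fix i j assume "i < N" "j < N"
    then have q: "entry_index i j \<in> upper_pairs N" by (rule entry_index_in_upper_pairs)
    then have [measurable]: "X (entry_index i j) \<in> borel_measurable M" using X(1) by (simp add: de_finetti_type_def)
    show "(\<lambda>\<omega>. entry_matrix N (\<lambda>q\<in>upper_pairs N. X q \<omega>) i j) \<in> borel_measurable M"
      using q unfolding entry_matrix_def by simp
  qed
  then show ?thesis by (subst measurable_cong[OF arg_cong2[OF X(2) refl, of _ law_error z]]) auto
qed

text \<open>The set of parameters \<open>t\<close> for which mean or second moment of \<open>P N t\<close> deviates by more than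
\<open>N powr (e - 1 / 2)\<close> has small measure by Markov's inequality. For the other \<open>t\<close> the entries are independent
with a law to which \<open>local_law_iid_entries\<close> applies with \<open>L = N powr e\<close>.\<close>

lemma curie_weiss_tail:
  fixes \<tau> \<epsilon> \<Delta> :: real
  assumes \<tau>: "0 < \<tau>" "\<tau> < 1" and cw: "curie_weiss_type M T P H" and pos: "\<epsilon> > 0" "\<Delta> > 0"
  shows "\<exists>C\<ge>0. \<forall>N\<ge>1. \<forall>z\<in>spectral_domain \<tau> N.
    emeasure M {\<omega> \<in> space M. real N powr \<epsilon> * rate 1 N z < law_error (H N \<omega>) z}
      \<le> ennreal (C * real N powr (- \<Delta>))"
proof (rule curie_weiss_moment_bounds[OF cw])
  fix K :: "nat \<Rightarrow> real" assume K: "\<And>q. K q \<ge> 0"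
    and K1: "\<And>q N. even q \<Longrightarrow> q > 0 \<Longrightarrow> N \<ge> 1 \<Longrightarrow> (\<integral>\<^sup>+ t. ennreal (\<bar>moment (P N t) 1\<bar> ^ q) \<partial>T N) \<le> ennreal (K q * real N powr (- real q / 2))"
    and K2: "\<And>q N. even q \<Longrightarrow> q > 0 \<Longrightarrow> N \<ge> 1 \<Longrightarrow> (\<integral>\<^sup>+ t. ennreal (\<bar>1 - moment (P N t) 2\<bar> ^ q) \<partial>T N) \<le> ennreal (K q * real N powr (- real q / 2))"
    and K3: "\<And>q N t. even q \<Longrightarrow> q > 0 \<Longrightarrow> N \<ge> 1 \<Longrightarrow> t \<in> space (T N) \<Longrightarrow> (\<integral>\<^sup>+ y. ennreal (\<bar>y - moment (P N t) 1\<bar> ^ q) \<partial>P N t) \<le> ennreal (K q)"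
  show ?thesis
  proof (rule local_law_iid_entries[OF \<tau>])
    fix C r0 N0 :: real
    assume C: "C \<ge> 1" and r0: "r0 > 0" and iid:
      "\<And>N Q \<mu> v D D' p L z. real N \<ge> N0 \<Longrightarrow> N \<ge> 1 \<Longrightarrow> centered_law Q \<mu> v D D' p \<Longrightarrow>
       L \<ge> 1 \<Longrightarrow> \<bar>\<mu>\<bar> * sqrt N \<le> L \<Longrightarrow> \<bar>v - 1\<bar> * sqrt N \<le> 2 * L\<^sup>2 \<Longrightarrow>
       \<bar>Re z\<bar> \<le> 1 / \<tau> \<Longrightarrow> 1 / N \<le> Im z \<Longrightarrow> Im z \<le> 1 / \<tau> \<Longrightarrow> 9 * L\<^sup>2 / sqrt (N * Im z) \<le> r0 \<Longrightarrow>
       emeasure (iid Q (upper_pairs N)) {x \<in> space (iid Q (upper_pairs N)).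
          C * rate (9 * L\<^sup>2) N z < local_law_error N (entry_matrix N x) z}
       \<le> ennreal (12 * real N ^ 6 * (centered_law.tail_const D D' p / L ^ (2 * p)))"
    \<comment> \<open>small enough for \<open>9 C L\<^sup>2 \<le> N powr \<epsilon>\<close> and for \<open>9 L\<^sup>2 / sqrt (N Im z) \<le> r0\<close> when \<open>N\<close> is large\<close>
    define e where "e = min (\<epsilon> / 4) (\<tau> / 8)"
    have e: "e > 0" "e \<le> \<epsilon> / 4" "e \<le> \<tau> / 8" using pos \<tau> by (auto simp: e_def)
    \<comment> \<open>\<open>L ^ (2 p)\<close> beats \<open>N ^ 6\<close> by the factor \<open>N powr \<Delta>\<close>, and \<open>2 q\<close> moments in \<open>t\<close> do the same for the exceptional parameters\<close>
    define p where "p = nat \<lceil>(6 + \<Delta>) / (2 * e)\<rceil>"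
    define q where "q = nat \<lceil>\<Delta> / (2 * e)\<rceil>"
    have "(6 + \<Delta>) / (2 * e) > 0" "\<Delta> / (2 * e) > 0" using pos e by auto
    then have p1: "p \<ge> 1" and q1: "q \<ge> 1" and "(6 + \<Delta>) / (2 * e) \<le> p" "\<Delta> / (2 * e) \<le> q"
      unfolding p_def q_def by linarith+
    then have pe: "6 + \<Delta> \<le> e * real (2 * p)" and qe: "\<Delta> \<le> 2 * real q * e"
      using e by (simp_all add: divide_le_eq mult_ac)
    define tc where "tc = centered_law.tail_const (K (2 * p)) (4 ^ p * (K (4 * p) + K 2 ^ (2 * p))) p"
    define N1 where "N1 = max 1 (max N0 (max ((9 * C) powr (1 / (\<epsilon> - 2 * e))) ((9 / r0) powr (1 / (\<tau> / 2 - 2 * e)))))"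
    \<comment> \<open>the last summand makes the bound trivial for \<open>N < N1\<close>\<close>
    define C' where "C' = 2 * K (2 * q) + 12 * \<bar>tc\<bar> + N1 powr \<Delta>"
    have C'0: "C' \<ge> 0" using K by (simp add: C'_def)
    have "emeasure M {\<omega> \<in> space M. real N powr \<epsilon> * rate 1 N z < law_error (H N \<omega>) z}
      \<le> ennreal (C' * real N powr (- \<Delta>))" (is "emeasure M ?A \<le> _") if N: "N \<ge> 1" and z: "z \<in> spectral_domain \<tau> N" for N z
    proof -
      obtain X where X: "de_finetti_type M (upper_pairs N) X (T N) (P N)"
        "\<And>\<omega>. \<omega> \<in> space M \<Longrightarrow> H N \<omega> = mat N N (\<lambda>(i, j). entry_matrix N (\<lambda>q\<in>upper_pairs N. X q \<omega>) i j)"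
        using curie_weiss_entry_matrix[OF cw N] by auto
      have M: "prob_space M" and TN: "prob_space (T N)" and PN: "P N \<in> measurable (T N) weak_borel"
        using X(1) by (auto simp: de_finetti_type_def)
      have Nr: "real N \<ge> 1" using N by simp
      note zs = spectral_domain_scale[OF \<tau> N z]
      have "0 < 1 / real N" using N by simp
      then have z0: "Im z > 0" using zs(2) by linarith
      show ?thesis
      proof (cases "real N \<ge> N1")
        case False
        have "N1 powr (- \<Delta>) \<le> real N powr (- \<Delta>)" using False N pos by (intro powr_mono2') auto
        then have "N1 powr \<Delta> * N1 powr (- \<Delta>) \<le> C' * real N powr (- \<Delta>)"
          using K C'0 by (intro mult_mono) (auto simp: C'_def)
        moreover have "N1 powr \<Delta> * N1 powr (- \<Delta>) = 1" by (simp add: N1_def powr_add[symmetric])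
        ultimately have "ennreal 1 \<le> ennreal (C' * real N powr (- \<Delta>))" by (intro ennreal_leI) simp
        then show ?thesis using order_trans[OF prob_space.emeasure_le_1[OF M, of ?A]] by (simp only: ennreal_1)
      next
        case True
        define L where "L = real N powr e"
        have L1: "L \<ge> 1" using Nr e by (simp add: L_def ge_one_powr_ge_zero)
        have L2: "L\<^sup>2 = real N powr (2 * e)" using N by (simp add: L_def power2_eq_square powr_add[symmetric])
        have sqN: "sqrt (real N) = real N powr (1 / 2)" using N by (simp add: powr_half_sqrt)
        have small: "9 * L\<^sup>2 / sqrt (N * Im z) \<le> r0"
        proof -
          have "9 / r0 \<le> real N powr (\<tau> / 2 - 2 * e)"
            by (rule powr_ge_of_base) (use True e \<tau> r0 in \<open>auto simp: N1_def\<close>)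
          then have "9 * L\<^sup>2 \<le> r0 * (real N powr (\<tau> / 2 - 2 * e) * L\<^sup>2)"
            using r0 L1 mult_right_mono[of "9 / r0" "real N powr (\<tau> / 2 - 2 * e)" "r0 * L\<^sup>2"] by (simp add: mult_ac)
          also have "real N powr (\<tau> / 2 - 2 * e) * L\<^sup>2 = sqrt (real N powr \<tau>)"
            unfolding L2 using N by (simp add: powr_add[symmetric] powr_half_sqrt[symmetric] powr_powr)
          also have "r0 * \<dots> \<le> r0 * sqrt (N * Im z)" using zs(4) r0 by (intro mult_left_mono) auto
          finally show ?thesis using z0 N by (simp add: divide_le_eq)
        qed
        define b where "b = rate 1 N z"
        have b0: "b \<ge> 0" using z0 by (auto simp: b_def edge_scale_def intro!: divide_nonneg_nonneg)
        have bnd: "C * rate (9 * L\<^sup>2) N z \<le> real N powr \<epsilon> * b"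
        proof -
          have "9 * C \<le> real N powr (\<epsilon> - 2 * e)"
            by (rule powr_ge_of_base) (use True e pos C in \<open>auto simp: N1_def\<close>)
          then have "9 * C * L\<^sup>2 \<le> real N powr (\<epsilon> - 2 * e) * L\<^sup>2" by (intro mult_right_mono) auto
          also have "\<dots> = real N powr \<epsilon>" unfolding L2 using N by (simp add: powr_add[symmetric])
          finally have "9 * C * L\<^sup>2 * b \<le> real N powr \<epsilon> * b" using b0 by (intro mult_right_mono)
          then show ?thesis by (simp add: b_def mult_ac)
        qed
        define I where "I = upper_pairs N"
        define B where "B = {x \<in> space (iid (borel :: real measure) I). real N powr \<epsilon> * b < local_law_error N (entry_matrix N x) z}"
        have [measurable]: "(\<lambda>x. local_law_error N (entry_matrix N x) z) \<in> borel_measurable (iid borel I)"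
        proof (rule local_law_error_measurable[OF _ entry_matrix_sym])
          fix i j assume "i < N" "j < N"
          then have "(\<lambda>x. x (entry_index i j)) \<in> borel_measurable (iid (borel :: real measure) I)"
            unfolding I_def by (intro measurable_component_singleton entry_index_in_upper_pairs)
          then show "(\<lambda>x. entry_matrix N x i j) \<in> borel_measurable (iid borel I)"
            unfolding entry_matrix_def by measurable
        qed (use z0 in simp)
        have B: "B \<in> sets (iid borel I)" unfolding B_def by measurable
        have law: "prob_space (P N t)" "sets (P N t) = sets borel" if "t \<in> space (T N)" for t
          using measurable_space[OF PN that] by (auto simp: space_weak_borel space_prob_algebra)
        have int: "integrable (P N t) (\<lambda>x. x ^ l)" if "t \<in> space (T N)" "l \<in> {1, 2}" for t l
          using second_moment_integrable[OF law[OF that(1)] K3[of 2 N t]] that N by auto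
        have [measurable]: "(\<lambda>t. moment (P N t) 1) \<in> borel_measurable (T N)" "(\<lambda>t. moment (P N t) 2) \<in> borel_measurable (T N)"
          using int by (auto intro: moment_measurable[OF PN])
        define G1 where "G1 = {t \<in> space (T N). real N powr (e - 1 / 2) < \<bar>moment (P N t) 1\<bar>}"
        define G2 where "G2 = {t \<in> space (T N). real N powr (e - 1 / 2) < \<bar>1 - moment (P N t) 2\<bar>}"
        have G12[measurable]: "G1 \<in> sets (T N)" "G2 \<in> sets (T N)" unfolding G1_def G2_def by measurable
        define G where "G = space (T N) - (G1 \<union> G2)"
        have Gs: "G \<in> sets (T N)" unfolding G_def by measurable
        have KN: "ennreal (K (2 * q) * real N powr (- (2 * real q * e))) \<le> ennreal (K (2 * q) * real N powr (- \<Delta>))"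
          using K qe Nr by (intro ennreal_leI mult_left_mono powr_mono) auto
        have Gc: "emeasure (T N) (space (T N) - G) \<le> ennreal (2 * K (2 * q) * real N powr (- \<Delta>))"
        proof -
          have "space (T N) - G = G1 \<union> G2" using sets.sets_into_space[OF G12(1)] sets.sets_into_space[OF G12(2)] by (auto simp: G_def)
          then have "emeasure (T N) (space (T N) - G) \<le> emeasure (T N) G1 + emeasure (T N) G2"
            using emeasure_subadditive[OF G12] by simp
          also have "\<dots> \<le> ennreal (K (2 * q) * real N powr (- \<Delta>)) + ennreal (K (2 * q) * real N powr (- \<Delta>))"
          proof (rule add_mono)
            have q2: "even (2 * q)" "2 * q > 0" using q1 by auto
            have N0': "real N > 0" using N by simp
            show "emeasure (T N) G1 \<le> ennreal (K (2 * q) * real N powr (- \<Delta>))"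
              unfolding G1_def by (rule order_trans[OF prob_space.moment_deviation[OF TN _ N0' K1[OF q2 N]] KN]) measurable
            show "emeasure (T N) G2 \<le> ennreal (K (2 * q) * real N powr (- \<Delta>))"
              unfolding G2_def by (rule order_trans[OF prob_space.moment_deviation[OF TN _ N0' K2[OF q2 N]] KN]) measurable
          qed
          finally show ?thesis using K by (simp add: ennreal_plus[symmetric] mult_ac del: ennreal_plus)
        qed
        have Gb: "emeasure (iid (P N t) I) B \<le> ennreal (12 * \<bar>tc\<bar> * real N powr (- \<Delta>))" if t: "t \<in> G" for t
        proof -
          have tT: "t \<in> space (T N)" using t by (simp add: G_def)
          define \<mu> where "\<mu> = moment (P N t) 1"
          define m2 where "m2 = moment (P N t) 2"
          have cl: "centered_law (P N t) \<mu> (m2 - \<mu>\<^sup>2) (K (2 * p)) (4 ^ p * (K (4 * p) + K 2 ^ (2 * p))) p"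
            unfolding \<mu>_def m2_def by (rule centered_law_of_moments[where K = K, OF law[OF tT] p1 K K3]) (use N tT in auto)
          have "real N powr (e - 1 / 2) * sqrt N = L" using N by (simp add: sqN L_def powr_add[symmetric])
          moreover have "\<bar>\<mu>\<bar> \<le> real N powr (e - 1 / 2)" "\<bar>1 - m2\<bar> \<le> real N powr (e - 1 / 2)"
            using t by (auto simp: G_def G1_def G2_def \<mu>_def m2_def not_less)
          ultimately have \<mu>: "\<bar>\<mu>\<bar> * sqrt N \<le> L" and m2: "\<bar>1 - m2\<bar> * sqrt N \<le> L"
            by (metis mult_right_mono of_nat_0_le_iff real_sqrt_ge_zero)+
          have v: "\<bar>m2 - \<mu>\<^sup>2 - 1\<bar> * sqrt N \<le> 2 * L\<^sup>2"
          proof -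
            have "1 * (\<mu>\<^sup>2 * sqrt N) \<le> sqrt N * (\<mu>\<^sup>2 * sqrt N)" using Nr by (intro mult_right_mono) auto
            also have "\<dots> = (\<bar>\<mu>\<bar> * sqrt N)\<^sup>2" by (simp add: power_mult_distrib)
            also have "\<dots> \<le> L\<^sup>2" using \<mu> by (intro power_mono) auto
            finally have 1: "\<mu>\<^sup>2 * sqrt N \<le> L\<^sup>2" by simp
            have "\<bar>m2 - \<mu>\<^sup>2 - 1\<bar> \<le> \<bar>1 - m2\<bar> + \<mu>\<^sup>2" using zero_le_power2[of \<mu>] by linarith
            then have "\<bar>m2 - \<mu>\<^sup>2 - 1\<bar> * sqrt N \<le> (\<bar>1 - m2\<bar> + \<mu>\<^sup>2) * sqrt N" by (intro mult_right_mono) auto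
            also have "\<dots> \<le> L + L\<^sup>2" using m2 1 by (simp add: distrib_right)
            also have "\<dots> \<le> 2 * L\<^sup>2" using L1 by (simp add: power2_eq_square)
            finally show ?thesis .
          qed
          have sP: "sets (iid (P N t) I) = sets (iid borel I)"
            by (rule sets_PiM_cong) (use law[OF tT] in auto)
          then have spP: "space (iid (P N t) I) = space (iid borel I)" by (rule sets_eq_imp_space_eq)
          let ?B' = "{x \<in> space (iid (P N t) I). C * rate (9 * L\<^sup>2) N z < local_law_error N (entry_matrix N x) z}"
          have "?B' = {x \<in> space (iid borel I). C * rate (9 * L\<^sup>2) N z < local_law_error N (entry_matrix N x) z}"
            unfolding spP ..
          also have "\<dots> \<in> sets (iid borel I)" by measurable
          finally have B': "?B' \<in> sets (iid (P N t) I)" unfolding sP .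
          have "emeasure (iid (P N t) I) B \<le> emeasure (iid (P N t) I) ?B'"
            by (rule emeasure_mono[OF _ B']) (use bnd in \<open>auto simp: B_def spP\<close>)
          also have "\<dots> \<le> ennreal (12 * real N ^ 6 * (tc / L ^ (2 * p)))"
            unfolding I_def tc_def by (rule iid[OF _ N cl L1 \<mu> v zs(1-3) small]) (use True in \<open>simp add: N1_def\<close>)
          also have "\<dots> \<le> ennreal (12 * \<bar>tc\<bar> * real N powr (- \<Delta>))"
          proof (rule ennreal_leI)
            have "12 * real N ^ 6 * (tc / L ^ (2 * p)) = 12 * tc * (real N ^ 6 / L ^ (2 * p))" by simp
            also have "\<dots> \<le> 12 * \<bar>tc\<bar> * (real N ^ 6 / L ^ (2 * p))" using L1 by (intro mult_right_mono) auto
            also have "\<dots> \<le> 12 * \<bar>tc\<bar> * real N powr (- \<Delta>)"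
              unfolding L_def by (intro mult_left_mono powr_div_le Nr pe) auto
            finally show "12 * real N ^ 6 * (tc / L ^ (2 * p)) \<le> 12 * \<bar>tc\<bar> * real N powr (- \<Delta>)" .
          qed
          finally show ?thesis .
        qed
        have "?A = {\<omega> \<in> space M. (\<lambda>q\<in>I. X q \<omega>) \<in> B}"
          using X(2) by (auto simp: B_def b_def I_def space_PiM)
        then have "emeasure M ?A = emeasure M {\<omega> \<in> space M. (\<lambda>q\<in>I. X q \<omega>) \<in> B}" by simp
        also have "\<dots> \<le> ennreal (2 * K (2 * q) * real N powr (- \<Delta>)) + ennreal (12 * \<bar>tc\<bar> * real N powr (- \<Delta>))"
          by (rule de_finetti_tail[OF X(1)[folded I_def] B Gs Gc Gb])
        also have "\<dots> = ennreal ((2 * K (2 * q) + 12 * \<bar>tc\<bar>) * real N powr (- \<Delta>))"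
          using K by (simp add: ennreal_plus[symmetric] distrib_right del: ennreal_plus)
        also have "\<dots> \<le> ennreal (C' * real N powr (- \<Delta>))"
          by (intro ennreal_leI mult_right_mono) (simp_all add: C'_def)
        finally show ?thesis .
      qed
    qed
    then show ?thesis using C'0 by blast
  qed
qed

text \<open>A constant factor is absorbed into \<open>N powr (\<epsilon> / 2)\<close> for large \<open>N\<close>, and the remaining \<open>N\<close> into the constant.\<close>

lemma stoch_dominated_weaken:
  assumes M: "prob_space M" and X: "stoch_dominated M U X Y"
    and sub: "\<And>N. N \<ge> 1 \<Longrightarrow> U' N \<subseteq> U N" and c: "c > 0"
    and Y: "\<And>N u \<omega>. N \<ge> 1 \<Longrightarrow> u \<in> U' N \<Longrightarrow> \<omega> \<in> space M \<Longrightarrow> Y N u \<omega> \<le> c * Y' N u \<omega>"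
    and Y': "\<And>N u. N \<ge> 1 \<Longrightarrow> u \<in> U' N \<Longrightarrow> Y' N u \<in> borel_measurable M"
      "\<And>N u \<omega>. N \<ge> 1 \<Longrightarrow> u \<in> U' N \<Longrightarrow> \<omega> \<in> space M \<Longrightarrow> Y' N u \<omega> \<ge> 0"
  shows "stoch_dominated M U' X Y'"
proof -
  have meas: "X N u \<in> borel_measurable M" "Y N u \<in> borel_measurable M" if "N \<ge> 1" "u \<in> U' N" for N u
    using X sub[OF that(1)] that unfolding stoch_dominated_def by blast+
  have "\<exists>C\<ge>0. \<forall>N\<ge>1. (SUP u\<in>U' N. emeasure M {\<omega> \<in> space M. cmod (X N u \<omega>) > real N powr \<epsilon> * Y' N u \<omega>}) \<le> ennreal (C * real N powr (- \<Delta>))"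
    if pos: "\<epsilon> > 0" "\<Delta> > 0" for \<epsilon> \<Delta> :: real
  proof -
    obtain C where C: "C \<ge> 0" "\<And>N. N \<ge> 1 \<Longrightarrow>
      (SUP u\<in>U N. emeasure M {\<omega> \<in> space M. cmod (X N u \<omega>) > real N powr (\<epsilon> / 2) * Y N u \<omega>}) \<le> ennreal (C * real N powr (- \<Delta>))"
      using X pos unfolding stoch_dominated_def by (meson half_gt_zero)
    define N1 where "N1 = max 1 (c powr (1 / (\<epsilon> / 2)))"
    have "emeasure M {\<omega> \<in> space M. cmod (X N u \<omega>) > real N powr \<epsilon> * Y' N u \<omega>} \<le> ennreal ((C + N1 powr \<Delta>) * real N powr (- \<Delta>))"
      (is "emeasure M ?A \<le> _") if N: "N \<ge> 1" and u: "u \<in> U' N" for N u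
    proof (cases "real N \<ge> N1")
      case True
      have c': "c \<le> real N powr (\<epsilon> / 2)" by (rule powr_ge_of_base) (use True pos c in \<open>auto simp: N1_def\<close>)
      have sq: "real N powr \<epsilon> = real N powr (\<epsilon> / 2) * real N powr (\<epsilon> / 2)" by (simp add: powr_add[symmetric])
      have "?A \<subseteq> {\<omega> \<in> space M. cmod (X N u \<omega>) > real N powr (\<epsilon> / 2) * Y N u \<omega>}"
      proof safe
        fix \<omega> assume \<omega>: "\<omega> \<in> space M" "real N powr \<epsilon> * Y' N u \<omega> < cmod (X N u \<omega>)"
        have "real N powr (\<epsilon> / 2) * Y N u \<omega> \<le> real N powr (\<epsilon> / 2) * (real N powr (\<epsilon> / 2) * Y' N u \<omega>)"
          using Y[OF N u \<omega>(1)] mult_right_mono[OF c' Y'(2)[OF N u \<omega>(1)]] by (intro mult_left_mono) auto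
        then show "real N powr (\<epsilon> / 2) * Y N u \<omega> < cmod (X N u \<omega>)" using \<omega>(2) by (simp add: sq mult.assoc)
      qed
      moreover have "{\<omega> \<in> space M. cmod (X N u \<omega>) > real N powr (\<epsilon> / 2) * Y N u \<omega>} \<in> sets M"
        using meas[OF N u] by measurable
      ultimately have "emeasure M ?A \<le> emeasure M {\<omega> \<in> space M. cmod (X N u \<omega>) > real N powr (\<epsilon> / 2) * Y N u \<omega>}"
        by (rule emeasure_mono)
      also have "\<dots> \<le> (SUP u\<in>U N. emeasure M {\<omega> \<in> space M. cmod (X N u \<omega>) > real N powr (\<epsilon> / 2) * Y N u \<omega>})"
        using u sub[OF N] by (intro SUP_upper) auto
      also have "\<dots> \<le> ennreal (C * real N powr (- \<Delta>))" by (rule C(2)[OF N])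
      also have "\<dots> \<le> ennreal ((C + N1 powr \<Delta>) * real N powr (- \<Delta>))" by (intro ennreal_leI mult_right_mono) auto
      finally show ?thesis .
    next
      case False
      have "N1 powr (- \<Delta>) \<le> real N powr (- \<Delta>)" using False N pos by (intro powr_mono2') auto
      then have "N1 powr \<Delta> * N1 powr (- \<Delta>) \<le> (C + N1 powr \<Delta>) * real N powr (- \<Delta>)"
        using C by (intro mult_mono) auto
      moreover have "N1 powr \<Delta> * N1 powr (- \<Delta>) = 1" by (simp add: N1_def powr_add[symmetric])
      ultimately have "ennreal 1 \<le> ennreal ((C + N1 powr \<Delta>) * real N powr (- \<Delta>))" by (intro ennreal_leI) simp
      then show ?thesis using order_trans[OF prob_space.emeasure_le_1[OF M, of ?A]] by (simp only: ennreal_1)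
    qed
    then show ?thesis using C(1) by (intro exI[of _ "C + N1 powr \<Delta>"]) (auto intro!: SUP_least)
  qed
  then show ?thesis using meas(1) Y' unfolding stoch_dominated_def by blast
qed

theorem theorem11:
  fixes \<tau> :: real
    and M :: "'a measure"
    and T :: "nat \<Rightarrow> 't measure"
    and P :: "nat \<Rightarrow> 't \<Rightarrow> real measure"
    and H :: "nat \<Rightarrow> 'a \<Rightarrow> real mat"
  assumes "0 < \<tau>" and "\<tau> < 1"
    and "curie_weiss_type M T P H"
  shows
    "stoch_dominated M (spectral_domain \<tau>)
       (\<lambda>N z \<omega>. complex_of_real
          (max (Lambda (H N \<omega>) z) (cmod (normalized_trace (H N \<omega>) z - stieltjes semicircle z))))
       (\<lambda>N z \<omega>. (1 / sqrt (real N * Im z)) /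
          sqrt (\<bar>\<bar>Re z\<bar> - 2\<bar> + Im z + 1 / sqrt (real N * Im z)))
     \<and>
     stoch_dominated M (bulk_domain \<tau>)
       (\<lambda>N z \<omega>. complex_of_real
          (max (Lambda (H N \<omega>) z) (cmod (normalized_trace (H N \<omega>) z - stieltjes semicircle z))))
       (\<lambda>N z \<omega>. 1 / sqrt (real N * Im z))"
proof
  have Im_pos: "Im z > 0" if "N \<ge> 1" "z \<in> spectral_domain \<tau> N" for N z
  proof -
    have "0 < 1 / real N" using that by simp
    then show ?thesis using spectral_domain_scale(2)[OF assms(1,2) that] by linarith
  qed
  have M: "prob_space M"
    using curie_weiss_entry_matrix[OF assms(3), of 1] by (auto simp: de_finetti_type_def)
  show global: "stoch_dominated M (spectral_domain \<tau>)
       (\<lambda>N z \<omega>. complex_of_real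
          (max (Lambda (H N \<omega>) z) (cmod (normalized_trace (H N \<omega>) z - stieltjes semicircle z))))
       (\<lambda>N z \<omega>. (1 / sqrt (real N * Im z)) /
          sqrt (\<bar>\<bar>Re z\<bar> - 2\<bar> + Im z + 1 / sqrt (real N * Im z)))"
    unfolding stoch_dominated_def law_error_def[symmetric] edge_scale_def[symmetric]
  proof (intro conjI allI impI ballI)
    fix N z assume N: "N \<ge> 1" and z: "z \<in> spectral_domain \<tau> N"
    note pos = Im_pos[OF N z]
    show "(\<lambda>\<omega>. complex_of_real (law_error (H N \<omega>) z)) \<in> borel_measurable M"
      using curie_weiss_error_measurable[OF assms(3) N less_imp_neq[OF pos, symmetric]] by measurable
    show "(\<lambda>\<omega>. 1 / sqrt (real N * Im z) / sqrt (edge_scale N z)) \<in> borel_measurable M" by simp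
    show "0 \<le> 1 / sqrt (real N * Im z) / sqrt (edge_scale N z)"
      using pos by (auto simp: edge_scale_def intro!: divide_nonneg_nonneg)
  next
    fix \<epsilon> \<Delta> :: real assume "\<epsilon> > 0" "\<Delta> > 0"
    from curie_weiss_tail[OF assms this] obtain C where C: "C \<ge> 0" "\<And>N z. N \<ge> 1 \<Longrightarrow> z \<in> spectral_domain \<tau> N \<Longrightarrow>
      emeasure M {\<omega> \<in> space M. real N powr \<epsilon> * rate 1 N z < law_error (H N \<omega>) z}
        \<le> ennreal (C * real N powr (- \<Delta>))" by blast
    have abs: "cmod (complex_of_real (law_error A z)) = law_error A z" for A z
      by (simp add: law_error_def le_max_iff_disj)
    show "\<exists>C\<ge>0. \<forall>N\<ge>1. (SUP z\<in>spectral_domain \<tau> N. emeasure M {\<omega> \<in> space M.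
        real N powr \<epsilon> * rate 1 N z < cmod (complex_of_real (law_error (H N \<omega>) z))})
      \<le> ennreal (C * real N powr (- \<Delta>))"
      unfolding abs using C by (intro exI[of _ C]) (auto intro!: SUP_least)
  qed
  show "stoch_dominated M (bulk_domain \<tau>)
       (\<lambda>N z \<omega>. complex_of_real
          (max (Lambda (H N \<omega>) z) (cmod (normalized_trace (H N \<omega>) z - stieltjes semicircle z))))
       (\<lambda>N z \<omega>. 1 / sqrt (real N * Im z))"
  proof (rule stoch_dominated_weaken[OF M global])
    have "(2 - \<tau>) * \<tau> \<le> 1" using zero_le_power2[of "1 - \<tau>"] by (simp add: power2_eq_square algebra_simps)
    then have "2 - \<tau> \<le> 1 / \<tau>" using assms by (simp add: le_divide_eq)
    then show sub: "bulk_domain \<tau> N \<subseteq> spectral_domain \<tau> N" for N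
      by (auto simp: bulk_domain_def spectral_domain_def)
    show "0 < 1 / sqrt \<tau>" using assms by simp
    fix N z \<omega> assume N: "N \<ge> 1" and z: "z \<in> bulk_domain \<tau> N"
    have pos: "Im z > 0" using Im_pos[OF N] sub z by blast
    show "0 \<le> 1 / sqrt (real N * Im z)" using pos by simp
    have "\<bar>Re z\<bar> \<le> 2 - \<tau>" using z by (auto simp: bulk_domain_def abs_le_iff)
    then have "\<tau> \<le> \<bar>\<bar>Re z\<bar> - 2\<bar> + Im z + 1 / sqrt (real N * Im z)"
      using pos by (intro add_increasing2) auto
    then have "sqrt \<tau> \<le> sqrt (\<bar>\<bar>Re z\<bar> - 2\<bar> + Im z + 1 / sqrt (real N * Im z))" by simp
    then have "1 / sqrt (real N * Im z) / sqrt (\<bar>\<bar>Re z\<bar> - 2\<bar> + Im z + 1 / sqrt (real N * Im z)) \<le> 1 / sqrt (real N * Im z) / sqrt \<tau>"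
      using pos assms by (intro divide_left_mono) (auto intro!: mult_pos_pos)
    then show "1 / sqrt (real N * Im z) / sqrt (\<bar>\<bar>Re z\<bar> - 2\<bar> + Im z + 1 / sqrt (real N * Im z)) \<le> 1 / sqrt \<tau> * (1 / sqrt (real N * Im z))"
      by (simp add: mult.commute)
  qed simp
qed

end
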